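(* Let $\mathscr C$ be an additive category, $\mathbb E:\mathscr C^{op}\times\mathscr C\to Ab$ a biadditive functor, and let $\mathfrak s$ be a correspondence assigning to each $\delta\in\mathbb E(C,A)$ ($A,C\in\mathscr C$) a class $\mathfrak s(\delta)$ of sequences of the form $A\to B\to C$ in $\mathscr C$. Then the triplet $(\mathscr C,\mathbb E,\mathfrak s)$ is a $1$-exangulated category if and only if it is an extriangulated category.
   Context: **$n$-exangulated categories** (used here with $n=1$). Let $n\ge1$, $\mathscr C$ additive, $\mathbb E:\mathscr C^{op}\times\mathscr C\to Ab$ biadditive. Extensions: an element $\delta\in\mathbb E(C,A)$ is an extension; for $a:A\to A'$, $c:C'\to C$ put $a_*\delta=\mathbb E(C,a)(\delta)$, $c^*\delta=\mathbb E(c,A)(\delta)$. For $\delta\in\mathbb E(C,A)$, $\rho\in\mathbb E(D,B)$ a morphism of extensions $(a,c):\delta\to\rho$ is a pair $a:A\to B$, $c:C\to D$ with $a_*\delta=c^*\rho$. Put $\delta_\sharp:\mathscr C(-,C)\to\mathbb E(-,A)$, $f\mapsto f^*\delta$, and $\delta^\sharp:\mathscr C(A,-)\to\mathbb E(C,-)$, $g\mapsto g_*\delta$. $\delta\oplus\rho\in\mathbb E(C\oplus D,A\oplus B)$ is the element corresponding to $(\delta,0,0,\rho)$ in $\mathbb E(C,A)\oplus\mathbb E(C,B)\oplus\mathbb E(D,A)\oplus\mathbb E(D,B)$. Complexes: $\mathbf C^{n+2}_{\mathscr C}$ is the category of complexes $X^\bullet=(X^0\xrightarrow{d_X^0}\cdots\xrightarrow{d_X^n}X^{n+1})$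 concentrated in degrees $0,\dots,n+1$, with usual chain homotopy. $\mathbf C^{n+2}_{(A,C)}$ has as objects the complexes with $X^0=A$, $X^{n+1}=C$ and as morphisms the chain maps with $f^0=1_A$, $f^{n+1}=1_C$; homotopy is the same relation, homotopy equivalences are taken within this category, and $[X^\bullet]$ is the homotopy equivalence class in it. $n$-exangles: a pair $\langle X^\bullet,\delta\rangle$ with $\delta\in\mathbb E(X^{n+1},X^0)$ is an $n$-exangle if $\mathscr C(-,X^0)\to\cdots\to\mathscr C(-,X^{n+1})\xrightarrow{\delta_\sharp}\mathbb E(-,X^0)$ and $\mathscr C(X^{n+1},-)\to\cdots\to\mathscr C(X^0,-)\xrightarrow{\delta^\sharp}\mathbb E(X^{n+1},-)$ are exact (at all inner terms). Exact realization: a correspondence $\mathfrak s$ assigning to each $\delta\in\mathbb E(C,A)$ a homotopy equivalence class $\mathfrak s(\delta)=[X^\bullet]$ of an object of $\mathbf C^{n+2}_{(A,C)}$ such that: (R0) if $\mathfrak s(\delta)=[X^\bullet]$, $\mathfrak s(\rho)=[Y^\bullet]$, every morphism $(a,c):\delta\to\rho$ has a lift, i.e. a chain map $f^\bullet:X^\bullet\to Y^\bullet$ with $f^0=a$, $f^{n+1}=c$; (R1) $\mathfrak s(\delta)=[X^\bullet]$ implies $\langle X^\bullet,\delta\rangle$ is an $n$-exangle; (R2) $0\in\mathbb E(0,A)$ has $\mathfrak s(0)=[A\xrightarrow{1}A\to0\to\cdots\to0]$ and $0\in\mathbb E(A,0)$ has $\mathfrak s(0)=[0\to\cdots\to0\to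 A\xrightarrow{1}A]$. If $\mathfrak s(\delta)=[X^\bullet]$, $\langle X^\bullet,\delta\rangle$ is called distinguished, $d_X^0$ an inflation, $d_X^n$ a deflation. Cones: for $f^\bullet:X^\bullet\to Y^\bullet$ with $f^0=1$, $M_f^\bullet$ is $X^1\to X^2\oplus Y^1\to\cdots\to X^{n+1}\oplus Y^n\to Y^{n+1}$ with $d^0=\begin{bmatrix}-d_X^1\\ f^1\end{bmatrix}$, $d^i=\begin{bmatrix}-d_X^{i+1}&0\\ f^{i+1}&d_Y^i\end{bmatrix}$, $d^n=[f^{n+1}\ d_Y^n]$. Dually for $h^\bullet$ with $h^{n+1}=1$, the mapping cocone is $X^0\to X^1\oplus Y^0\to\cdots\to X^n\oplus Y^{n-1}\to Y^n$ with $\begin{bmatrix}d_X^0\\ h^0\end{bmatrix}$, $\begin{bmatrix}d_X^i&0\\ h^i&-d_Y^{i-1}\end{bmatrix}$, $[h^n\ -d_Y^{n-1}]$. $(\mathscr C,\mathbb E,\mathfrak s)$ is $n$-exangulated if $\mathfrak s$ is an exact realization and: (EA1) inflations are closed under composition, and so are deflations; (EA2) for $\rho\in\mathbb E(D,A)$, $c:C\to D$ and distinguished $\langle X^\bullet,c^*\rho\rangle$, $\langle Y^\bullet,\rho\rangle$, $(1_A,c)$ has a lift $f^\bullet$ such that $\langle M_f^\bullet,(d_X^0)_*\rho\rangle$ is distinguished; (EA2$^{op}$) for $\delta\in\mathbb E(C,A)$, $a:A\to B$ and distinguished $\langle X^\bullet,\delta\rangle$, $\langle Y^\bullet,a_*\delta\rangle$,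 $(a,1_C)$ has a lift whose mapping cocone with extension $(d_Y^n)^*\delta$ is distinguished. **Extriangulated categories (Nakaoka–Palu).** Two sequences $A\xrightarrow{x}B\xrightarrow{y}C$, $A\xrightarrow{x'}B'\xrightarrow{y'}C$ are equivalent if there is an isomorphism $b:B\to B'$ with $bx=x'$, $y'b=y$; here $[A\xrightarrow{x}B\xrightarrow{y}C]$ is the equivalence class. $(\mathscr C,\mathbb E,\mathfrak s)$ is extriangulated if: (ET1) $\mathbb E$ is a biadditive functor. (ET2) $\mathfrak s$ assigns to each $\delta\in\mathbb E(C,A)$ an equivalence class $[A\to B\to C]$ and is an additive realization: (i) for $\mathfrak s(\delta)=[A\xrightarrow{x}B\xrightarrow{y}C]$, $\mathfrak s(\delta')=[A'\xrightarrow{x'}B'\xrightarrow{y'}C']$ and a morphism $(a,c):\delta\to\delta'$ there is $b:B\to B'$ with $bx=x'a$, $y'b=cy$; (ii) $\mathfrak s(0)=[A\xrightarrow{\left[\begin{smallmatrix}1\\0\end{smallmatrix}\right]}A\oplus C\xrightarrow{[0\ 1]}C]$ for $0\in\mathbb E(C,A)$; (iii) $\mathfrak s(\delta\oplus\delta')=[A\oplus A'\xrightarrow{x\oplus x'}B\oplus B'\xrightarrow{y\oplus y'}C\oplus C']$. (ET3) With notation as in (i), if $a:A\to A'$, $b:B\to B'$ satisfy $bx=x'a$, there is $c:C\to C'$ with $a_*\delta=c^*\delta'$ and $cy=y'b$. (ET3$^{op}$) Dually, if $b,c$ satisfy $cy=y'b$, there is $a$ with $a_*\delta=c^*\delta'$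 and $bx=x'a$. (ET4) If $\delta\in\mathbb E(D,A)$, $\delta'\in\mathbb E(F,B)$ are realized by $A\xrightarrow{f}B\xrightarrow{f'}D$ and $B\xrightarrow{g}C\xrightarrow{g'}F$, there are $E\in\mathscr C$, morphisms $h=gf$, $h':C\to E$, $d:D\to E$, $e:E\to F$ with $df'=h'g$, $eh'=g'$, and $\delta''\in\mathbb E(E,A)$ realized by $A\xrightarrow{h}C\xrightarrow{h'}E$, such that $D\xrightarrow{d}E\xrightarrow{e}F$ realizes $f'_*\delta'$, $d^*\delta''=\delta$, and $f_*\delta''=e^*\delta'$. (ET4$^{op}$) If $\delta\in\mathbb E(B,D)$, $\delta'\in\mathbb E(C,F)$ are realized by $D\xrightarrow{f'}A\xrightarrow{f}B$ and $F\xrightarrow{g'}B\xrightarrow{g}C$, there are $E$, $h=gf$, $h':E\to A$, $d:D\to E$, $e:E\to F$ with $h'd=f'$, $fh'=g'e$, and $\delta''\in\mathbb E(C,E)$ realized by $E\xrightarrow{h'}A\xrightarrow{h}C$, such that $D\xrightarrow{d}E\xrightarrow{e}F$ realizes $g'^*\delta$, $e_*\delta''=\delta'$, and $d_*\delta=g^*\delta''$. *)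

theory Defs
  imports "HOL-Algebra.Group"
begin

section \<open>Additive categories\<close>

text \<open>
  Hom-sets and extension groups are abelian groups in the sense of HOL-Algebra
  (\<^const>\<open>comm_group\<close>), which writes them multiplicatively: the group operation is the
  addition of morphisms (extensions), \<open>\<one>\<close> is the zero morphism (extension) and \<open>inv\<close> is
  negation. \<open>Cmp \<C> g f\<close> is the composite of \<open>f\<close> followed by \<open>g\<close>.
\<close>

record ('o, 'm) precat =
  Obj :: "'o set"
  Mor :: "'o \<Rightarrow> 'o \<Rightarrow> 'm monoid"
  Idn :: "'o \<Rightarrow> 'm"
  Cmp :: "'m \<Rightarrow> 'm \<Rightarrow> 'm"

locale preadditive_category =
  fixes \<C> :: "('o, 'm) precat"
  assumes Mor_comm_group:
      "\<And>A B. \<lbrakk>A \<in> Obj \<C>; B \<in> Obj \<C>\<rbrakk> \<Longrightarrow> comm_group (Mor \<C> A B)"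
    and Mor_disjoint:
      "\<And>A B A' B' f. \<lbrakk>A \<in> Obj \<C>; B \<in> Obj \<C>; A' \<in> Obj \<C>; B' \<in> Obj \<C>;
         f \<in> carrier (Mor \<C> A B); f \<in> carrier (Mor \<C> A' B')\<rbrakk> \<Longrightarrow> A = A' \<and> B = B'"
    and Idn_in: "\<And>A. A \<in> Obj \<C> \<Longrightarrow> Idn \<C> A \<in> carrier (Mor \<C> A A)"
    and Cmp_in:
      "\<And>A B C f g. \<lbrakk>A \<in> Obj \<C>; B \<in> Obj \<C>; C \<in> Obj \<C>;
         f \<in> carrier (Mor \<C> A B); g \<in> carrier (Mor \<C> B C)\<rbrakk>
         \<Longrightarrow> Cmp \<C> g f \<in> carrier (Mor \<C> A C)"
    and Cmp_Idn_left:
      "\<And>A B f. \<lbrakk>A \<in> Obj \<C>; B \<in> Obj \<C>; f \<in> carrier (Mor \<C> A B)\<rbrakk>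
         \<Longrightarrow> Cmp \<C> (Idn \<C> B) f = f"
    and Cmp_Idn_right:
      "\<And>A B f. \<lbrakk>A \<in> Obj \<C>; B \<in> Obj \<C>; f \<in> carrier (Mor \<C> A B)\<rbrakk>
         \<Longrightarrow> Cmp \<C> f (Idn \<C> A) = f"
    and Cmp_assoc:
      "\<And>A B C D f g h. \<lbrakk>A \<in> Obj \<C>; B \<in> Obj \<C>; C \<in> Obj \<C>; D \<in> Obj \<C>;
         f \<in> carrier (Mor \<C> A B); g \<in> carrier (Mor \<C> B C); h \<in> carrier (Mor \<C> C D)\<rbrakk>
         \<Longrightarrow> Cmp \<C> h (Cmp \<C> g f) = Cmp \<C> (Cmp \<C> h g) f"
    and Cmp_add_left:
      "\<And>A B C f g g'. \<lbrakk>A \<in> Obj \<C>; B \<in> Obj \<C>; C \<in> Obj \<C>;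
         f \<in> carrier (Mor \<C> A B); g \<in> carrier (Mor \<C> B C); g' \<in> carrier (Mor \<C> B C)\<rbrakk>
         \<Longrightarrow> Cmp \<C> (g \<otimes>\<^bsub>Mor \<C> B C\<^esub> g') f = Cmp \<C> g f \<otimes>\<^bsub>Mor \<C> A C\<^esub> Cmp \<C> g' f"
    and Cmp_add_right:
      "\<And>A B C f f' g. \<lbrakk>A \<in> Obj \<C>; B \<in> Obj \<C>; C \<in> Obj \<C>;
         f \<in> carrier (Mor \<C> A B); f' \<in> carrier (Mor \<C> A B); g \<in> carrier (Mor \<C> B C)\<rbrakk>
         \<Longrightarrow> Cmp \<C> g (f \<otimes>\<^bsub>Mor \<C> A B\<^esub> f') = Cmp \<C> g f \<otimes>\<^bsub>Mor \<C> A C\<^esub> Cmp \<C> g f'"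
begin

abbreviation arr :: "'o \<Rightarrow> 'o \<Rightarrow> 'm set"
  where "arr A B \<equiv> carrier (Mor \<C> A B)"

abbreviation cmp :: "'m \<Rightarrow> 'm \<Rightarrow> 'm"  (infixr "\<cdot>" 75)
  where "g \<cdot> f \<equiv> Cmp \<C> g f"

abbreviation zmor :: "'o \<Rightarrow> 'o \<Rightarrow> 'm"
  where "zmor A B \<equiv> \<one>\<^bsub>Mor \<C> A B\<^esub>"

definition is_zero_object :: "'o \<Rightarrow> bool" where
  "is_zero_object Z \<longleftrightarrow> Z \<in> Obj \<C> \<and>
     (\<forall>A \<in> Obj \<C>. (\<exists>!f. f \<in> arr Z A) \<and> (\<exists>!f. f \<in> arr A Z))"

definition is_iso :: "'o \<Rightarrow> 'o \<Rightarrow> 'm \<Rightarrow> bool" where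
  "is_iso A B f \<longleftrightarrow> f \<in> arr A B \<and> (\<exists>g \<in> arr B A. g \<cdot> f = Idn \<C> A \<and> f \<cdot> g = Idn \<C> B)"

end

datatype ('o, 'm) biprod_data =
  Biprod (bsum: 'o) (in1: 'm) (in2: 'm) (pr1: 'm) (pr2: 'm)

definition (in preadditive_category) is_biproduct ::
    "'o \<Rightarrow> 'o \<Rightarrow> ('o, 'm) biprod_data \<Rightarrow> bool" where
  "is_biproduct A B P \<longleftrightarrow>
     bsum P \<in> Obj \<C> \<and>
     in1 P \<in> arr A (bsum P) \<and> in2 P \<in> arr B (bsum P) \<and>
     pr1 P \<in> arr (bsum P) A \<and> pr2 P \<in> arr (bsum P) B \<and>
     pr1 P \<cdot> in1 P = Idn \<C> A \<and> pr2 P \<cdot> in2 P = Idn \<C> B \<and>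
     pr2 P \<cdot> in1 P = zmor A B \<and> pr1 P \<cdot> in2 P = zmor B A \<and>
     (in1 P \<cdot> pr1 P) \<otimes>\<^bsub>Mor \<C> (bsum P) (bsum P)\<^esub> (in2 P \<cdot> pr2 P) = Idn \<C> (bsum P)"

locale additive_category = preadditive_category \<C>
  for \<C> :: "('o, 'm) precat" +
  assumes zero_object_exists: "\<exists>Z. is_zero_object Z"
    and biproduct_exists: "\<And>A B. \<lbrakk>A \<in> Obj \<C>; B \<in> Obj \<C>\<rbrakk> \<Longrightarrow> \<exists>P. is_biproduct A B P"
begin

text \<open>A fixed choice of biproducts \<open>A \<oplus> B\<close>.\<close>

definition biprod :: "'o \<Rightarrow> 'o \<Rightarrow> ('o, 'm) biprod_data" where
  "biprod A B = (SOME P. is_biproduct A B P)"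

abbreviation dsum :: "'o \<Rightarrow> 'o \<Rightarrow> 'o"  (infixr "\<oplus>\<oplus>" 70)
  where "A \<oplus>\<oplus> B \<equiv> bsum (biprod A B)"

text \<open>
  Matrices of morphisms: \<open>col T A B f g\<close> is the column \<open>T \<rightarrow> A \<oplus> B\<close> with entries
  \<open>f : T \<rightarrow> A\<close>, \<open>g : T \<rightarrow> B\<close>; \<open>row A B T f g\<close> is the row \<open>A \<oplus> B \<rightarrow> T\<close> with entries
  \<open>f : A \<rightarrow> T\<close>, \<open>g : B \<rightarrow> T\<close>; \<open>mat A B A' B' a b c d\<close> is the matrix
  \<open>A \<oplus> B \<rightarrow> A' \<oplus> B'\<close> with first line \<open>a b\<close> and second line \<open>c d\<close>.
\<close>

definition col :: "'o \<Rightarrow> 'o \<Rightarrow> 'o \<Rightarrow> 'm \<Rightarrow> 'm \<Rightarrow> 'm" where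
  "col T A B f g =
     (in1 (biprod A B) \<cdot> f) \<otimes>\<^bsub>Mor \<C> T (A \<oplus>\<oplus> B)\<^esub> (in2 (biprod A B) \<cdot> g)"

definition row :: "'o \<Rightarrow> 'o \<Rightarrow> 'o \<Rightarrow> 'm \<Rightarrow> 'm \<Rightarrow> 'm" where
  "row A B T f g =
     (f \<cdot> pr1 (biprod A B)) \<otimes>\<^bsub>Mor \<C> (A \<oplus>\<oplus> B) T\<^esub> (g \<cdot> pr2 (biprod A B))"

definition mat :: "'o \<Rightarrow> 'o \<Rightarrow> 'o \<Rightarrow> 'o \<Rightarrow> 'm \<Rightarrow> 'm \<Rightarrow> 'm \<Rightarrow> 'm \<Rightarrow> 'm" where
  "mat A B A' B' a b c d = row A B (A' \<oplus>\<oplus> B') (col A A' B' a c) (col B A' B' b d)"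

definition dsum_mor :: "'o \<Rightarrow> 'o \<Rightarrow> 'o \<Rightarrow> 'o \<Rightarrow> 'm \<Rightarrow> 'm \<Rightarrow> 'm" where
  "dsum_mor A A' B B' f f' = mat A A' B B' f (zmor A' B) (zmor A B') f'"

end


section \<open>Complexes\<close>

text \<open>
  A sequence \<open>X\<^sup>0 \<rightarrow> \<cdots> \<rightarrow> X\<^sup>n\<^sup>+\<^sup>1\<close> is stored as the list of its \<open>n + 2\<close> objects together with
  the list of its \<open>n + 1\<close> morphisms; \<open>Sq [A, B, C] [x, y]\<close> is \<open>A \<rightarrow> B \<rightarrow> C\<close>.
\<close>

datatype ('o, 'm) sq = Sq (objs: "'o list") (mors: "'m list")

abbreviation ob :: "('o, 'm) sq \<Rightarrow> nat \<Rightarrow> 'o" where "ob X i \<equiv> objs X ! i"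
abbreviation df :: "('o, 'm) sq \<Rightarrow> nat \<Rightarrow> 'm" where "df X i \<equiv> mors X ! i"

context preadditive_category
begin

definition is_seq :: "nat \<Rightarrow> ('o, 'm) sq \<Rightarrow> bool" where
  "is_seq n X \<longleftrightarrow> length (objs X) = n + 2 \<and> length (mors X) = n + 1 \<and>
     set (objs X) \<subseteq> Obj \<C> \<and> (\<forall>i \<le> n. df X i \<in> arr (ob X i) (ob X (i + 1)))"

definition is_complex :: "nat \<Rightarrow> ('o, 'm) sq \<Rightarrow> bool" where
  "is_complex n X \<longleftrightarrow> is_seq n X \<and>
     (\<forall>i < n. df X (i + 1) \<cdot> df X i = zmor (ob X i) (ob X (i + 2)))"

definition chain_map :: "nat \<Rightarrow> ('o, 'm) sq \<Rightarrow> ('o, 'm) sq \<Rightarrow> (nat \<Rightarrow> 'm) \<Rightarrow> bool" where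
  "chain_map n X Y f \<longleftrightarrow>
     (\<forall>i \<le> n + 1. f i \<in> arr (ob X i) (ob Y i)) \<and>
     (\<forall>i \<le> n. f (i + 1) \<cdot> df X i = df Y i \<cdot> f i)"

definition homotopic ::
    "nat \<Rightarrow> ('o, 'm) sq \<Rightarrow> ('o, 'm) sq \<Rightarrow> (nat \<Rightarrow> 'm) \<Rightarrow> (nat \<Rightarrow> 'm) \<Rightarrow> bool" where
  "homotopic n X Y f g \<longleftrightarrow> (\<exists>\<phi>.
     (\<forall>i \<in> {1..n + 1}. \<phi> i \<in> arr (ob X i) (ob Y (i - 1))) \<and>
     f 0 \<otimes>\<^bsub>Mor \<C> (ob X 0) (ob Y 0)\<^esub> inv\<^bsub>Mor \<C> (ob X 0) (ob Y 0)\<^esub> g 0 = \<phi> 1 \<cdot> df X 0 \<and>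
     (\<forall>i \<in> {1..n}. f i \<otimes>\<^bsub>Mor \<C> (ob X i) (ob Y i)\<^esub> inv\<^bsub>Mor \<C> (ob X i) (ob Y i)\<^esub> g i
        = (df Y (i - 1) \<cdot> \<phi> i) \<otimes>\<^bsub>Mor \<C> (ob X i) (ob Y i)\<^esub> (\<phi> (i + 1) \<cdot> df X i)) \<and>
     f (n + 1) \<otimes>\<^bsub>Mor \<C> (ob X (n + 1)) (ob Y (n + 1))\<^esub>
         inv\<^bsub>Mor \<C> (ob X (n + 1)) (ob Y (n + 1))\<^esub> g (n + 1)
       = df Y n \<cdot> \<phi> (n + 1))"

text \<open>The category \<open>\<^bold>C\<^sup>n\<^sup>+\<^sup>2\<close> with fixed end terms \<open>A\<close> and \<open>C\<close>.\<close>

definition is_complex_AC :: "nat \<Rightarrow> 'o \<Rightarrow> 'o \<Rightarrow> ('o, 'm) sq \<Rightarrow> bool" where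
  "is_complex_AC n A C X \<longleftrightarrow> is_complex n X \<and> ob X 0 = A \<and> ob X (n + 1) = C"

definition chain_map_AC ::
    "nat \<Rightarrow> 'o \<Rightarrow> 'o \<Rightarrow> ('o, 'm) sq \<Rightarrow> ('o, 'm) sq \<Rightarrow> (nat \<Rightarrow> 'm) \<Rightarrow> bool" where
  "chain_map_AC n A C X Y f \<longleftrightarrow>
     chain_map n X Y f \<and> f 0 = Idn \<C> A \<and> f (n + 1) = Idn \<C> C"

definition homotopy_equivalent_AC ::
    "nat \<Rightarrow> 'o \<Rightarrow> 'o \<Rightarrow> ('o, 'm) sq \<Rightarrow> ('o, 'm) sq \<Rightarrow> bool" where
  "homotopy_equivalent_AC n A C X Y \<longleftrightarrow>
     (\<exists>f g. chain_map_AC n A C X Y f \<and> chain_map_AC n A C Y X g \<and>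
        homotopic n X X (\<lambda>i. g i \<cdot> f i) (\<lambda>i. Idn \<C> (ob X i)) \<and>
        homotopic n Y Y (\<lambda>i. f i \<cdot> g i) (\<lambda>i. Idn \<C> (ob Y i)))"

definition homotopy_class :: "nat \<Rightarrow> ('o, 'm) sq \<Rightarrow> ('o, 'm) sq set" where
  "homotopy_class n X =
     {Y. is_complex_AC n (ob X 0) (ob X (n + 1)) Y \<and>
         homotopy_equivalent_AC n (ob X 0) (ob X (n + 1)) X Y}"

end

context additive_category
begin

text \<open>Intended for chain maps \<open>f : X \<rightarrow> Y\<close> with \<open>f\<^sup>0\<close> an identity.\<close>

definition mapping_cone ::
    "nat \<Rightarrow> ('o, 'm) sq \<Rightarrow> ('o, 'm) sq \<Rightarrow> (nat \<Rightarrow> 'm) \<Rightarrow> ('o, 'm) sq" where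
  "mapping_cone n X Y f = Sq
     (ob X 1 # map (\<lambda>i. ob X (i + 1) \<oplus>\<oplus> ob Y i) [1..<n + 1] @ [ob Y (n + 1)])
     (col (ob X 1) (ob X 2) (ob Y 1) (inv\<^bsub>Mor \<C> (ob X 1) (ob X 2)\<^esub> df X 1) (f 1)
      # map (\<lambda>i. mat (ob X (i + 1)) (ob Y i) (ob X (i + 2)) (ob Y (i + 1))
                  (inv\<^bsub>Mor \<C> (ob X (i + 1)) (ob X (i + 2))\<^esub> df X (i + 1))
                  (zmor (ob Y i) (ob X (i + 2)))
                  (f (i + 1))
                  (df Y i)) [1..<n]
      @ [row (ob X (n + 1)) (ob Y n) (ob Y (n + 1)) (f (n + 1)) (df Y n)])"

text \<open>Intended for chain maps \<open>h : X \<rightarrow> Y\<close> with \<open>h\<^sup>n\<^sup>+\<^sup>1\<close> an identity.\<close>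

definition mapping_cocone ::
    "nat \<Rightarrow> ('o, 'm) sq \<Rightarrow> ('o, 'm) sq \<Rightarrow> (nat \<Rightarrow> 'm) \<Rightarrow> ('o, 'm) sq" where
  "mapping_cocone n X Y h = Sq
     (ob X 0 # map (\<lambda>i. ob X i \<oplus>\<oplus> ob Y (i - 1)) [1..<n + 1] @ [ob Y n])
     (col (ob X 0) (ob X 1) (ob Y 0) (df X 0) (h 0)
      # map (\<lambda>i. mat (ob X i) (ob Y (i - 1)) (ob X (i + 1)) (ob Y i)
                  (df X i)
                  (zmor (ob Y (i - 1)) (ob X (i + 1)))
                  (h i)
                  (inv\<^bsub>Mor \<C> (ob Y (i - 1)) (ob Y i)\<^esub> df Y (i - 1))) [1..<n]
      @ [row (ob X n) (ob Y (n - 1)) (ob Y n)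
           (h n) (inv\<^bsub>Mor \<C> (ob Y (n - 1)) (ob Y n)\<^esub> df Y (n - 1))])"

end


section \<open>Biadditive functors and extensions\<close>

text \<open>
  \<open>Ext \<E> C A\<close> is the group \<open>\<E>(C, A)\<close>, and \<open>ExtMap \<E> c a\<close> is the homomorphism
  \<open>\<E>(c, a) : \<E>(C, A) \<rightarrow> \<E>(C', A')\<close> for \<open>c : C' \<rightarrow> C\<close> and \<open>a : A \<rightarrow> A'\<close>.
  Different groups \<open>\<E>(C, A)\<close> may share elements, so an extension is always accompanied
  by its end terms below.
\<close>

record ('o, 'm, 'e) bifunctor =
  Ext :: "'o \<Rightarrow> 'o \<Rightarrow> 'e monoid"
  ExtMap :: "'m \<Rightarrow> 'm \<Rightarrow> 'e \<Rightarrow> 'e"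

locale biadditive_functor = additive_category \<C>
  for \<C> :: "('o, 'm) precat" +
  fixes \<E> :: "('o, 'm, 'e) bifunctor"
  assumes Ext_comm_group:
      "\<And>C A. \<lbrakk>C \<in> Obj \<C>; A \<in> Obj \<C>\<rbrakk> \<Longrightarrow> comm_group (Ext \<E> C A)"
    and ExtMap_hom:
      "\<And>C C' A A' c a. \<lbrakk>C \<in> Obj \<C>; C' \<in> Obj \<C>; A \<in> Obj \<C>; A' \<in> Obj \<C>;
         c \<in> arr C' C; a \<in> arr A A'\<rbrakk>
         \<Longrightarrow> ExtMap \<E> c a \<in> hom (Ext \<E> C A) (Ext \<E> C' A')"
    and ExtMap_Idn:
      "\<And>C A \<delta>. \<lbrakk>C \<in> Obj \<C>; A \<in> Obj \<C>; \<delta> \<in> carrier (Ext \<E> C A)\<rbrakk>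
         \<Longrightarrow> ExtMap \<E> (Idn \<C> C) (Idn \<C> A) \<delta> = \<delta>"
    and ExtMap_Cmp:
      "\<And>C C' C'' A A' A'' c c' a a' \<delta>.
         \<lbrakk>C \<in> Obj \<C>; C' \<in> Obj \<C>; C'' \<in> Obj \<C>; A \<in> Obj \<C>; A' \<in> Obj \<C>; A'' \<in> Obj \<C>;
          c \<in> arr C' C; c' \<in> arr C'' C'; a \<in> arr A A'; a' \<in> arr A' A'';
          \<delta> \<in> carrier (Ext \<E> C A)\<rbrakk>
         \<Longrightarrow> ExtMap \<E> (c \<cdot> c') (a' \<cdot> a) \<delta> = ExtMap \<E> c' a' (ExtMap \<E> c a \<delta>)"
    and ExtMap_add_left:
      "\<And>C C' A A' c c' a \<delta>. \<lbrakk>C \<in> Obj \<C>; C' \<in> Obj \<C>; A \<in> Obj \<C>; A' \<in> Obj \<C>;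
         c \<in> arr C' C; c' \<in> arr C' C; a \<in> arr A A'; \<delta> \<in> carrier (Ext \<E> C A)\<rbrakk>
         \<Longrightarrow> ExtMap \<E> (c \<otimes>\<^bsub>Mor \<C> C' C\<^esub> c') a \<delta>
             = ExtMap \<E> c a \<delta> \<otimes>\<^bsub>Ext \<E> C' A'\<^esub> ExtMap \<E> c' a \<delta>"
    and ExtMap_add_right:
      "\<And>C C' A A' c a a' \<delta>. \<lbrakk>C \<in> Obj \<C>; C' \<in> Obj \<C>; A \<in> Obj \<C>; A' \<in> Obj \<C>;
         c \<in> arr C' C; a \<in> arr A A'; a' \<in> arr A A'; \<delta> \<in> carrier (Ext \<E> C A)\<rbrakk>
         \<Longrightarrow> ExtMap \<E> c (a \<otimes>\<^bsub>Mor \<C> A A'\<^esub> a') \<delta>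
             = ExtMap \<E> c a \<delta> \<otimes>\<^bsub>Ext \<E> C' A'\<^esub> ExtMap \<E> c a' \<delta>"
begin

abbreviation ext :: "'o \<Rightarrow> 'o \<Rightarrow> 'e set"
  where "ext C A \<equiv> carrier (Ext \<E> C A)"

abbreviation zext :: "'o \<Rightarrow> 'o \<Rightarrow> 'e"
  where "zext C A \<equiv> \<one>\<^bsub>Ext \<E> C A\<^esub>"

text \<open>
  For \<open>\<delta> \<in> \<E>(C, A)\<close>: \<open>push C a \<delta>\<close> is \<open>a\<^sub>*\<delta>\<close> and \<open>pull A c \<delta>\<close> is \<open>c\<^sup>*\<delta>\<close>.
\<close>

definition push :: "'o \<Rightarrow> 'm \<Rightarrow> 'e \<Rightarrow> 'e" where
  "push C a \<delta> = ExtMap \<E> (Idn \<C> C) a \<delta>"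

definition pull :: "'o \<Rightarrow> 'm \<Rightarrow> 'e \<Rightarrow> 'e" where
  "pull A c \<delta> = ExtMap \<E> c (Idn \<C> A) \<delta>"

text \<open>Morphisms \<open>(a, c)\<close> from \<open>\<delta> \<in> \<E>(C, A)\<close> to \<open>\<rho> \<in> \<E>(D, B)\<close>.\<close>

definition ext_morphism ::
    "'o \<Rightarrow> 'o \<Rightarrow> 'e \<Rightarrow> 'o \<Rightarrow> 'o \<Rightarrow> 'e \<Rightarrow> 'm \<Rightarrow> 'm \<Rightarrow> bool" where
  "ext_morphism C A \<delta> D B \<rho> a c \<longleftrightarrow>
     a \<in> arr A B \<and> c \<in> arr C D \<and> push C a \<delta> = pull B c \<rho>"

text \<open>
  \<open>\<delta> \<oplus> \<rho>\<close> for \<open>\<delta> \<in> \<E>(C, A)\<close>, \<open>\<rho> \<in> \<E>(D, B)\<close>: the element whose components in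
  \<open>\<E>(C, A)\<close>, \<open>\<E>(C, B)\<close>, \<open>\<E>(D, A)\<close>, \<open>\<E>(D, B)\<close> are \<open>\<delta>, 0, 0, \<rho>\<close>.
\<close>

definition dsum_ext :: "'o \<Rightarrow> 'o \<Rightarrow> 'e \<Rightarrow> 'o \<Rightarrow> 'o \<Rightarrow> 'e \<Rightarrow> 'e" where
  "dsum_ext C A \<delta> D B \<rho> = (THE \<theta>. \<theta> \<in> ext (C \<oplus>\<oplus> D) (A \<oplus>\<oplus> B) \<and>
     ExtMap \<E> (in1 (biprod C D)) (pr1 (biprod A B)) \<theta> = \<delta> \<and>
     ExtMap \<E> (in1 (biprod C D)) (pr2 (biprod A B)) \<theta> = zext C B \<and>
     ExtMap \<E> (in2 (biprod C D)) (pr1 (biprod A B)) \<theta> = zext D A \<and>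
     ExtMap \<E> (in2 (biprod C D)) (pr2 (biprod A B)) \<theta> = \<rho>)"

text \<open>
  Exactness of the two sequences of functors, evaluated at every object \<open>T\<close>, at all terms
  but the first and the last.
\<close>

definition exangle :: "nat \<Rightarrow> ('o, 'm) sq \<Rightarrow> 'e \<Rightarrow> bool" where
  "exangle n X \<delta> \<longleftrightarrow> is_complex n X \<and> \<delta> \<in> ext (ob X (n + 1)) (ob X 0) \<and>
     (\<forall>T \<in> Obj \<C>.
        (\<forall>i < n. {g \<in> arr T (ob X (i + 1)). df X (i + 1) \<cdot> g = zmor T (ob X (i + 2))}
                 = (\<lambda>h. df X i \<cdot> h) ` arr T (ob X i)) \<and>
        {g \<in> arr T (ob X (n + 1)). pull (ob X 0) g \<delta> = zext T (ob X 0)}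
          = (\<lambda>h. df X n \<cdot> h) ` arr T (ob X n)) \<and>
     (\<forall>T \<in> Obj \<C>.
        (\<forall>i < n. {g \<in> arr (ob X (i + 1)) T. g \<cdot> df X i = zmor (ob X i) T}
                 = (\<lambda>h. h \<cdot> df X (i + 1)) ` arr (ob X (i + 2)) T) \<and>
        {g \<in> arr (ob X 0) T. push (ob X (n + 1)) g \<delta> = zext (ob X (n + 1)) T}
          = (\<lambda>h. h \<cdot> df X 0) ` arr (ob X 1) T)"

end


section \<open>n-exangulated categories\<close>

text \<open>\<open>\<ss> C A \<delta>\<close> is the class assigned to \<open>\<delta> \<in> \<E>(C, A)\<close>.\<close>

type_synonym ('o, 'm, 'e) correspondence = "'o \<Rightarrow> 'o \<Rightarrow> 'e \<Rightarrow> ('o, 'm) sq set"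

context biadditive_functor
begin

definition distinguished ::
    "nat \<Rightarrow> ('o, 'm, 'e) correspondence \<Rightarrow> ('o, 'm) sq \<Rightarrow> 'e \<Rightarrow> bool" where
  "distinguished n \<ss> X \<delta> \<longleftrightarrow> is_complex n X \<and> \<delta> \<in> ext (ob X (n + 1)) (ob X 0) \<and>
     \<ss> (ob X (n + 1)) (ob X 0) \<delta> = homotopy_class n X"

definition inflation :: "nat \<Rightarrow> ('o, 'm, 'e) correspondence \<Rightarrow> 'o \<Rightarrow> 'o \<Rightarrow> 'm \<Rightarrow> bool" where
  "inflation n \<ss> A B f \<longleftrightarrow>
     (\<exists>X \<delta>. distinguished n \<ss> X \<delta> \<and> ob X 0 = A \<and> ob X 1 = B \<and> df X 0 = f)"

definition deflation :: "nat \<Rightarrow> ('o, 'm, 'e) correspondence \<Rightarrow> 'o \<Rightarrow> 'o \<Rightarrow> 'm \<Rightarrow> bool" where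
  "deflation n \<ss> B C g \<longleftrightarrow>
     (\<exists>X \<delta>. distinguished n \<ss> X \<delta> \<and> ob X n = B \<and> ob X (n + 1) = C \<and> df X n = g)"

definition is_lift ::
    "nat \<Rightarrow> ('o, 'm) sq \<Rightarrow> ('o, 'm) sq \<Rightarrow> 'm \<Rightarrow> 'm \<Rightarrow> (nat \<Rightarrow> 'm) \<Rightarrow> bool" where
  "is_lift n X Y a c f \<longleftrightarrow> chain_map n X Y f \<and> f 0 = a \<and> f (n + 1) = c"

end

locale exact_realization = biadditive_functor \<C> \<E>
  for \<C> :: "('o, 'm) precat" and \<E> :: "('o, 'm, 'e) bifunctor" +
  fixes n :: nat and \<ss> :: "('o, 'm, 'e) correspondence"
  assumes n_pos: "n \<ge> 1"
    and realization_class: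
      "\<And>C A \<delta>. \<lbrakk>C \<in> Obj \<C>; A \<in> Obj \<C>; \<delta> \<in> ext C A\<rbrakk>
         \<Longrightarrow> \<exists>X. is_complex_AC n A C X \<and> \<ss> C A \<delta> = homotopy_class n X"
    and R0:
      "\<And>X Y \<delta> \<rho> a c. \<lbrakk>distinguished n \<ss> X \<delta>; distinguished n \<ss> Y \<rho>;
         ext_morphism (ob X (n + 1)) (ob X 0) \<delta> (ob Y (n + 1)) (ob Y 0) \<rho> a c\<rbrakk>
         \<Longrightarrow> \<exists>f. is_lift n X Y a c f"
    and R1: "\<And>X \<delta>. distinguished n \<ss> X \<delta> \<Longrightarrow> exangle n X \<delta>"
    and R2_left:
      "\<And>A Z. \<lbrakk>A \<in> Obj \<C>; is_zero_object Z\<rbrakk> \<Longrightarrow>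
         \<ss> Z A (zext Z A) = homotopy_class n
           (Sq (A # A # replicate n Z)
               (Idn \<C> A # zmor A Z # replicate (n - 1) (zmor Z Z)))"
    and R2_right:
      "\<And>A Z. \<lbrakk>A \<in> Obj \<C>; is_zero_object Z\<rbrakk> \<Longrightarrow>
         \<ss> A Z (zext A Z) = homotopy_class n
           (Sq (replicate n Z @ [A, A])
               (replicate (n - 1) (zmor Z Z) @ [zmor Z A, Idn \<C> A]))"

locale n_exangulated_category = exact_realization \<C> \<E> n \<ss>
  for \<C> :: "('o, 'm) precat" and \<E> :: "('o, 'm, 'e) bifunctor"
    and n :: nat and \<ss> :: "('o, 'm, 'e) correspondence" +
  assumes EA1_inflation:
      "\<And>A B C f g. \<lbrakk>inflation n \<ss> A B f; inflation n \<ss> B C g\<rbrakk> \<Longrightarrow> inflation n \<ss> A C (g \<cdot> f)"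
    and EA1_deflation:
      "\<And>A B C f g. \<lbrakk>deflation n \<ss> A B f; deflation n \<ss> B C g\<rbrakk> \<Longrightarrow> deflation n \<ss> A C (g \<cdot> f)"
    and EA2:
      "\<And>A C D \<rho> c X Y. \<lbrakk>A \<in> Obj \<C>; C \<in> Obj \<C>; D \<in> Obj \<C>; \<rho> \<in> ext D A; c \<in> arr C D;
         ob X 0 = A; ob X (n + 1) = C; distinguished n \<ss> X (pull A c \<rho>);
         ob Y 0 = A; ob Y (n + 1) = D; distinguished n \<ss> Y \<rho>\<rbrakk>
         \<Longrightarrow> \<exists>f. is_lift n X Y (Idn \<C> A) c f \<and>
                 distinguished n \<ss> (mapping_cone n X Y f) (push D (df X 0) \<rho>)"
    and EA2_op:
      "\<And>A B C \<delta> a X Y. \<lbrakk>A \<in> Obj \<C>; B \<in> Obj \<C>; C \<in> Obj \<C>; \<delta> \<in> ext C A; a \<in> arr A B;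
         ob X 0 = A; ob X (n + 1) = C; distinguished n \<ss> X \<delta>;
         ob Y 0 = B; ob Y (n + 1) = C; distinguished n \<ss> Y (push C a \<delta>)\<rbrakk>
         \<Longrightarrow> \<exists>h. is_lift n X Y a (Idn \<C> C) h \<and>
                 distinguished n \<ss> (mapping_cocone n X Y h) (pull A (df Y n) \<delta>)"


section \<open>Extriangulated categories\<close>

context preadditive_category
begin

definition is_seq3 :: "'o \<Rightarrow> 'o \<Rightarrow> 'o \<Rightarrow> 'm \<Rightarrow> 'm \<Rightarrow> bool" where
  "is_seq3 A B C x y \<longleftrightarrow> A \<in> Obj \<C> \<and> B \<in> Obj \<C> \<and> C \<in> Obj \<C> \<and> x \<in> arr A B \<and> y \<in> arr B C"

definition equiv_class3 :: "'o \<Rightarrow> 'o \<Rightarrow> 'o \<Rightarrow> 'm \<Rightarrow> 'm \<Rightarrow> ('o, 'm) sq set" where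
  "equiv_class3 A B C x y =
     {Sq [A, B', C] [x', y'] | B' x' y'. is_seq3 A B' C x' y' \<and>
        (\<exists>b. is_iso B B' b \<and> b \<cdot> x = x' \<and> y' \<cdot> b = y)}"

end

definition (in biadditive_functor) realized_by ::
    "('o, 'm, 'e) correspondence \<Rightarrow> 'e \<Rightarrow> 'o \<Rightarrow> 'o \<Rightarrow> 'o \<Rightarrow> 'm \<Rightarrow> 'm \<Rightarrow> bool" where
  "realized_by \<ss> \<delta> A B C x y \<longleftrightarrow>
     is_seq3 A B C x y \<and> \<delta> \<in> ext C A \<and> \<ss> C A \<delta> = equiv_class3 A B C x y"

text \<open>The axiom (ET1), biadditivity of \<open>\<E>\<close>, is the imported locale.\<close>

locale extriangulated_category = biadditive_functor \<C> \<E>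
  for \<C> :: "('o, 'm) precat" and \<E> :: "('o, 'm, 'e) bifunctor" +
  fixes \<ss> :: "('o, 'm, 'e) correspondence"
  assumes ET2_class:
      "\<And>C A \<delta>. \<lbrakk>C \<in> Obj \<C>; A \<in> Obj \<C>; \<delta> \<in> ext C A\<rbrakk>
         \<Longrightarrow> \<exists>B x y. is_seq3 A B C x y \<and> \<ss> C A \<delta> = equiv_class3 A B C x y"
    and ET2_i:
      "\<And>A B C x y \<delta> A' B' C' x' y' \<delta>' a c.
         \<lbrakk>realized_by \<ss> \<delta> A B C x y; realized_by \<ss> \<delta>' A' B' C' x' y';
          ext_morphism C A \<delta> C' A' \<delta>' a c\<rbrakk>
         \<Longrightarrow> \<exists>b \<in> arr B B'. b \<cdot> x = x' \<cdot> a \<and> y' \<cdot> b = c \<cdot> y"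
    and ET2_ii:
      "\<And>A C. \<lbrakk>A \<in> Obj \<C>; C \<in> Obj \<C>\<rbrakk> \<Longrightarrow>
         \<ss> C A (zext C A) = equiv_class3 A (A \<oplus>\<oplus> C) C
           (col A A C (Idn \<C> A) (zmor A C)) (row A C C (zmor A C) (Idn \<C> C))"
    and ET2_iii:
      "\<And>A B C x y \<delta> A' B' C' x' y' \<delta>'.
         \<lbrakk>realized_by \<ss> \<delta> A B C x y; realized_by \<ss> \<delta>' A' B' C' x' y'\<rbrakk>
         \<Longrightarrow> \<ss> (C \<oplus>\<oplus> C') (A \<oplus>\<oplus> A') (dsum_ext C A \<delta> C' A' \<delta>')
             = equiv_class3 (A \<oplus>\<oplus> A') (B \<oplus>\<oplus> B') (C \<oplus>\<oplus> C')
                 (dsum_mor A A' B B' x x') (dsum_mor B B' C C' y y')"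
    and ET3:
      "\<And>A B C x y \<delta> A' B' C' x' y' \<delta>' a b.
         \<lbrakk>realized_by \<ss> \<delta> A B C x y; realized_by \<ss> \<delta>' A' B' C' x' y';
          a \<in> arr A A'; b \<in> arr B B'; b \<cdot> x = x' \<cdot> a\<rbrakk>
         \<Longrightarrow> \<exists>c. ext_morphism C A \<delta> C' A' \<delta>' a c \<and> c \<cdot> y = y' \<cdot> b"
    and ET3_op:
      "\<And>A B C x y \<delta> A' B' C' x' y' \<delta>' b c.
         \<lbrakk>realized_by \<ss> \<delta> A B C x y; realized_by \<ss> \<delta>' A' B' C' x' y';
          b \<in> arr B B'; c \<in> arr C C'; c \<cdot> y = y' \<cdot> b\<rbrakk>
         \<Longrightarrow> \<exists>a. ext_morphism C A \<delta> C' A' \<delta>' a c \<and> b \<cdot> x = x' \<cdot> a"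
    and ET4:
      "\<And>A B C D F f f' g g' \<delta> \<delta>'.
         \<lbrakk>realized_by \<ss> \<delta> A B D f f'; realized_by \<ss> \<delta>' B C F g g'\<rbrakk>
         \<Longrightarrow> \<exists>E h h' d e \<delta>''. E \<in> Obj \<C> \<and> h = g \<cdot> f \<and>
               h' \<in> arr C E \<and> d \<in> arr D E \<and> e \<in> arr E F \<and>
               d \<cdot> f' = h' \<cdot> g \<and> e \<cdot> h' = g' \<and>
               realized_by \<ss> \<delta>'' A C E h h' \<and>
               realized_by \<ss> (push F f' \<delta>') D E F d e \<and>
               pull A d \<delta>'' = \<delta> \<and>
               push E f \<delta>'' = pull B e \<delta>'"
    and ET4_op:
      "\<And>A B C D F f f' g g' \<delta> \<delta>'.
         \<lbrakk>realized_by \<ss> \<delta> D A B f' f; realized_by \<ss> \<delta>' F B C g' g\<rbrakk>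
         \<Longrightarrow> \<exists>E h h' d e \<delta>''. E \<in> Obj \<C> \<and> h = g \<cdot> f \<and>
               h' \<in> arr E A \<and> d \<in> arr D E \<and> e \<in> arr E F \<and>
               h' \<cdot> d = f' \<and> f \<cdot> h' = g' \<cdot> e \<and>
               realized_by \<ss> \<delta>'' E A C h' h \<and>
               realized_by \<ss> (pull D g' \<delta>) D E F d e \<and>
               push C e \<delta>'' = \<delta>' \<and>
               push B d \<delta> = pull E g \<delta>''"

end

theory Submission
  imports Defs
begin

text \<open>
  Both kinds of structure amount to a realization by sequences that are exact under
  \<open>\<C>(T, -)\<close> and \<open>\<C>(-, T)\<close>, together with further axioms, and homotopy equivalence over fixed end
  terms coincides with isomorphism.

  In a 1-exangulated category, (EA2) yields exactness of \<open>\<C>(-, C) \<rightarrow> \<E>(-, A) \<rightarrow> \<E>(-, B)\<close>, hence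
  (ET3). For (ET4), let \<open>h = gf\<close> have cokernel \<open>E\<close>, which exists by (EA1). The cone of
  \<open>(1, g, d)\<close> and the cocone belonging to \<open>f'\<^sub>*\<delta>'\<close> both continue the same morphism
  \<open>B \<rightarrow> D \<oplus> C\<close>, so their third terms are isomorphic; this identifies \<open>D \<rightarrow> E \<rightarrow> F\<close> as a
  realization of \<open>f'\<^sub>*\<delta>'\<close>.

  Conversely, in an extriangulated category (ET3) and its dual yield exactness, (ET4) contains
  (EA1), and (EA2) follows from the dual of (ET4), applied to the two deflations
  \<open>C \<oplus> Y \<rightarrow> C \<oplus> D \<rightarrow> D\<close>. Everything else follows by passing to the opposite category, for
  which the axioms are phrased with arbitrary instead of chosen biproducts.
\<close>

section \<open>Calculus of morphisms\<close>

text \<open>The exact sequences of functors end after four terms, so the five lemma is available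
  only by halves: each half of exactness gives a comparison morphism a one-sided inverse. The other
  source of isomorphisms is an endomorphism \<open>1 + n\<close> with \<open>n\<close> nilpotent. It
  handles everything that is determined only up to a non-unique morphism: homotopy inverses, third
  terms of sequences, and the lifts of (EA2). Non-uniqueness is the obstacle in both directions.
  (EA2) asserts some lift where (ET4) prescribes the morphisms, so lifts have to be corrected
  through a cokernel property. Conversely, the octahedron produces a sequence whose first term is
  merely isomorphic to the required one, and neither notion of class allows end terms to vary, so
  realizations must be moved by hand. Chosen biproducts come from Hilbert choice, hence those of the
  opposite category are unrelated to those of \<C>. Arbitrary biproduct data survive dualization,
  and signs, shears and permutations of summands can be absorbed in their injections and
  projections.\<close>

context preadditive_category
begin

text \<open>
  Since hom-sets are disjoint, sources and targets are functions of the morphism. Sums can then be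
  written without naming the hom-set, and the ring laws become conditional rewrite rules all of
  whose side conditions are decided by simplification.
\<close>

definition mor :: "'m \<Rightarrow> bool" where
  "mor f \<longleftrightarrow> (\<exists>A\<in>Obj \<C>. \<exists>B\<in>Obj \<C>. f \<in> arr A B)"

definition src :: "'m \<Rightarrow> 'o" where
  "src f = (THE A. A \<in> Obj \<C> \<and> (\<exists>B\<in>Obj \<C>. f \<in> arr A B))"

definition tgt :: "'m \<Rightarrow> 'o" where
  "tgt f = (THE B. B \<in> Obj \<C> \<and> (\<exists>A\<in>Obj \<C>. f \<in> arr A B))"

definition pls :: "'m \<Rightarrow> 'm \<Rightarrow> 'm" (infixl "\<oplus>" 65) where
  "f \<oplus> g = f \<otimes>\<^bsub>Mor \<C> (src f) (tgt f)\<^esub> g"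

definition ng :: "'m \<Rightarrow> 'm" ("\<ominus> _" [81] 80) where
  "\<ominus> f = inv\<^bsub>Mor \<C> (src f) (tgt f)\<^esub> f"

abbreviation is_arr :: "'m \<Rightarrow> 'o \<Rightarrow> 'o \<Rightarrow> bool" ("\<guillemotleft>_ : _ \<rightarrow> _\<guillemotright>") where
  "\<guillemotleft>f : A \<rightarrow> B\<guillemotright> \<equiv> mor f \<and> src f = A \<and> tgt f = B \<and> A \<in> Obj \<C> \<and> B \<in> Obj \<C>"

section \<open>Typing, ring laws and normal forms of morphisms\<close>

lemma arr_src_tgt:
  assumes "A \<in> Obj \<C>" "B \<in> Obj \<C>" "f \<in> arr A B"
  shows "mor f" "src f = A" "tgt f = B"
proof -
  show "mor f" using assms by (auto simp: mor_def)
  show "src f = A" unfolding src_def using assms Mor_disjoint by (intro the_equality) blast+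
  show "tgt f = B" unfolding tgt_def using assms Mor_disjoint by (intro the_equality) blast+
qed

lemma is_arr_iff: "\<guillemotleft>f : A \<rightarrow> B\<guillemotright> \<longleftrightarrow> A \<in> Obj \<C> \<and> B \<in> Obj \<C> \<and> f \<in> arr A B"
  using arr_src_tgt by (metis mor_def)

lemma is_arrI: "\<lbrakk>A \<in> Obj \<C>; B \<in> Obj \<C>; f \<in> arr A B\<rbrakk> \<Longrightarrow> \<guillemotleft>f : A \<rightarrow> B\<guillemotright>"
  using is_arr_iff by blast

lemma mor_iff: "mor f \<longleftrightarrow> \<guillemotleft>f : src f \<rightarrow> tgt f\<guillemotright>"
  using arr_src_tgt by (metis mor_def)

lemma mor_arr: "mor f \<Longrightarrow> f \<in> arr (src f) (tgt f)"
  using arr_src_tgt by (metis mor_def)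

lemma arrI [simp]: "\<lbrakk>mor f; src f = A; tgt f = B\<rbrakk> \<Longrightarrow> f \<in> arr A B"
  using mor_arr by blast

text \<open>As rewrite rules these facts expand products over sums, nest composites and sums to the
  right and move signs in front of composites. Commutativity of sums is left to
  \<open>pls_ac\<close>.\<close>

named_theorems cat

lemma src_tgt_Obj [cat]: "mor f \<Longrightarrow> src f \<in> Obj \<C>" "mor f \<Longrightarrow> tgt f \<in> Obj \<C>"
  using mor_iff by blast+

lemma cmp_arr [cat]:
  assumes "mor g" "mor f" "src g = tgt f"
  shows "mor (g \<cdot> f)" "src (g \<cdot> f) = src f" "tgt (g \<cdot> f) = tgt g"
proof -
  have "g \<cdot> f \<in> arr (src f) (tgt g)"
    using assms Cmp_in[of "src f" "tgt f" "tgt g" f g] mor_arr[of f] mor_arr[of g]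
    by (simp add: src_tgt_Obj)
  then show "mor (g \<cdot> f)" "src (g \<cdot> f) = src f" "tgt (g \<cdot> f) = tgt g"
    using arr_src_tgt[of "src f" "tgt g" "g \<cdot> f"] assms by (simp_all add: src_tgt_Obj del: arrI)
qed

lemma Idn_arr [cat]:
  assumes "A \<in> Obj \<C>"
  shows "mor (Idn \<C> A)" "src (Idn \<C> A) = A" "tgt (Idn \<C> A) = A"
  using arr_src_tgt[OF assms assms Idn_in[OF assms]] by auto

lemma group_Mor: "\<lbrakk>A \<in> Obj \<C>; B \<in> Obj \<C>\<rbrakk> \<Longrightarrow> group (Mor \<C> A B)"
  using Mor_comm_group comm_group.axioms(2) by blast

lemma monoid_Mor: "\<lbrakk>A \<in> Obj \<C>; B \<in> Obj \<C>\<rbrakk> \<Longrightarrow> monoid (Mor \<C> A B)"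
  using group_Mor group.is_monoid by blast

lemma zmor_arr [cat]:
  assumes "A \<in> Obj \<C>" "B \<in> Obj \<C>"
  shows "mor (zmor A B)" "src (zmor A B) = A" "tgt (zmor A B) = B"
  using arr_src_tgt[OF assms monoid.one_closed[OF monoid_Mor[OF assms]]] by auto

lemma pls_arr [cat]:
  assumes "mor f" "mor g" "src g = src f" "tgt g = tgt f"
  shows "mor (f \<oplus> g)" "src (f \<oplus> g) = src f" "tgt (f \<oplus> g) = tgt f"
proof -
  have "f \<oplus> g \<in> arr (src f) (tgt f)" unfolding pls_def
    using assms monoid.m_closed[OF monoid_Mor] mor_arr[of f] mor_arr[of g] src_tgt_Obj[of f] by simp
  then show "mor (f \<oplus> g)" "src (f \<oplus> g) = src f" "tgt (f \<oplus> g) = tgt f"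
    using arr_src_tgt[of "src f" "tgt f" "f \<oplus> g"] assms by (simp_all add: src_tgt_Obj del: arrI)
qed

lemma ng_arr [cat]:
  assumes "mor f"
  shows "mor (\<ominus> f)" "src (\<ominus> f) = src f" "tgt (\<ominus> f) = tgt f"
proof -
  have "\<ominus> f \<in> arr (src f) (tgt f)" unfolding ng_def
    using assms group.inv_closed[OF group_Mor] mor_arr[of f] src_tgt_Obj[of f] by simp
  then show "mor (\<ominus> f)" "src (\<ominus> f) = src f" "tgt (\<ominus> f) = tgt f"
    using arr_src_tgt[of "src f" "tgt f" "\<ominus> f"] assms by (simp_all add: src_tgt_Obj del: arrI)
qed

lemma cmp_assoc [cat]:
  "\<lbrakk>mor f; mor g; mor h; src g = tgt f; src h = tgt g\<rbrakk> \<Longrightarrow> (h \<cdot> g) \<cdot> f = h \<cdot> (g \<cdot> f)"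
  using Cmp_assoc[of "src f" "tgt f" "tgt g" "tgt h" f g h] mor_arr[of f] mor_arr[of g] mor_arr[of h]
  by (simp add: src_tgt_Obj)

lemma cmp_Idn [cat]:
  "\<lbrakk>mor f; tgt f = A\<rbrakk> \<Longrightarrow> Idn \<C> A \<cdot> f = f" "\<lbrakk>mor f; src f = A\<rbrakk> \<Longrightarrow> f \<cdot> Idn \<C> A = f"
  using Cmp_Idn_left[of "src f" "tgt f" f] Cmp_Idn_right[of "src f" "tgt f" f] mor_arr[of f]
  by (auto simp: src_tgt_Obj)

lemma cmp_pls [cat]:
  "\<lbrakk>mor f; mor g; mor g'; src g = tgt f; src g' = src g; tgt g' = tgt g\<rbrakk>
    \<Longrightarrow> (g \<oplus> g') \<cdot> f = g \<cdot> f \<oplus> g' \<cdot> f"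
  "\<lbrakk>mor g; mor f; mor f'; src g = tgt f; src f' = src f; tgt f' = tgt f\<rbrakk>
    \<Longrightarrow> g \<cdot> (f \<oplus> f') = g \<cdot> f \<oplus> g \<cdot> f'"
  unfolding pls_def
  using Cmp_add_left[of "src f" "tgt f" "tgt g" f g g'] Cmp_add_right[of "src f" "tgt f" "tgt g" f f' g]
    mor_arr[of f] mor_arr[of f'] mor_arr[of g] mor_arr[of g']
  by (simp_all add: cmp_arr src_tgt_Obj)

lemma pls_assoc [cat]:
  "\<lbrakk>mor f; mor g; mor h; src g = src f; tgt g = tgt f; src h = src f; tgt h = tgt f\<rbrakk>
    \<Longrightarrow> (f \<oplus> g) \<oplus> h = f \<oplus> (g \<oplus> h)"
  using pls_arr[of f g] monoid.m_assoc[OF monoid_Mor, of "src f" "tgt f" f g h]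
    mor_arr[of f] mor_arr[of g] mor_arr[of h]
  by (simp add: pls_def src_tgt_Obj)

lemma pls_commute:
  "\<lbrakk>mor f; mor g; src g = src f; tgt g = tgt f\<rbrakk> \<Longrightarrow> f \<oplus> g = g \<oplus> f"
  unfolding pls_def
  using comm_monoid.m_comm[OF comm_group.axioms(1)[OF Mor_comm_group], of "src f" "tgt f" f g]
    mor_arr[of f] mor_arr[of g]
  by (simp add: src_tgt_Obj)

lemma pls_left_commute:
  "\<lbrakk>mor f; mor g; mor h; src g = src f; tgt g = tgt f; src h = src f; tgt h = tgt f\<rbrakk>
    \<Longrightarrow> f \<oplus> (g \<oplus> h) = g \<oplus> (f \<oplus> h)"
  using pls_assoc[of f g h] pls_assoc[of g f h] pls_commute[of f g] by simp

lemmas pls_ac = pls_commute pls_left_commute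

lemma pls_zmor [cat]:
  assumes "mor f" "src f = A" "tgt f = B"
  shows "f \<oplus> zmor A B = f" "zmor A B \<oplus> f = f"
proof -
  have "A \<in> Obj \<C>" "B \<in> Obj \<C>" using assms src_tgt_Obj by auto
  then show "f \<oplus> zmor A B = f" "zmor A B \<oplus> f = f"
    using assms unfolding pls_def
    by (simp_all add: monoid.l_one[OF monoid_Mor] monoid.r_one[OF monoid_Mor] zmor_arr)
qed

lemma pls_ng [cat]:
  assumes "mor f"
  shows "f \<oplus> \<ominus> f = zmor (src f) (tgt f)" "\<ominus> f \<oplus> f = zmor (src f) (tgt f)"
  using assms unfolding pls_def ng_arr(2,3)[OF assms] unfolding ng_def
  by (simp_all add: group.l_inv[OF group_Mor] group.r_inv[OF group_Mor] src_tgt_Obj)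

text \<open>In a right-nested sum opposite summands may be followed by the rest of the sum or be
  separated by another summand; each form covers one such position.\<close>

lemma pls_ng_cancel [cat]:
  assumes "mor f" "mor g" "src g = src f" "tgt g = tgt f"
  shows "f \<oplus> (\<ominus> f \<oplus> g) = g" "\<ominus> f \<oplus> (f \<oplus> g) = g"
    "f \<oplus> (g \<oplus> \<ominus> f) = g" "\<ominus> f \<oplus> (g \<oplus> f) = g"
proof -
  show 1: "f \<oplus> (\<ominus> f \<oplus> g) = g" "\<ominus> f \<oplus> (f \<oplus> g) = g"
    using assms by (simp_all add: cat flip: pls_assoc)
  show "f \<oplus> (g \<oplus> \<ominus> f) = g" "\<ominus> f \<oplus> (g \<oplus> f) = g"
    using 1 assms pls_commute[of g f] pls_commute[of g "\<ominus> f"] by (simp_all add: cat)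
qed

lemma pls_left_imp_eq:
  assumes "f \<oplus> g = f \<oplus> h" "mor f" "mor g" "mor h"
    "src g = src f" "tgt g = tgt f" "src h = src f" "tgt h = tgt f"
  shows "g = h"
  using assms pls_ng_cancel(2) by metis

lemma pls_eq_zmor_imp:
  assumes "f \<oplus> g = zmor A B" "\<guillemotleft>f : A \<rightarrow> B\<guillemotright>" "\<guillemotleft>g : A \<rightarrow> B\<guillemotright>"
  shows "g = \<ominus> f"
  using assms by (intro pls_left_imp_eq[of f g "\<ominus> f"]) (auto simp: cat)

lemma ng_ng [cat]: "mor f \<Longrightarrow> \<ominus> (\<ominus> f) = f"
  using pls_eq_zmor_imp[of "\<ominus> f" f] by (auto simp: cat)

lemma ng_pls [cat]:
  assumes "mor f" "mor g" "src g = src f" "tgt g = tgt f"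
  shows "\<ominus> (f \<oplus> g) = \<ominus> f \<oplus> \<ominus> g"
  using assms by (intro pls_eq_zmor_imp[symmetric]) (auto simp: cat pls_ac)

lemma ng_zmor [cat]: "\<lbrakk>A \<in> Obj \<C>; B \<in> Obj \<C>\<rbrakk> \<Longrightarrow> \<ominus> (zmor A B) = zmor A B"
  using pls_eq_zmor_imp[of "zmor A B" "zmor A B"] by (auto simp: cat)

lemma cmp_zmor [cat]:
  assumes "mor f"
  shows "\<lbrakk>tgt f = B; C \<in> Obj \<C>\<rbrakk> \<Longrightarrow> zmor B C \<cdot> f = zmor (src f) C"
    and "\<lbrakk>src f = B; A \<in> Obj \<C>\<rbrakk> \<Longrightarrow> f \<cdot> zmor A B = zmor A (tgt f)"
proof -
  show "zmor B C \<cdot> f = zmor (src f) C" if "tgt f = B" "C \<in> Obj \<C>"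
  proof -
    have "B \<in> Obj \<C>" using that assms src_tgt_Obj by auto
    then have "(zmor B C \<oplus> zmor B C) \<cdot> f = zmor B C \<cdot> f \<oplus> zmor B C \<cdot> f"
      using assms that by (intro cmp_pls) (simp_all add: zmor_arr)
    also have "zmor B C \<oplus> zmor B C = zmor B C"
      using that \<open>B \<in> Obj \<C>\<close> by (intro pls_zmor) (simp_all add: zmor_arr)
    also have "zmor B C \<cdot> f = zmor B C \<cdot> f \<oplus> zmor (src f) C"
      using assms that \<open>B \<in> Obj \<C>\<close> by (intro pls_zmor(1)[symmetric]) (simp_all add: cat)
    finally show ?thesis
      using assms that \<open>B \<in> Obj \<C>\<close> by (intro pls_left_imp_eq[of "zmor B C \<cdot> f" "zmor B C \<cdot> f"]) (simp_all add: cat)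
  qed
  show "f \<cdot> zmor A B = zmor A (tgt f)" if "src f = B" "A \<in> Obj \<C>"
  proof -
    have "B \<in> Obj \<C>" using that assms src_tgt_Obj by auto
    then have "f \<cdot> (zmor A B \<oplus> zmor A B) = f \<cdot> zmor A B \<oplus> f \<cdot> zmor A B"
      using assms that by (intro cmp_pls) (simp_all add: zmor_arr)
    also have "zmor A B \<oplus> zmor A B = zmor A B"
      using that \<open>B \<in> Obj \<C>\<close> by (intro pls_zmor) (simp_all add: zmor_arr)
    also have "f \<cdot> zmor A B = f \<cdot> zmor A B \<oplus> zmor A (tgt f)"
      using assms that \<open>B \<in> Obj \<C>\<close> by (intro pls_zmor(1)[symmetric]) (simp_all add: cat)
    finally show ?thesis
      using assms that \<open>B \<in> Obj \<C>\<close> by (intro pls_left_imp_eq[of "f \<cdot> zmor A B" "f \<cdot> zmor A B"]) (simp_all add: cat)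
  qed
qed

lemma cmp_ng [cat]:
  assumes "mor g" "mor f" "src g = tgt f"
  shows "\<ominus> g \<cdot> f = \<ominus> (g \<cdot> f)" "g \<cdot> \<ominus> f = \<ominus> (g \<cdot> f)"
proof -
  have "g \<cdot> f \<oplus> \<ominus> g \<cdot> f = zmor (src f) (tgt g)"
    using assms by (simp add: cat flip: cmp_pls)
  then show "\<ominus> g \<cdot> f = \<ominus> (g \<cdot> f)"
    using assms by (intro pls_eq_zmor_imp) (auto simp: cat)
  have "g \<cdot> f \<oplus> g \<cdot> \<ominus> f = zmor (src f) (tgt g)"
    using assms by (simp add: cat flip: cmp_pls)
  then show "g \<cdot> \<ominus> f = \<ominus> (g \<cdot> f)"
    using assms by (intro pls_eq_zmor_imp) (auto simp: cat)
qed

text \<open>Composites nest to the right, so an equation for \<open>g \<cdot> f\<close> does not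
  match inside \<open>g \<cdot> (f \<cdot> w)\<close>. This form makes it usable there.\<close>

lemma cmp_red:
  assumes "g \<cdot> f = k" "mor g" "mor f" "src g = tgt f"
  shows "\<And>w. \<lbrakk>mor w; tgt w = src f\<rbrakk> \<Longrightarrow> g \<cdot> (f \<cdot> w) = k \<cdot> w"
  using assms cmp_assoc by metis

section \<open>Isomorphisms: one-sided inverses and nilpotent perturbations\<close>

lemma is_iso_iff:
  "A \<in> Obj \<C> \<and> B \<in> Obj \<C> \<and> is_iso A B f \<longleftrightarrow>
    \<guillemotleft>f : A \<rightarrow> B\<guillemotright> \<and> (\<exists>g. \<guillemotleft>g : B \<rightarrow> A\<guillemotright> \<and> g \<cdot> f = Idn \<C> A \<and> f \<cdot> g = Idn \<C> B)"
  unfolding is_iso_def using is_arr_iff by blast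

lemma isoE:
  assumes "is_iso A B f" "A \<in> Obj \<C>" "B \<in> Obj \<C>"
  obtains g where "\<guillemotleft>f : A \<rightarrow> B\<guillemotright>" "\<guillemotleft>g : B \<rightarrow> A\<guillemotright>" "g \<cdot> f = Idn \<C> A" "f \<cdot> g = Idn \<C> B"
  using assms is_iso_iff by blast

lemma isoI:
  assumes "\<guillemotleft>f : A \<rightarrow> B\<guillemotright>" "\<guillemotleft>g : B \<rightarrow> A\<guillemotright>" "g \<cdot> f = Idn \<C> A" "f \<cdot> g = Idn \<C> B"
  shows "is_iso A B f"
  using assms is_iso_iff by blast

lemma isoI_split:
  assumes "\<guillemotleft>f : A \<rightarrow> B\<guillemotright>" "\<guillemotleft>g : B \<rightarrow> A\<guillemotright>" "\<guillemotleft>h : B \<rightarrow> A\<guillemotright>" "g \<cdot> f = Idn \<C> A" "f \<cdot> h = Idn \<C> B"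
  shows "is_iso A B f"
proof -
  have "g = g \<cdot> (f \<cdot> h)" using assms by (simp add: cat)
  also have "\<dots> = h" using assms cmp_red[of g f "Idn \<C> A" h] by (simp add: cat)
  finally show ?thesis using assms by (auto intro: isoI)
qed

text \<open>An inverse of \<open>g \<cdot> f\<close> yields a left inverse of \<open>f\<close>, an
  inverse of \<open>f \<cdot> g\<close> a right one. This suits pairs that are not inverse to each
  other, such as homotopy inverses.\<close>

lemma iso_split_composites:
  assumes "\<guillemotleft>f : A \<rightarrow> B\<guillemotright>" "\<guillemotleft>g : B \<rightarrow> A\<guillemotright>" "is_iso A A (g \<cdot> f)" "is_iso B B (f \<cdot> g)"
  shows "is_iso A B f"
proof -
  obtain u where u: "\<guillemotleft>u : A \<rightarrow> A\<guillemotright>" "u \<cdot> (g \<cdot> f) = Idn \<C> A" using isoE assms by blast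
  obtain v where v: "\<guillemotleft>v : B \<rightarrow> B\<guillemotright>" "(f \<cdot> g) \<cdot> v = Idn \<C> B" using isoE assms by blast
  show ?thesis
    using u v assms(1,2) by (intro isoI_split[of f A B "u \<cdot> g" "g \<cdot> v"]) (simp_all add: cat)
qed

text \<open>The inverse is the geometric series \<open>1 - n + n^2\<close>. The bound of cube zero
  is dictated by self-homotopies, whose square need not vanish.\<close>

lemma iso_Idn_pls_nilpotent:
  assumes "\<guillemotleft>n : A \<rightarrow> A\<guillemotright>" "n \<cdot> (n \<cdot> n) = zmor A A"
  shows "is_iso A A (Idn \<C> A \<oplus> n)"
  using assms
  by (intro isoI[of _ _ _ "Idn \<C> A \<oplus> (\<ominus> n \<oplus> n \<cdot> n)"]) (simp_all add: cat pls_ac)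

lemma iso_if_diff_nilpotent:
  assumes "\<guillemotleft>f : A \<rightarrow> A\<guillemotright>" "f \<oplus> \<ominus> (Idn \<C> A) = n" "n \<cdot> (n \<cdot> n) = zmor A A"
  shows "is_iso A A f"
proof -
  have "f = Idn \<C> A \<oplus> n" using assms(1) by (simp add: assms(2)[symmetric] cat)
  moreover have "\<guillemotleft>n : A \<rightarrow> A\<guillemotright>" using assms(1) by (simp add: assms(2)[symmetric] cat)
  ultimately show ?thesis using iso_Idn_pls_nilpotent[of n A] assms(3) by simp
qed

section \<open>Biproducts and zero objects\<close>

lemma is_biproduct_iff:
  "A \<in> Obj \<C> \<and> B \<in> Obj \<C> \<and> is_biproduct A B P \<longleftrightarrow>
    \<guillemotleft>in1 P : A \<rightarrow> bsum P\<guillemotright> \<and> \<guillemotleft>in2 P : B \<rightarrow> bsum P\<guillemotright> \<and> \<guillemotleft>pr1 P : bsum P \<rightarrow> A\<guillemotright> \<and> \<guillemotleft>pr2 P : bsum P \<rightarrow> B\<guillemotright> \<and>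
    pr1 P \<cdot> in1 P = Idn \<C> A \<and> pr2 P \<cdot> in2 P = Idn \<C> B \<and>
    pr2 P \<cdot> in1 P = zmor A B \<and> pr1 P \<cdot> in2 P = zmor B A \<and>
    in1 P \<cdot> pr1 P \<oplus> in2 P \<cdot> pr2 P = Idn \<C> (bsum P)" (is "?L \<longleftrightarrow> ?R")
proof -
  have "in1 P \<cdot> pr1 P \<oplus> in2 P \<cdot> pr2 P =
      in1 P \<cdot> pr1 P \<otimes>\<^bsub>Mor \<C> (bsum P) (bsum P)\<^esub> in2 P \<cdot> pr2 P"
    if "\<guillemotleft>in1 P : A \<rightarrow> bsum P\<guillemotright>" "\<guillemotleft>pr1 P : bsum P \<rightarrow> A\<guillemotright>"
    using that by (simp add: pls_def cat)
  then show ?thesis unfolding is_biproduct_def by (metis is_arr_iff)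
qed

lemmas is_biproductI = is_biproduct_iff[THEN iffD2, THEN conjunct2, THEN conjunct2]

text \<open>Later proofs select these facts by position: 1-4 are the typings, 5-8 the projections
  after injections, 9 the decomposition of the identity, and 10-13 repeat 5-8 with a trailing
  factor, as met in right-nested composites.\<close>

lemma biproductD:
  assumes "is_biproduct A B P" "A \<in> Obj \<C>" "B \<in> Obj \<C>"
  shows "\<guillemotleft>in1 P : A \<rightarrow> bsum P\<guillemotright>" "\<guillemotleft>in2 P : B \<rightarrow> bsum P\<guillemotright>" "\<guillemotleft>pr1 P : bsum P \<rightarrow> A\<guillemotright>" "\<guillemotleft>pr2 P : bsum P \<rightarrow> B\<guillemotright>"
    "pr1 P \<cdot> in1 P = Idn \<C> A" "pr2 P \<cdot> in2 P = Idn \<C> B"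
    "pr2 P \<cdot> in1 P = zmor A B" "pr1 P \<cdot> in2 P = zmor B A"
    "in1 P \<cdot> pr1 P \<oplus> in2 P \<cdot> pr2 P = Idn \<C> (bsum P)"
    "\<And>w. \<lbrakk>mor w; tgt w = A\<rbrakk> \<Longrightarrow> pr1 P \<cdot> (in1 P \<cdot> w) = w"
    "\<And>w. \<lbrakk>mor w; tgt w = B\<rbrakk> \<Longrightarrow> pr2 P \<cdot> (in2 P \<cdot> w) = w"
    "\<And>w. \<lbrakk>mor w; tgt w = A\<rbrakk> \<Longrightarrow> pr2 P \<cdot> (in1 P \<cdot> w) = zmor (src w) B"
    "\<And>w. \<lbrakk>mor w; tgt w = B\<rbrakk> \<Longrightarrow> pr1 P \<cdot> (in2 P \<cdot> w) = zmor (src w) A"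
proof -
  note P = is_biproduct_iff[THEN iffD1, OF conjI[OF assms(2) conjI[OF assms(3,1)]]]
  show "\<guillemotleft>in1 P : A \<rightarrow> bsum P\<guillemotright>" "\<guillemotleft>in2 P : B \<rightarrow> bsum P\<guillemotright>" "\<guillemotleft>pr1 P : bsum P \<rightarrow> A\<guillemotright>" "\<guillemotleft>pr2 P : bsum P \<rightarrow> B\<guillemotright>"
    "pr1 P \<cdot> in1 P = Idn \<C> A" "pr2 P \<cdot> in2 P = Idn \<C> B"
    "pr2 P \<cdot> in1 P = zmor A B" "pr1 P \<cdot> in2 P = zmor B A"
    "in1 P \<cdot> pr1 P \<oplus> in2 P \<cdot> pr2 P = Idn \<C> (bsum P)"
    using P by blast+
  show "pr1 P \<cdot> (in1 P \<cdot> w) = w" if "mor w" "tgt w = A" for w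
    using P that cmp_red[of "pr1 P" "in1 P" _ w] by (simp add: cat)
  show "pr2 P \<cdot> (in2 P \<cdot> w) = w" if "mor w" "tgt w = B" for w
    using P that cmp_red[of "pr2 P" "in2 P" _ w] by (simp add: cat)
  show "pr2 P \<cdot> (in1 P \<cdot> w) = zmor (src w) B" if "mor w" "tgt w = A" for w
    using P that cmp_red[of "pr2 P" "in1 P" _ w] by (simp add: cat)
  show "pr1 P \<cdot> (in2 P \<cdot> w) = zmor (src w) A" if "mor w" "tgt w = B" for w
    using P that cmp_red[of "pr1 P" "in2 P" _ w] by (simp add: cat)
qed

lemma biproduct_expand:
  assumes "is_biproduct A B P" "A \<in> Obj \<C>" "B \<in> Obj \<C>" and f: "\<guillemotleft>f : T \<rightarrow> bsum P\<guillemotright>"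
  shows "f = in1 P \<cdot> (pr1 P \<cdot> f) \<oplus> in2 P \<cdot> (pr2 P \<cdot> f)"
proof -
  note P = biproductD[OF assms(1-3)]
  have "Idn \<C> (bsum P) \<cdot> f = in1 P \<cdot> (pr1 P \<cdot> f) \<oplus> in2 P \<cdot> (pr2 P \<cdot> f)"
    unfolding P(9)[symmetric] using P(1-4) f by (simp add: cat)
  then show ?thesis using f by (simp add: cat)
qed

lemma biproduct_eqI:
  assumes "is_biproduct A B P" "A \<in> Obj \<C>" "B \<in> Obj \<C>"
    and "\<guillemotleft>f : T \<rightarrow> bsum P\<guillemotright>" "\<guillemotleft>g : T \<rightarrow> bsum P\<guillemotright>" "pr1 P \<cdot> f = pr1 P \<cdot> g" "pr2 P \<cdot> f = pr2 P \<cdot> g"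
  shows "f = g"
  using biproduct_expand[OF assms(1-3)] assms(4-) by metis

lemma biproduct_unique_up_to_iso:
  assumes "is_biproduct A B P" "is_biproduct A B Q" "A \<in> Obj \<C>" "B \<in> Obj \<C>"
  shows "is_iso (bsum P) (bsum Q) (in1 Q \<cdot> pr1 P \<oplus> in2 Q \<cdot> pr2 P)"
proof -
  note P = biproductD[OF assms(1,3,4)] and Q = biproductD[OF assms(2,3,4)]
  show ?thesis
    by (rule isoI[where g = "in1 P \<cdot> pr1 Q \<oplus> in2 P \<cdot> pr2 Q"]) (simp_all add: cat P Q)
qed

lemma zero_object_mor:
  assumes "is_zero_object Z" "\<guillemotleft>f : Z \<rightarrow> A\<guillemotright> \<or> \<guillemotleft>f : A \<rightarrow> Z\<guillemotright>"
  shows "f = zmor (src f) (tgt f)"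
proof -
  have Z: "Z \<in> Obj \<C>" "\<And>A f g. \<lbrakk>\<guillemotleft>f : Z \<rightarrow> A\<guillemotright>; \<guillemotleft>g : Z \<rightarrow> A\<guillemotright>\<rbrakk> \<Longrightarrow> f = g"
    "\<And>A f g. \<lbrakk>\<guillemotleft>f : A \<rightarrow> Z\<guillemotright>; \<guillemotleft>g : A \<rightarrow> Z\<guillemotright>\<rbrakk> \<Longrightarrow> f = g"
    using assms(1) unfolding is_zero_object_def by (blast, (metis is_arr_iff)+)
  show ?thesis
    using assms(2)
  proof
    assume "\<guillemotleft>f : Z \<rightarrow> A\<guillemotright>"
    then show ?thesis using Z(2)[of f A "zmor Z A"] by (auto simp: cat)
  next
    assume "\<guillemotleft>f : A \<rightarrow> Z\<guillemotright>"
    then show ?thesis using Z(3)[of f A "zmor A Z"] by (auto simp: cat)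
  qed
qed

end

context additive_category
begin

lemma is_biproduct_biprod: "\<lbrakk>A \<in> Obj \<C>; B \<in> Obj \<C>\<rbrakk> \<Longrightarrow> is_biproduct A B (biprod A B)"
  unfolding biprod_def using biproduct_exists by (auto intro: someI_ex)

lemma col_eq: "\<lbrakk>\<guillemotleft>f : T \<rightarrow> A\<guillemotright>; \<guillemotleft>g : T \<rightarrow> B\<guillemotright>\<rbrakk> \<Longrightarrow> col T A B f g = in1 (biprod A B) \<cdot> f \<oplus> in2 (biprod A B) \<cdot> g"
  using biproductD(1,2)[OF is_biproduct_biprod, of A B] by (simp add: col_def pls_def cat)

lemma row_eq: "\<lbrakk>\<guillemotleft>f : A \<rightarrow> T\<guillemotright>; \<guillemotleft>g : B \<rightarrow> T\<guillemotright>\<rbrakk> \<Longrightarrow> row A B T f g = f \<cdot> pr1 (biprod A B) \<oplus> g \<cdot> pr2 (biprod A B)"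
  using biproductD(3,4)[OF is_biproduct_biprod, of A B] by (simp add: row_def pls_def cat)

lemma dsum_mor_eq:
  assumes "\<guillemotleft>f : A \<rightarrow> B\<guillemotright>" "\<guillemotleft>f' : A' \<rightarrow> B'\<guillemotright>"
  shows "dsum_mor A A' B B' f f' =
    in1 (biprod B B') \<cdot> (f \<cdot> pr1 (biprod A A')) \<oplus> in2 (biprod B B') \<cdot> (f' \<cdot> pr2 (biprod A A'))"
  using assms biproductD(1-4)[OF is_biproduct_biprod, of A A'] biproductD(1-4)[OF is_biproduct_biprod, of B B']
  by (simp add: dsum_mor_def mat_def row_eq col_eq cat)

end

section \<open>Sequences with three terms\<close>

context preadditive_category
begin

lemma is_seq3_iff: "is_seq3 A B C x y \<longleftrightarrow> \<guillemotleft>x : A \<rightarrow> B\<guillemotright> \<and> \<guillemotleft>y : B \<rightarrow> C\<guillemotright>"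
  unfolding is_seq3_def using is_arr_iff by blast

lemma is_complex_1_iff:
  "is_complex 1 X \<longleftrightarrow> (\<exists>A B C x y. X = Sq [A, B, C] [x, y] \<and>
     \<guillemotleft>x : A \<rightarrow> B\<guillemotright> \<and> \<guillemotleft>y : B \<rightarrow> C\<guillemotright> \<and> y \<cdot> x = zmor A C)" (is "?L \<longleftrightarrow> ?R")
proof
  assume L: ?L
  then have "length (objs X) = 3" "length (mors X) = 2"
    unfolding is_complex_def is_seq_def by simp_all
  then obtain A B C x y where X: "X = Sq [A, B, C] [x, y]"
    by (cases X) (auto simp: numeral_eq_Suc length_Suc_conv)
  have "\<forall>i\<le>1. df X i \<in> arr (ob X i) (ob X (i + 1))" "set (objs X) \<subseteq> Obj \<C>"
    "y \<cdot> x = zmor A C"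
    using L X by (auto simp: is_complex_def is_seq_def)
  then have "x \<in> arr A B" "y \<in> arr B C" "A \<in> Obj \<C>" "B \<in> Obj \<C>" "C \<in> Obj \<C>"
    using X by (auto simp: le_Suc_eq simp del: One_nat_def dest: spec[of _ 1] spec[of _ 0])
  then show ?R using X \<open>y \<cdot> x = zmor A C\<close> is_arr_iff by blast
next
  assume ?R
  then show ?L unfolding is_complex_def is_seq_def by (auto simp: le_Suc_eq)
qed

section \<open>Isomorphism classes against homotopy classes\<close>

lemma in_equiv_class3_iff:
  "Sq [A', B', C'] [x', y'] \<in> equiv_class3 A B C x y \<longleftrightarrow>
     A' = A \<and> C' = C \<and> is_seq3 A B' C x' y' \<and> (\<exists>b. is_iso B B' b \<and> b \<cdot> x = x' \<and> y' \<cdot> b = y)"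
  unfolding equiv_class3_def by auto

lemma equiv_class3_self:
  assumes "is_seq3 A B C x y"
  shows "Sq [A, B, C] [x, y] \<in> equiv_class3 A B C x y"
proof -
  have "is_iso B B (Idn \<C> B)" "Idn \<C> B \<cdot> x = x" "y \<cdot> Idn \<C> B = y"
    using assms by (auto simp: is_seq3_iff cat intro: isoI[of _ _ _ "Idn \<C> B"])
  then show ?thesis using assms by (auto simp: in_equiv_class3_iff)
qed

lemma equiv_class3_mono:
  assumes "is_seq3 A B C x y" "is_seq3 A B' C x' y'" "is_iso B B' b" "b \<cdot> x = x'" "y' \<cdot> b = y"
  shows "equiv_class3 A B' C x' y' \<subseteq> equiv_class3 A B C x y"
proof
  fix X assume "X \<in> equiv_class3 A B' C x' y'"
  then obtain B'' x'' y'' c where X: "X = Sq [A, B'', C] [x'', y'']" "is_seq3 A B'' C x'' y''"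
    "is_iso B' B'' c" "c \<cdot> x' = x''" "y'' \<cdot> c = y'"
    unfolding equiv_class3_def by blast
  have Obj: "B \<in> Obj \<C>" "B' \<in> Obj \<C>" "B'' \<in> Obj \<C>" using assms X by (auto simp: is_seq3_def)
  obtain b' where b: "\<guillemotleft>b : B \<rightarrow> B'\<guillemotright>" "\<guillemotleft>b' : B' \<rightarrow> B\<guillemotright>" "b' \<cdot> b = Idn \<C> B" "b \<cdot> b' = Idn \<C> B'"
    using isoE assms(3) Obj by metis
  obtain c' where c: "\<guillemotleft>c : B' \<rightarrow> B''\<guillemotright>" "\<guillemotleft>c' : B'' \<rightarrow> B'\<guillemotright>" "c' \<cdot> c = Idn \<C> B'" "c \<cdot> c' = Idn \<C> B''"
    using isoE X(3) Obj by metis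
  have "is_iso B B'' (c \<cdot> b)"
    using b c cmp_red[OF c(3)] cmp_red[OF b(4)] by (intro isoI[of _ _ _ "b' \<cdot> c'"]) (simp_all add: cat)
  moreover have "(c \<cdot> b) \<cdot> x = x''" "y'' \<cdot> (c \<cdot> b) = y"
    using assms X b c cmp_red[OF X(5), of b] by (simp_all add: is_seq3_iff cat)
  ultimately show "X \<in> equiv_class3 A B C x y"
    using X by (auto simp: in_equiv_class3_iff)
qed

lemma equiv_class3_eqI:
  assumes "is_seq3 A B C x y" "is_seq3 A B' C x' y'" "is_iso B B' b" "b \<cdot> x = x'" "y' \<cdot> b = y"
  shows "equiv_class3 A B' C x' y' = equiv_class3 A B C x y"
proof
  show "equiv_class3 A B' C x' y' \<subseteq> equiv_class3 A B C x y" using equiv_class3_mono assms by blast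
  have "B \<in> Obj \<C>" "B' \<in> Obj \<C>" using assms by (auto simp: is_seq3_def)
  then obtain b' where b: "\<guillemotleft>b : B \<rightarrow> B'\<guillemotright>" "\<guillemotleft>b' : B' \<rightarrow> B\<guillemotright>" "b' \<cdot> b = Idn \<C> B" "b \<cdot> b' = Idn \<C> B'"
    using isoE assms(3) by metis
  have "b' \<cdot> x' = x" "y \<cdot> b' = y'"
    using assms b cmp_red[OF b(3), of x] by (auto simp: is_seq3_iff cat)
  then show "equiv_class3 A B C x y \<subseteq> equiv_class3 A B' C x' y'"
    using equiv_class3_mono[OF assms(2,1), of b'] isoI[of b' B' B b] b by simp
qed

text \<open>
  For a complex with fixed end terms, a self-homotopy of the middle component has cube zero.
  Hence homotopy equivalence over fixed end terms already is isomorphism, without any exactness.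
\<close>

lemma homotopic_Idn_imp_iso:
  assumes "\<guillemotleft>x : A \<rightarrow> B\<guillemotright>" "\<guillemotleft>y : B \<rightarrow> C\<guillemotright>" "y \<cdot> x = zmor A C"
    and f: "f 0 = Idn \<C> A" "\<guillemotleft>f 1 : B \<rightarrow> B\<guillemotright>" "f 2 = Idn \<C> C"
    and "homotopic 1 (Sq [A, B, C] [x, y]) (Sq [A, B, C] [x, y]) f (\<lambda>i. Idn \<C> ([A, B, C] ! i))"
  shows "is_iso B B (f 1)"
proof -
  obtain \<phi> where \<phi>: "\<forall>i\<in>{1..1 + 1}. \<phi> i \<in> arr ([A, B, C] ! i) ([A, B, C] ! (i - 1))"
    "f 0 \<otimes>\<^bsub>Mor \<C> A A\<^esub> inv\<^bsub>Mor \<C> A A\<^esub> (Idn \<C> A) = \<phi> 1 \<cdot> x"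
    "f 1 \<otimes>\<^bsub>Mor \<C> B B\<^esub> inv\<^bsub>Mor \<C> B B\<^esub> (Idn \<C> B) = x \<cdot> \<phi> 1 \<otimes>\<^bsub>Mor \<C> B B\<^esub> \<phi> 2 \<cdot> y"
    "f 2 \<otimes>\<^bsub>Mor \<C> C C\<^esub> inv\<^bsub>Mor \<C> C C\<^esub> (Idn \<C> C) = y \<cdot> \<phi> 2"
    using assms(7) unfolding homotopic_def by (auto simp: numeral_2_eq_2)
  have "\<phi> 1 \<in> arr B A" "\<phi> 2 \<in> arr C B"
    using \<phi>(1)[rule_format, of 1] \<phi>(1)[rule_format, of 2] by auto
  then have a: "\<guillemotleft>\<phi> 1 : B \<rightarrow> A\<guillemotright>" "\<guillemotleft>\<phi> 2 : C \<rightarrow> B\<guillemotright>" using assms(1,2) is_arr_iff by blast+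
  \<comment> \<open>The end components of \<open>f\<close> are identities, so the homotopy relations
    in degrees 0 and 2 reduce to these two equations. Together with \<open>y \<cdot> x = 0\<close>
    they leave only one term in the square of the homotopy and none in its cube.\<close>
  have 0: "\<phi> 1 \<cdot> x = zmor A A" "y \<cdot> \<phi> 2 = zmor C C"
    using \<phi>(2,4) f assms(1,2) by (simp_all add: pls_def[symmetric] ng_def cat)
      (metis Idn_arr ng_def pls_def pls_ng(1))+
  have "f 1 \<oplus> \<ominus> (Idn \<C> B) = x \<cdot> \<phi> 1 \<oplus> \<phi> 2 \<cdot> y"
    using \<phi>(3) assms(1,2) f a by (simp add: pls_def ng_def cat)
  moreover have "(x \<cdot> \<phi> 1 \<oplus> \<phi> 2 \<cdot> y) \<cdot> ((x \<cdot> \<phi> 1 \<oplus> \<phi> 2 \<cdot> y) \<cdot> (x \<cdot> \<phi> 1 \<oplus> \<phi> 2 \<cdot> y)) = zmor B B"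
    using assms(1,2) a 0 cmp_red[OF 0(1)] cmp_red[OF 0(2)] cmp_red[OF assms(3)]
    by (simp add: cat)
  ultimately show ?thesis using f by (intro iso_if_diff_nilpotent) auto
qed

lemma chain_map_1_iff:
  assumes "\<guillemotleft>x : A \<rightarrow> B\<guillemotright>" "\<guillemotleft>y : B \<rightarrow> C\<guillemotright>" "\<guillemotleft>x' : A' \<rightarrow> B'\<guillemotright>" "\<guillemotleft>y' : B' \<rightarrow> C'\<guillemotright>"
  shows "chain_map 1 (Sq [A, B, C] [x, y]) (Sq [A', B', C'] [x', y']) f \<longleftrightarrow>
    \<guillemotleft>f 0 : A \<rightarrow> A'\<guillemotright> \<and> \<guillemotleft>f 1 : B \<rightarrow> B'\<guillemotright> \<and> \<guillemotleft>f 2 : C \<rightarrow> C'\<guillemotright> \<and>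
    f 1 \<cdot> x = x' \<cdot> f 0 \<and> f 2 \<cdot> y = y' \<cdot> f 1"
proof -
  have 1: "(\<forall>i\<le>1. P i) \<longleftrightarrow> P 0 \<and> P 1" "(\<forall>i\<le>1 + 1. P i) \<longleftrightarrow> P 0 \<and> P 1 \<and> P 2" for P :: "nat \<Rightarrow> bool"
    by (auto simp: le_Suc_eq numeral_2_eq_2)
  have "f 0 \<in> arr A A' \<longleftrightarrow> \<guillemotleft>f 0 : A \<rightarrow> A'\<guillemotright>" "f 1 \<in> arr B B' \<longleftrightarrow> \<guillemotleft>f 1 : B \<rightarrow> B'\<guillemotright>"
    "f 2 \<in> arr C C' \<longleftrightarrow> \<guillemotleft>f 2 : C \<rightarrow> C'\<guillemotright>"
    using assms is_arr_iff by blast+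
  then show ?thesis
    unfolding chain_map_def 1 by (simp add: one_add_one del: One_nat_def)
qed

lemma chain_map_AC_1_iff:
  assumes "\<guillemotleft>x : A \<rightarrow> B\<guillemotright>" "\<guillemotleft>y : B \<rightarrow> C\<guillemotright>" "\<guillemotleft>x' : A \<rightarrow> B'\<guillemotright>" "\<guillemotleft>y' : B' \<rightarrow> C\<guillemotright>"
  shows "chain_map_AC 1 A C (Sq [A, B, C] [x, y]) (Sq [A, B', C] [x', y']) f \<longleftrightarrow>
    f 0 = Idn \<C> A \<and> f 2 = Idn \<C> C \<and> \<guillemotleft>f 1 : B \<rightarrow> B'\<guillemotright> \<and> f 1 \<cdot> x = x' \<and> y' \<cdot> f 1 = y"
proof -
  have "\<guillemotleft>Idn \<C> A : A \<rightarrow> A\<guillemotright>" "\<guillemotleft>Idn \<C> C : C \<rightarrow> C\<guillemotright>" "x' \<cdot> Idn \<C> A = x'" "Idn \<C> C \<cdot> y = y"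
    using assms by (simp_all add: cat)
  then show ?thesis
    unfolding chain_map_AC_def chain_map_1_iff[OF assms] one_add_one by metis
qed

text \<open>For a homotopy equivalence \<open>f\<close>, \<open>g\<close> the middle components of
  both composites are isomorphisms by \<open>homotopic_Idn_imp_iso\<close>, hence so is
  \<open>f 1\<close>, even if \<open>g 1\<close> is not its inverse. Conversely, an isomorphism and
  its inverse form a homotopy equivalence with zero homotopies.\<close>

lemma homotopy_class_1:
  assumes "\<guillemotleft>x : A \<rightarrow> B\<guillemotright>" "\<guillemotleft>y : B \<rightarrow> C\<guillemotright>" "y \<cdot> x = zmor A C"
  shows "homotopy_class 1 (Sq [A, B, C] [x, y]) = equiv_class3 A B C x y"
proof
  show "homotopy_class 1 (Sq [A, B, C] [x, y]) \<subseteq> equiv_class3 A B C x y"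
  proof
    fix Y assume "Y \<in> homotopy_class 1 (Sq [A, B, C] [x, y])"
    then have Y: "is_complex_AC 1 A C Y" "homotopy_equivalent_AC 1 A C (Sq [A, B, C] [x, y]) Y"
      unfolding homotopy_class_def by simp_all
    have "is_complex 1 Y" "ob Y 0 = A" "ob Y 2 = C"
      using Y(1) by (simp_all add: is_complex_AC_def one_add_one del: One_nat_def)
    moreover obtain A' B' C' x' y' where "Y = Sq [A', B', C'] [x', y']" "\<guillemotleft>x' : A' \<rightarrow> B'\<guillemotright>"
      "\<guillemotleft>y' : B' \<rightarrow> C'\<guillemotright>" "y' \<cdot> x' = zmor A' C'"
      using \<open>is_complex 1 Y\<close> unfolding is_complex_1_iff by blast
    ultimately have Y': "Y = Sq [A, B', C] [x', y']" "\<guillemotleft>x' : A \<rightarrow> B'\<guillemotright>" "\<guillemotleft>y' : B' \<rightarrow> C\<guillemotright>"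
      "y' \<cdot> x' = zmor A C"
      by simp_all
    obtain f g where fg: "chain_map_AC 1 A C (Sq [A, B, C] [x, y]) Y f" "chain_map_AC 1 A C Y (Sq [A, B, C] [x, y]) g"
      and h: "homotopic 1 (Sq [A, B, C] [x, y]) (Sq [A, B, C] [x, y]) (\<lambda>i. g i \<cdot> f i) (\<lambda>i. Idn \<C> ([A, B, C] ! i))"
      "homotopic 1 Y Y (\<lambda>i. f i \<cdot> g i) (\<lambda>i. Idn \<C> (ob Y i))"
      using Y(2) unfolding homotopy_equivalent_AC_def by (simp del: One_nat_def) blast
    have f: "f 0 = Idn \<C> A" "f 2 = Idn \<C> C" "\<guillemotleft>f 1 : B \<rightarrow> B'\<guillemotright>" "f 1 \<cdot> x = x'" "y' \<cdot> f 1 = y"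
      using fg(1) chain_map_AC_1_iff[OF assms(1,2) Y'(2,3)] Y'(1) by simp_all
    have g: "g 0 = Idn \<C> A" "g 2 = Idn \<C> C" "\<guillemotleft>g 1 : B' \<rightarrow> B\<guillemotright>" "g 1 \<cdot> x' = x" "y \<cdot> g 1 = y'"
      using fg(2) chain_map_AC_1_iff[OF Y'(2,3) assms(1,2)] Y'(1) by simp_all
    have "is_iso B B (g 1 \<cdot> f 1)"
      using h(1) assms f g by (intro homotopic_Idn_imp_iso[of x A B y C "\<lambda>i. g i \<cdot> f i"]) (simp_all add: cat)
    moreover have "is_iso B' B' (f 1 \<cdot> g 1)"
      using h(2) Y' assms f g by (intro homotopic_Idn_imp_iso[of x' A B' y' C "\<lambda>i. f i \<cdot> g i"]) (simp_all add: cat)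
    ultimately have "is_iso B B' (f 1)" using f g iso_split_composites by blast
    then show "Y \<in> equiv_class3 A B C x y"
      using f Y' unfolding Y'(1) in_equiv_class3_iff is_seq3_iff by blast
  qed
next
  show "equiv_class3 A B C x y \<subseteq> homotopy_class 1 (Sq [A, B, C] [x, y])"
  proof
    fix Y assume "Y \<in> equiv_class3 A B C x y"
    then obtain B' x' y' b where Y: "Y = Sq [A, B', C] [x', y']" "is_seq3 A B' C x' y'"
      "is_iso B B' b" "b \<cdot> x = x'" "y' \<cdot> b = y"
      unfolding equiv_class3_def by blast
    have B': "B \<in> Obj \<C>" "B' \<in> Obj \<C>" "\<guillemotleft>x' : A \<rightarrow> B'\<guillemotright>" "\<guillemotleft>y' : B' \<rightarrow> C\<guillemotright>"
      using assms Y by (auto simp: is_seq3_iff)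
    obtain b' where b: "\<guillemotleft>b : B \<rightarrow> B'\<guillemotright>" "\<guillemotleft>b' : B' \<rightarrow> B\<guillemotright>" "b' \<cdot> b = Idn \<C> B" "b \<cdot> b' = Idn \<C> B'"
      using isoE Y(3) B' by metis
    have b': "b' \<cdot> x' = x" "y \<cdot> b' = y'"
      using assms Y(4,5) b B' cmp_red[OF b(3), of x] cmp_assoc[of b' b y'] by (auto simp: cat)
    have "y' \<cdot> x' = zmor A C"
      using assms Y(4,5) b B' cmp_assoc[of x b y'] by auto
    then have "is_complex_AC 1 A C Y"
      using Y B' unfolding is_complex_AC_def is_complex_1_iff by auto
    moreover have "homotopy_equivalent_AC 1 A C (Sq [A, B, C] [x, y]) Y"
      unfolding homotopy_equivalent_AC_def
    proof (intro exI conjI)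
      let ?f = "\<lambda>i::nat. if i = 0 then Idn \<C> A else if i = 1 then b else Idn \<C> C"
      let ?g = "\<lambda>i::nat. if i = 0 then Idn \<C> A else if i = 1 then b' else Idn \<C> C"
      have *: "homotopic 1 (Sq [A, E, C] [u, v]) (Sq [A, E, C] [u, v]) h (\<lambda>i. Idn \<C> (ob (Sq [A, E, C] [u, v]) i))"
        if "\<guillemotleft>u : A \<rightarrow> E\<guillemotright>" "\<guillemotleft>v : E \<rightarrow> C\<guillemotright>" "h 0 = Idn \<C> A" "h (1::nat) = Idn \<C> E" "h 2 = Idn \<C> C"
        for E u v h
      proof -
        have i: "Idn \<C> D \<otimes>\<^bsub>Mor \<C> D D\<^esub> inv\<^bsub>Mor \<C> D D\<^esub> (Idn \<C> D) = zmor D D" if "D \<in> Obj \<C>" for D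
          using that pls_ng(1)[of "Idn \<C> D"] by (simp add: pls_def ng_def Idn_arr)
        have z: "zmor D D \<otimes>\<^bsub>Mor \<C> D D\<^esub> zmor D D = zmor D D" if "D \<in> Obj \<C>" for D
          using that monoid_Mor by (simp add: monoid.l_one)
        show ?thesis unfolding homotopic_def
          using that i z
          by (intro exI[of _ "\<lambda>i. if i = 1 then zmor E A else zmor C E"])
            (auto simp: numeral_2_eq_2 cat less_Suc_eq_le)
      qed
      show "chain_map_AC 1 A C (Sq [A, B, C] [x, y]) Y ?f"
        using b Y chain_map_AC_1_iff[OF assms(1,2) B'(3,4)] by simp
      show "chain_map_AC 1 A C Y (Sq [A, B, C] [x, y]) ?g"
        using b b' Y chain_map_AC_1_iff[OF B'(3,4) assms(1,2)] by simp
      show "homotopic 1 (Sq [A, B, C] [x, y]) (Sq [A, B, C] [x, y]) (\<lambda>i. ?g i \<cdot> ?f i)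
          (\<lambda>i. Idn \<C> (ob (Sq [A, B, C] [x, y]) i))"
        using assms b by (intro *) (simp_all add: cat)
      show "homotopic 1 Y Y (\<lambda>i. ?f i \<cdot> ?g i) (\<lambda>i. Idn \<C> (ob Y i))"
        unfolding Y(1) using assms b B' by (intro *) (simp_all add: cat)
    qed
    ultimately show "Y \<in> homotopy_class 1 (Sq [A, B, C] [x, y])"
      unfolding homotopy_class_def by simp
  qed
qed

end

section \<open>Biadditive functors\<close>

context biadditive_functor
begin

lemma realized_byD:
  assumes "realized_by \<ss> \<delta> A B C x y"
  shows "\<guillemotleft>x : A \<rightarrow> B\<guillemotright>" "\<guillemotleft>y : B \<rightarrow> C\<guillemotright>" "\<delta> \<in> ext C A"
  using assms by (auto simp: realized_by_def is_seq3_iff)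

lemma realized_by_iso:
  assumes "realized_by \<ss> \<delta> A B C x y" "is_iso B B' b" "b \<cdot> x = x'" "y' \<cdot> b = y" "\<guillemotleft>y' : B' \<rightarrow> C\<guillemotright>"
  shows "realized_by \<ss> \<delta> A B' C x' y'"
proof -
  have B: "B \<in> Obj \<C>" using assms by (auto simp: realized_by_def is_seq3_def)
  have "\<guillemotleft>b : B \<rightarrow> B'\<guillemotright>" using isoE[OF assms(2) B] assms(5) by blast
  then have "is_seq3 A B' C x' y'"
    using assms(1,3,5) by (auto simp: realized_by_def is_seq3_iff cat)
  then show ?thesis
    using assms equiv_class3_eqI[of A B C x y B' x' y' b] by (auto simp: realized_by_def)
qed

lemma realized_by_unique:
  assumes "realized_by \<ss> \<delta> A B C x y" "realized_by \<ss> \<delta> A B' C x' y'"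
  shows "\<exists>b. is_iso B B' b \<and> b \<cdot> x = x' \<and> y' \<cdot> b = y"
proof -
  have "Sq [A, B', C] [x', y'] \<in> equiv_class3 A B C x y"
    using assms equiv_class3_self[of A B' C x' y'] unfolding realized_by_def by metis
  then show ?thesis unfolding in_equiv_class3_iff by blast
qed

text \<open>\<open>realized_by\<close> is an equality of isomorphism classes and says nothing about
  \<open>y \<cdot> x\<close>, whereas \<open>distinguished\<close> concerns complexes; hence the
  separate clause. On complexes the two kinds of classes agree by
  \<open>homotopy_class_1\<close>.\<close>

lemma distinguished_1_iff:
  "distinguished 1 \<ss> X \<delta> \<longleftrightarrow>
    (\<exists>A B C x y. X = Sq [A, B, C] [x, y] \<and> y \<cdot> x = zmor A C \<and> realized_by \<ss> \<delta> A B C x y)"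
proof -
  have "distinguished 1 \<ss> (Sq [A, B, C] [x, y]) \<delta> \<longleftrightarrow> y \<cdot> x = zmor A C \<and> realized_by \<ss> \<delta> A B C x y"
    if "is_complex 1 (Sq [A, B, C] [x, y])" for A B C x y
  proof -
    have "\<guillemotleft>x : A \<rightarrow> B\<guillemotright>" "\<guillemotleft>y : B \<rightarrow> C\<guillemotright>" "y \<cdot> x = zmor A C"
      using that unfolding is_complex_1_iff by blast+
    then show ?thesis
      using that homotopy_class_1[of x A B y C]
      by (simp add: distinguished_def realized_by_def is_seq3_iff del: One_nat_def)
  qed
  moreover have "is_complex 1 X" if "distinguished 1 \<ss> X \<delta>" using that unfolding distinguished_def by blast
  moreover have "is_complex 1 (Sq [A, B, C] [x, y])"
    if "y \<cdot> x = zmor A C" "realized_by \<ss> \<delta> A B C x y" for A B C x y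
    using that realized_byD[OF that(2)] unfolding is_complex_1_iff by blast
  ultimately show ?thesis using is_complex_1_iff by metis
qed

section \<open>Extension groups and the action of morphisms on them\<close>

lemma group_Ext: "\<lbrakk>C \<in> Obj \<C>; A \<in> Obj \<C>\<rbrakk> \<Longrightarrow> group (Ext \<E> C A)"
  using Ext_comm_group comm_group.axioms(2) by blast

lemma Ext_monoid [cat]:
  assumes "C \<in> Obj \<C>" "A \<in> Obj \<C>"
  shows "zext C A \<in> ext C A"
    and "\<delta> \<in> ext C A \<Longrightarrow> \<delta> \<otimes>\<^bsub>Ext \<E> C A\<^esub> zext C A = \<delta>"
    and "\<delta> \<in> ext C A \<Longrightarrow> zext C A \<otimes>\<^bsub>Ext \<E> C A\<^esub> \<delta> = \<delta>"
    and "\<delta> \<in> ext C A \<Longrightarrow> \<rho> \<in> ext C A \<Longrightarrow> \<delta> \<otimes>\<^bsub>Ext \<E> C A\<^esub> \<rho> \<in> ext C A"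
  using group.is_monoid[OF group_Ext[OF assms]]
  by (simp_all add: monoid.one_closed monoid.l_one monoid.r_one monoid.m_closed)

lemma ExtMap_in: "\<lbrakk>\<guillemotleft>c : C' \<rightarrow> C\<guillemotright>; \<guillemotleft>a : A \<rightarrow> A'\<guillemotright>; \<delta> \<in> ext C A\<rbrakk> \<Longrightarrow> ExtMap \<E> c a \<delta> \<in> ext C' A'"
  using ExtMap_hom[of C C' A A' c a] by (auto simp: hom_def Pi_def)

lemma ExtMap_mult:
  "\<lbrakk>\<guillemotleft>c : C' \<rightarrow> C\<guillemotright>; \<guillemotleft>a : A \<rightarrow> A'\<guillemotright>; \<delta> \<in> ext C A; \<rho> \<in> ext C A\<rbrakk>
    \<Longrightarrow> ExtMap \<E> c a (\<delta> \<otimes>\<^bsub>Ext \<E> C A\<^esub> \<rho>) = ExtMap \<E> c a \<delta> \<otimes>\<^bsub>Ext \<E> C' A'\<^esub> ExtMap \<E> c a \<rho>"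
  using ExtMap_hom[of C C' A A' c a] by (auto simp: hom_def)

lemma ExtMap_one: "\<lbrakk>\<guillemotleft>c : C' \<rightarrow> C\<guillemotright>; \<guillemotleft>a : A \<rightarrow> A'\<guillemotright>\<rbrakk> \<Longrightarrow> ExtMap \<E> c a (zext C A) = zext C' A'"
  by (rule hom_one[OF ExtMap_hom]) (auto intro: group_Ext)

lemma pull_in [cat]:
  "\<lbrakk>mor c; A \<in> Obj \<C>; \<delta> \<in> ext (tgt c) A; src c = C'\<rbrakk> \<Longrightarrow> pull A c \<delta> \<in> ext C' A"
  unfolding pull_def by (rule ExtMap_in) (auto simp: cat)

lemma push_in [cat]:
  "\<lbrakk>mor a; C \<in> Obj \<C>; \<delta> \<in> ext C (src a); tgt a = A'\<rbrakk> \<Longrightarrow> push C a \<delta> \<in> ext C A'"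
  unfolding push_def by (rule ExtMap_in) (auto simp: cat)

lemma pull_Idn [cat]: "\<lbrakk>\<delta> \<in> ext C A; C \<in> Obj \<C>; A \<in> Obj \<C>\<rbrakk> \<Longrightarrow> pull A (Idn \<C> C) \<delta> = \<delta>"
  unfolding pull_def by (rule ExtMap_Idn)

lemma push_Idn [cat]: "\<lbrakk>\<delta> \<in> ext C A; C \<in> Obj \<C>; A \<in> Obj \<C>\<rbrakk> \<Longrightarrow> push C (Idn \<C> A) \<delta> = \<delta>"
  unfolding push_def by (rule ExtMap_Idn)

lemma ExtMap_ExtMap:
  assumes "mor c" "mor c'" "tgt c' = src c" "mor a" "mor a'" "tgt a = src a'" "\<delta> \<in> ext (tgt c) (src a)"
  shows "ExtMap \<E> c' a' (ExtMap \<E> c a \<delta>) = ExtMap \<E> (c \<cdot> c') (a' \<cdot> a) \<delta>"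
  using assms
  by (intro ExtMap_Cmp[symmetric, of "tgt c" "src c" "src c'" "src a" "tgt a" "tgt a'"]) (simp_all add: cat)

lemma pull_pull [cat]:
  "\<lbrakk>mor c; mor c'; tgt c' = src c; A \<in> Obj \<C>; \<delta> \<in> ext (tgt c) A\<rbrakk>
    \<Longrightarrow> pull A c' (pull A c \<delta>) = pull A (c \<cdot> c') \<delta>"
  unfolding pull_def by (simp add: ExtMap_ExtMap cat)

lemma push_push [cat]:
  "\<lbrakk>mor a; mor a'; tgt a = src a'; C \<in> Obj \<C>; \<delta> \<in> ext C (src a)\<rbrakk>
    \<Longrightarrow> push C a' (push C a \<delta>) = push C (a' \<cdot> a) \<delta>"
  unfolding push_def by (simp add: ExtMap_ExtMap cat)

lemma pull_push:
  assumes "mor c" "mor a" "\<delta> \<in> ext (tgt c) (src a)" "tgt a = A'" "tgt c = C"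
  shows "pull A' c (push C a \<delta>) = ExtMap \<E> c a \<delta>"
proof -
  have "A' \<in> Obj \<C>" "C \<in> Obj \<C>" using assms src_tgt_Obj by auto
  then show ?thesis using assms unfolding push_def pull_def by (simp add: ExtMap_ExtMap cat)
qed

text \<open>Both sides are \<open>\<E>(c, a)\<close> applied to \<delta>. The orientation puts
  pullbacks outside; with \<open>pull_pull\<close> and \<open>push_push\<close>, every iterated
  action is reduced to one pullback of one pushforward.\<close>

lemma push_pull [cat]:
  assumes "mor c" "mor a" "\<delta> \<in> ext (tgt c) A" "src a = A" "src c = C'"
  shows "push C' a (pull A c \<delta>) = pull (tgt a) c (push (tgt c) a \<delta>)"
proof -
  have "A \<in> Obj \<C>" "C' \<in> Obj \<C>" using assms src_tgt_Obj by auto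
  then show ?thesis using assms
    unfolding pull_push[OF assms(1,2) assms(3)[folded assms(4)] refl refl]
    unfolding push_def pull_def by (simp add: ExtMap_ExtMap cat)
qed

lemma pull_zext [cat]:
  "\<lbrakk>mor c; tgt c = C; A \<in> Obj \<C>\<rbrakk> \<Longrightarrow> pull A c (zext C A) = zext (src c) A"
  unfolding pull_def by (rule ExtMap_one) (auto simp: cat)

lemma push_zext [cat]:
  "\<lbrakk>mor a; src a = A; C \<in> Obj \<C>\<rbrakk> \<Longrightarrow> push C a (zext C A) = zext C (tgt a)"
  unfolding push_def by (rule ExtMap_one) (auto simp: cat)

lemma pull_mult [cat]:
  "\<lbrakk>mor c; tgt c = C; A \<in> Obj \<C>; \<delta> \<in> ext C A; \<rho> \<in> ext C A\<rbrakk>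
    \<Longrightarrow> pull A c (\<delta> \<otimes>\<^bsub>Ext \<E> C A\<^esub> \<rho>) = pull A c \<delta> \<otimes>\<^bsub>Ext \<E> (src c) A\<^esub> pull A c \<rho>"
  unfolding pull_def by (rule ExtMap_mult) (auto simp: cat)

lemma push_mult [cat]:
  "\<lbrakk>mor a; src a = A; C \<in> Obj \<C>; \<delta> \<in> ext C A; \<rho> \<in> ext C A\<rbrakk>
    \<Longrightarrow> push C a (\<delta> \<otimes>\<^bsub>Ext \<E> C A\<^esub> \<rho>) = push C a \<delta> \<otimes>\<^bsub>Ext \<E> C (tgt a)\<^esub> push C a \<rho>"
  unfolding push_def by (rule ExtMap_mult) (auto simp: cat)

lemma pull_pls [cat]:
  assumes "mor c" "mor c'" "src c' = src c" "tgt c' = tgt c" "A \<in> Obj \<C>" "\<delta> \<in> ext (tgt c) A"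
  shows "pull A (c \<oplus> c') \<delta> = pull A c \<delta> \<otimes>\<^bsub>Ext \<E> (src c) A\<^esub> pull A c' \<delta>"
  unfolding pull_def pls_def using assms
  by (intro ExtMap_add_left[of "tgt c"]) (simp_all add: cat)

lemma push_pls [cat]:
  assumes "mor a" "mor a'" "src a' = src a" "tgt a' = tgt a" "C \<in> Obj \<C>" "\<delta> \<in> ext C (src a)"
  shows "push C (a \<oplus> a') \<delta> = push C a \<delta> \<otimes>\<^bsub>Ext \<E> C (tgt a)\<^esub> push C a' \<delta>"
  unfolding push_def pls_def using assms
  by (intro ExtMap_add_right[of C C "src a"]) (simp_all add: cat)

lemma Ext_self_mult_imp:
  assumes "\<delta> \<otimes>\<^bsub>Ext \<E> C A\<^esub> \<delta> = \<delta>" "\<delta> \<in> ext C A" "C \<in> Obj \<C>" "A \<in> Obj \<C>"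
  shows "\<delta> = zext C A"
  using group.l_cancel_one[OF group_Ext[OF assms(3,4)], of \<delta> \<delta>] assms by simp

lemma pull_zmor [cat]:
  assumes "C \<in> Obj \<C>" "C' \<in> Obj \<C>" "A \<in> Obj \<C>" "\<delta> \<in> ext C A"
  shows "pull A (zmor C' C) \<delta> = zext C' A"
proof -
  have "pull A (zmor C' C \<oplus> zmor C' C) \<delta> = pull A (zmor C' C) \<delta> \<otimes>\<^bsub>Ext \<E> C' A\<^esub> pull A (zmor C' C) \<delta>"
    using pull_pls[of "zmor C' C" "zmor C' C" A \<delta>] assms by (simp only: zmor_arr)
  then have "pull A (zmor C' C) \<delta> \<otimes>\<^bsub>Ext \<E> C' A\<^esub> pull A (zmor C' C) \<delta> = pull A (zmor C' C) \<delta>"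
    using assms by (simp add: pls_zmor zmor_arr)
  then show ?thesis using assms by (intro Ext_self_mult_imp) (simp_all add: cat)
qed

lemma push_zmor [cat]:
  assumes "C \<in> Obj \<C>" "A' \<in> Obj \<C>" "A \<in> Obj \<C>" "\<delta> \<in> ext C A"
  shows "push C (zmor A A') \<delta> = zext C A'"
proof -
  have "push C (zmor A A' \<oplus> zmor A A') \<delta> = push C (zmor A A') \<delta> \<otimes>\<^bsub>Ext \<E> C A'\<^esub> push C (zmor A A') \<delta>"
    using push_pls[of "zmor A A'" "zmor A A'" C \<delta>] assms by (simp only: zmor_arr)
  then have "push C (zmor A A') \<delta> \<otimes>\<^bsub>Ext \<E> C A'\<^esub> push C (zmor A A') \<delta> = push C (zmor A A') \<delta>"
    using assms by (simp add: pls_zmor zmor_arr)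
  then show ?thesis using assms by (intro Ext_self_mult_imp) (simp_all add: cat)
qed

lemma ext_morphism_iff:
  "\<lbrakk>A \<in> Obj \<C>; B \<in> Obj \<C>; C \<in> Obj \<C>; D \<in> Obj \<C>\<rbrakk> \<Longrightarrow>
    ext_morphism C A \<delta> D B \<rho> a c \<longleftrightarrow> \<guillemotleft>a : A \<rightarrow> B\<guillemotright> \<and> \<guillemotleft>c : C \<rightarrow> D\<guillemotright> \<and> push C a \<delta> = pull B c \<rho>"
  unfolding ext_morphism_def using is_arr_iff by blast

text \<open>The exact sequence of \<delta> under \<open>\<C>(T, -)\<close>, ending in
  \<open>\<E>(T, A)\<close>. Vanishing of composites is demanded only for the universal elements,
  since the general case follows by precomposition; factorization through \<open>x\<close> and
  \<open>y\<close> stays pointwise. \<open>rexact\<close> is the same for \<open>\<C>(-, T)\<close>,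
  and the opposite category exchanges the two.\<close>

definition lexact :: "'o \<Rightarrow> 'o \<Rightarrow> 'o \<Rightarrow> 'm \<Rightarrow> 'm \<Rightarrow> 'e \<Rightarrow> bool" where
  "lexact A B C x y \<delta> \<longleftrightarrow> \<guillemotleft>x : A \<rightarrow> B\<guillemotright> \<and> \<guillemotleft>y : B \<rightarrow> C\<guillemotright> \<and> \<delta> \<in> ext C A \<and>
     y \<cdot> x = zmor A C \<and> pull A y \<delta> = zext B A \<and>
     (\<forall>T g. \<guillemotleft>g : T \<rightarrow> B\<guillemotright> \<longrightarrow> y \<cdot> g = zmor T C \<longrightarrow> (\<exists>k. \<guillemotleft>k : T \<rightarrow> A\<guillemotright> \<and> g = x \<cdot> k)) \<and>
     (\<forall>T g. \<guillemotleft>g : T \<rightarrow> C\<guillemotright> \<longrightarrow> pull A g \<delta> = zext T A \<longrightarrow> (\<exists>k. \<guillemotleft>k : T \<rightarrow> B\<guillemotright> \<and> g = y \<cdot> k))"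

definition rexact :: "'o \<Rightarrow> 'o \<Rightarrow> 'o \<Rightarrow> 'm \<Rightarrow> 'm \<Rightarrow> 'e \<Rightarrow> bool" where
  "rexact A B C x y \<delta> \<longleftrightarrow> \<guillemotleft>x : A \<rightarrow> B\<guillemotright> \<and> \<guillemotleft>y : B \<rightarrow> C\<guillemotright> \<and> \<delta> \<in> ext C A \<and>
     y \<cdot> x = zmor A C \<and> push C x \<delta> = zext C B \<and>
     (\<forall>T g. \<guillemotleft>g : B \<rightarrow> T\<guillemotright> \<longrightarrow> g \<cdot> x = zmor A T \<longrightarrow> (\<exists>k. \<guillemotleft>k : C \<rightarrow> T\<guillemotright> \<and> g = k \<cdot> y)) \<and>
     (\<forall>T g. \<guillemotleft>g : A \<rightarrow> T\<guillemotright> \<longrightarrow> push C g \<delta> = zext C T \<longrightarrow> (\<exists>k. \<guillemotleft>k : B \<rightarrow> T\<guillemotright> \<and> g = k \<cdot> x))"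

lemma lexactD:
  assumes "lexact A B C x y \<delta>"
  shows "\<guillemotleft>x : A \<rightarrow> B\<guillemotright>" "\<guillemotleft>y : B \<rightarrow> C\<guillemotright>" "\<delta> \<in> ext C A" "y \<cdot> x = zmor A C" "pull A y \<delta> = zext B A"
    "\<And>w. \<lbrakk>mor w; tgt w = A\<rbrakk> \<Longrightarrow> y \<cdot> (x \<cdot> w) = zmor (src w) C"
  using assms cmp_red[of y x] unfolding lexact_def by (simp_all add: cat)

lemma lexact_kernel:
  assumes "lexact A B C x y \<delta>" "\<guillemotleft>g : T \<rightarrow> B\<guillemotright>" "y \<cdot> g = zmor T C"
  obtains k where "\<guillemotleft>k : T \<rightarrow> A\<guillemotright>" "g = x \<cdot> k"
  using assms unfolding lexact_def by blast

lemma lexact_lift: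
  assumes "lexact A B C x y \<delta>" "\<guillemotleft>g : T \<rightarrow> C\<guillemotright>" "pull A g \<delta> = zext T A"
  obtains k where "\<guillemotleft>k : T \<rightarrow> B\<guillemotright>" "g = y \<cdot> k"
  using assms unfolding lexact_def by blast

lemma rexactD:
  assumes "rexact A B C x y \<delta>"
  shows "\<guillemotleft>x : A \<rightarrow> B\<guillemotright>" "\<guillemotleft>y : B \<rightarrow> C\<guillemotright>" "\<delta> \<in> ext C A" "y \<cdot> x = zmor A C" "push C x \<delta> = zext C B"
  using assms unfolding rexact_def by (simp_all add: cat)

lemma rexact_cokernel:
  assumes "rexact A B C x y \<delta>" "\<guillemotleft>g : B \<rightarrow> T\<guillemotright>" "g \<cdot> x = zmor A T"
  obtains k where "\<guillemotleft>k : C \<rightarrow> T\<guillemotright>" "g = k \<cdot> y"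
  using assms unfolding rexact_def by blast

lemma rexact_extend:
  assumes "rexact A B C x y \<delta>" "\<guillemotleft>g : A \<rightarrow> T\<guillemotright>" "push C g \<delta> = zext C T"
  obtains k where "\<guillemotleft>k : B \<rightarrow> T\<guillemotright>" "g = k \<cdot> x"
  using assms unfolding rexact_def by blast

lemma Collect_eq_imageI:
  assumes "\<And>k. k \<in> K \<Longrightarrow> F k \<in> G \<and> P (F k)" "\<And>g. \<lbrakk>g \<in> G; P g\<rbrakk> \<Longrightarrow> \<exists>k\<in>K. g = F k"
  shows "{g \<in> G. P g} = F ` K"
  using assms by blast

lemma exangle_1_iff:
  assumes "\<guillemotleft>x : A \<rightarrow> B\<guillemotright>" "\<guillemotleft>y : B \<rightarrow> C\<guillemotright>"
  shows "exangle 1 (Sq [A, B, C] [x, y]) \<delta> \<longleftrightarrow> lexact A B C x y \<delta> \<and> rexact A B C x y \<delta>"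
    (is "?L \<longleftrightarrow> ?R")
proof -
  have Obj: "A \<in> Obj \<C>" "B \<in> Obj \<C>" "C \<in> Obj \<C>" using assms by auto
  have arr: "f \<in> arr D E \<longleftrightarrow> \<guillemotleft>f : D \<rightarrow> E\<guillemotright>" if "D \<in> Obj \<C>" "E \<in> Obj \<C>" for f D E
    using that is_arr_iff by blast
  have L: "?L \<longleftrightarrow> y \<cdot> x = zmor A C \<and> \<delta> \<in> ext C A \<and>
    (\<forall>T\<in>Obj \<C>. {g \<in> arr T B. y \<cdot> g = zmor T C} = (\<lambda>h. x \<cdot> h) ` arr T A \<and>
       {g \<in> arr T C. pull A g \<delta> = zext T A} = (\<lambda>h. y \<cdot> h) ` arr T B) \<and>
    (\<forall>T\<in>Obj \<C>. {g \<in> arr B T. g \<cdot> x = zmor A T} = (\<lambda>h. h \<cdot> y) ` arr C T \<and>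
       {g \<in> arr A T. push C g \<delta> = zext C T} = (\<lambda>h. h \<cdot> x) ` arr B T)"
    using assms unfolding exangle_def
    by (simp add: is_complex_def is_seq_def le_Suc_eq conj_ac all_conj_distrib)
  show ?thesis
  proof
    assume ?L
    note l = this[unfolded L]
    note l' = l[THEN conjunct2, THEN conjunct2, THEN conjunct1, THEN bspec]
      l[THEN conjunct2, THEN conjunct2, THEN conjunct2, THEN bspec]
    have a: "{g \<in> arr T B. y \<cdot> g = zmor T C} = (\<lambda>h. x \<cdot> h) ` arr T A"
       "{g \<in> arr T C. pull A g \<delta> = zext T A} = (\<lambda>h. y \<cdot> h) ` arr T B"
       "{g \<in> arr B T. g \<cdot> x = zmor A T} = (\<lambda>h. h \<cdot> y) ` arr C T"
       "{g \<in> arr A T. push C g \<delta> = zext C T} = (\<lambda>h. h \<cdot> x) ` arr B T" if "T \<in> Obj \<C>" for T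
      using l'(1)[OF that] l'(2)[OF that] by (iprover elim: conjE)+
    \<comment> \<open>Evaluation at \<open>B\<close>: the morphisms \<open>x\<close> and
      \<open>y\<close> are themselves images, namely of the identity, so the extension vanishes on
      them.\<close>
    have "y \<cdot> Idn \<C> B = y" "Idn \<C> B \<cdot> x = x" using assms by (simp_all add: cat)
    then have "y \<in> (\<lambda>h. y \<cdot> h) ` arr B B" "x \<in> (\<lambda>h. h \<cdot> x) ` arr B B"
      using Idn_in[OF Obj(2)] by (metis imageI)+
    then have 0: "pull A y \<delta> = zext B A" "push C x \<delta> = zext C B"
      using a(2)[OF Obj(2)] a(4)[OF Obj(2)] by auto
    have "\<exists>k. \<guillemotleft>k : T \<rightarrow> A\<guillemotright> \<and> g = x \<cdot> k" if "\<guillemotleft>g : T \<rightarrow> B\<guillemotright>" "y \<cdot> g = zmor T C" for T g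
      using a(1)[of T] that arr[of T] Obj by blast
    moreover have "\<exists>k. \<guillemotleft>k : T \<rightarrow> B\<guillemotright> \<and> g = y \<cdot> k" if "\<guillemotleft>g : T \<rightarrow> C\<guillemotright>" "pull A g \<delta> = zext T A" for T g
      using a(2)[of T] that arr[of T] Obj by blast
    moreover have "\<exists>k. \<guillemotleft>k : C \<rightarrow> T\<guillemotright> \<and> g = k \<cdot> y" if "\<guillemotleft>g : B \<rightarrow> T\<guillemotright>" "g \<cdot> x = zmor A T" for T g
      using a(3)[of T] that arr[of _ T] Obj by blast
    moreover have "\<exists>k. \<guillemotleft>k : B \<rightarrow> T\<guillemotright> \<and> g = k \<cdot> x" if "\<guillemotleft>g : A \<rightarrow> T\<guillemotright>" "push C g \<delta> = zext C T" for T g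
      using a(4)[of T] that arr[of _ T] Obj by blast
    ultimately show ?R
      unfolding lexact_def rexact_def using assms l[THEN conjunct1] l[THEN conjunct2, THEN conjunct1] 0
      by (intro conjI allI impI) iprover+
  next
    assume R: ?R
    then have r: "y \<cdot> x = zmor A C" "pull A y \<delta> = zext B A" "push C x \<delta> = zext C B" "\<delta> \<in> ext C A"
      unfolding lexact_def rexact_def by blast+
    have RL: "lexact A B C x y \<delta>" and RR: "rexact A B C x y \<delta>" using R by blast+
    have "{g \<in> arr T B. y \<cdot> g = zmor T C} = (\<lambda>h. x \<cdot> h) ` arr T A" 
         "{g \<in> arr T C. pull A g \<delta> = zext T A} = (\<lambda>h. y \<cdot> h) ` arr T B"
         "{g \<in> arr B T. g \<cdot> x = zmor A T} = (\<lambda>h. h \<cdot> y) ` arr C T"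
         "{g \<in> arr A T. push C g \<delta> = zext C T} = (\<lambda>h. h \<cdot> x) ` arr B T" if "T \<in> Obj \<C>" for T
    proof -
      show "{g \<in> arr T B. y \<cdot> g = zmor T C} = (\<lambda>h. x \<cdot> h) ` arr T A"
      proof (rule Collect_eq_imageI)
        fix k assume "k \<in> arr T A"
        then have "\<guillemotleft>k : T \<rightarrow> A\<guillemotright>" using arr that Obj by blast
        then show "x \<cdot> k \<in> arr T B \<and> y \<cdot> (x \<cdot> k) = zmor T C"
          using assms r cmp_red[OF r(1), of k] by (simp add: cat)
      next
        fix g assume g: "g \<in> arr T B" "y \<cdot> g = zmor T C"
        then have "\<guillemotleft>g : T \<rightarrow> B\<guillemotright>" using arr that Obj by blast
        then obtain k where k: "\<guillemotleft>k : T \<rightarrow> A\<guillemotright>" "g = x \<cdot> k" using lexact_kernel[OF RL _ g(2)] by blast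
        have "k \<in> arr T A" using k(1) arr that Obj by blast
        then show "\<exists>k\<in>arr T A. g = x \<cdot> k" using k(2) by blast
      qed
      show "{g \<in> arr T C. pull A g \<delta> = zext T A} = (\<lambda>h. y \<cdot> h) ` arr T B"
      proof (rule Collect_eq_imageI)
        fix k assume "k \<in> arr T B"
        then have "\<guillemotleft>k : T \<rightarrow> B\<guillemotright>" using arr that Obj by blast
        then show "y \<cdot> k \<in> arr T C \<and> pull A (y \<cdot> k) \<delta> = zext T A"
          using assms r by (simp add: cat flip: pull_pull)
      next
        fix g assume g: "g \<in> arr T C" "pull A g \<delta> = zext T A"
        then have "\<guillemotleft>g : T \<rightarrow> C\<guillemotright>" using arr that Obj by blast
        then obtain k where k: "\<guillemotleft>k : T \<rightarrow> B\<guillemotright>" "g = y \<cdot> k" using lexact_lift[OF RL _ g(2)] by blast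
        have "k \<in> arr T B" using k(1) arr that Obj by blast
        then show "\<exists>k\<in>arr T B. g = y \<cdot> k" using k(2) by blast
      qed
      show "{g \<in> arr B T. g \<cdot> x = zmor A T} = (\<lambda>h. h \<cdot> y) ` arr C T"
      proof (rule Collect_eq_imageI)
        fix k assume "k \<in> arr C T"
        then have "\<guillemotleft>k : C \<rightarrow> T\<guillemotright>" using arr that Obj by blast
        then show "k \<cdot> y \<in> arr B T \<and> (k \<cdot> y) \<cdot> x = zmor A T"
          using assms r by (simp add: cat)
      next
        fix g assume g: "g \<in> arr B T" "g \<cdot> x = zmor A T"
        then have "\<guillemotleft>g : B \<rightarrow> T\<guillemotright>" using arr that Obj by blast
        then obtain k where k: "\<guillemotleft>k : C \<rightarrow> T\<guillemotright>" "g = k \<cdot> y" using rexact_cokernel[OF RR _ g(2)] by blast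
        have "k \<in> arr C T" using k(1) arr that Obj by blast
        then show "\<exists>k\<in>arr C T. g = k \<cdot> y" using k(2) by blast
      qed
      show "{g \<in> arr A T. push C g \<delta> = zext C T} = (\<lambda>h. h \<cdot> x) ` arr B T"
      proof (rule Collect_eq_imageI)
        fix k assume "k \<in> arr B T"
        then have "\<guillemotleft>k : B \<rightarrow> T\<guillemotright>" using arr that Obj by blast
        then show "k \<cdot> x \<in> arr A T \<and> push C (k \<cdot> x) \<delta> = zext C T"
          using assms r by (simp add: cat flip: push_push)
      next
        fix g assume g: "g \<in> arr A T" "push C g \<delta> = zext C T"
        then have "\<guillemotleft>g : A \<rightarrow> T\<guillemotright>" using arr that Obj by blast
        then obtain k where k: "\<guillemotleft>k : B \<rightarrow> T\<guillemotright>" "g = k \<cdot> x" using rexact_extend[OF RR _ g(2)] by blast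
        have "k \<in> arr B T" using k(1) arr that Obj by blast
        then show "\<exists>k\<in>arr B T. g = k \<cdot> x" using k(2) by blast
      qed
    qed
    then show ?L unfolding L using r(1,4) by (intro conjI ballI) iprover+
  qed
qed

text \<open>This is the epi half of the five lemma, applied to the identity of \<open>B'\<close>. As
  \<delta> vanishes on \<open>y'\<close>, there is \<open>t\<close> with
  \<open>y' = y \<cdot> t\<close>. Then \<open>b \<cdot> t - 1\<close> is killed by
  \<open>y'\<close>, hence equals \<open>x' \<cdot> r = b \<cdot> x \<cdot> r\<close>, and
  subtracting \<open>x \<cdot> r\<close> from \<open>t\<close> gives a right inverse of
  \<open>b\<close>.\<close>

lemma lexact_comparison_split_epi:
  assumes "lexact A B C x y \<delta>" "lexact A B' C x' y' \<delta>" "\<guillemotleft>b : B \<rightarrow> B'\<guillemotright>" "b \<cdot> x = x'" "y' \<cdot> b = y"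
  shows "\<exists>h. \<guillemotleft>h : B' \<rightarrow> B\<guillemotright> \<and> b \<cdot> h = Idn \<C> B'"
proof -
  note X = lexactD[OF assms(1)] and Y = lexactD[OF assms(2)]
  obtain t where t: "\<guillemotleft>t : B' \<rightarrow> B\<guillemotright>" "y' = y \<cdot> t"
    using lexact_lift[OF assms(1) Y(2,5)] by blast
  have "y' \<cdot> (b \<cdot> t \<oplus> \<ominus> (Idn \<C> B')) = zmor B' C"
    using X Y t assms(3-5) cmp_red[OF assms(5), of t] by (simp add: cat)
  moreover have "\<guillemotleft>b \<cdot> t \<oplus> \<ominus> (Idn \<C> B') : B' \<rightarrow> B'\<guillemotright>" using t assms(3) by (simp add: cat)
  ultimately obtain r where r: "\<guillemotleft>r : B' \<rightarrow> A\<guillemotright>" "b \<cdot> t \<oplus> \<ominus> (Idn \<C> B') = x' \<cdot> r"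
    using lexact_kernel[OF assms(2)] by blast
  have "b \<cdot> (t \<oplus> \<ominus> (x \<cdot> r)) = Idn \<C> B'"
    using X Y t r assms(3) cmp_red[OF assms(4), of r] by (simp add: cat pls_ac flip: r(2))
  moreover have "\<guillemotleft>t \<oplus> \<ominus> (x \<cdot> r) : B' \<rightarrow> B\<guillemotright>" using X t r by (simp add: cat)
  ultimately show ?thesis by blast
qed

lemma lexact_split:
  assumes "is_biproduct A C P" "A \<in> Obj \<C>" "C \<in> Obj \<C>"
  shows "lexact A (bsum P) C (in1 P) (pr2 P) (zext C A)"
proof -
  note P = biproductD[OF assms]
  have "\<exists>k. \<guillemotleft>k : T \<rightarrow> A\<guillemotright> \<and> g = in1 P \<cdot> k" if "\<guillemotleft>g : T \<rightarrow> bsum P\<guillemotright>" "pr2 P \<cdot> g = zmor T C" for T g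
    using P that by (intro exI[of _ "pr1 P \<cdot> g"] conjI biproduct_eqI[OF assms that(1)]) (simp_all add: cat)
  moreover have "\<exists>k. \<guillemotleft>k : T \<rightarrow> bsum P\<guillemotright> \<and> g = pr2 P \<cdot> k" if "\<guillemotleft>g : T \<rightarrow> C\<guillemotright>" for T g
    using P that by (intro exI[of _ "in2 P \<cdot> g"] conjI) (simp_all add: cat)
  ultimately show ?thesis unfolding lexact_def using P by (simp add: cat)
qed

lemma lexact_push_iso:
  assumes "lexact A B C x y \<delta>" "\<guillemotleft>a : A \<rightarrow> A'\<guillemotright>" "\<guillemotleft>a' : A' \<rightarrow> A\<guillemotright>" "a' \<cdot> a = Idn \<C> A"
  shows "lexact A' B C (x \<cdot> a') y (push C a \<delta>)"
proof -
  note X = lexactD[OF assms(1)]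
  have "\<exists>k. \<guillemotleft>k : T \<rightarrow> A'\<guillemotright> \<and> g = (x \<cdot> a') \<cdot> k" if g: "\<guillemotleft>g : T \<rightarrow> B\<guillemotright>" "y \<cdot> g = zmor T C" for T g
  proof -
    obtain k where k: "\<guillemotleft>k : T \<rightarrow> A\<guillemotright>" "g = x \<cdot> k" using lexact_kernel[OF assms(1) g] by blast
    then show ?thesis using X assms(2-) cmp_red[OF assms(4), of k]
      by (intro exI[of _ "a \<cdot> k"]) (simp add: cat)
  qed
  moreover have "\<exists>k. \<guillemotleft>k : T \<rightarrow> B\<guillemotright> \<and> g = y \<cdot> k"
    if g: "\<guillemotleft>g : T \<rightarrow> C\<guillemotright>" "pull A' g (push C a \<delta>) = zext T A'" for T g
  proof -
    \<comment> \<open>As \<open>a'\<close> is a left inverse of \<open>a\<close>, pushing along it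
      recovers the pullback of the original \<delta>.\<close>
    have "pull A g \<delta> = push T a' (pull A' g (push C a \<delta>))"
      using X assms(2-) g(1) by (simp add: cat)
    also have "\<dots> = zext T A" using g assms(2-) by (simp add: cat)
    finally show ?thesis using lexact_lift[OF assms(1) g(1)] by blast
  qed
  moreover have "pull A' y (push C a \<delta>) = push B a (pull A y \<delta>)"
    using X(1-3) assms(2-) by (simp add: cat)
  ultimately show ?thesis unfolding lexact_def using X assms(2-) by (simp add: cat)
qed

end

section \<open>The opposite category\<close>

definition op_cat :: "('o, 'm) precat \<Rightarrow> ('o, 'm) precat" where
  "op_cat \<C> = \<lparr>Obj = Obj \<C>, Mor = (\<lambda>A B. Mor \<C> B A), Idn = Idn \<C>, Cmp = (\<lambda>g f. Cmp \<C> f g)\<rparr>"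

definition op_fun :: "('o, 'm, 'e) bifunctor \<Rightarrow> ('o, 'm, 'e) bifunctor" where
  "op_fun \<E> = \<lparr>Ext = (\<lambda>C A. Ext \<E> A C), ExtMap = (\<lambda>c a. ExtMap \<E> a c)\<rparr>"

definition op_biprod :: "('o, 'm) biprod_data \<Rightarrow> ('o, 'm) biprod_data" where
  "op_biprod P = Biprod (bsum P) (pr1 P) (pr2 P) (in1 P) (in2 P)"

definition op_sq :: "('o, 'm) sq \<Rightarrow> ('o, 'm) sq" where
  "op_sq X = Sq (rev (objs X)) (rev (mors X))"

definition op_cor :: "('o, 'm, 'e) correspondence \<Rightarrow> ('o, 'm, 'e) correspondence" where
  "op_cor \<ss> = (\<lambda>C A \<delta>. op_sq ` \<ss> A C \<delta>)"

lemma op_cat_sel [simp]: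
  "Obj (op_cat \<C>) = Obj \<C>" "Mor (op_cat \<C>) A B = Mor \<C> B A"
  "Idn (op_cat \<C>) = Idn \<C>" "Cmp (op_cat \<C>) g f = Cmp \<C> f g"
  by (simp_all add: op_cat_def)

lemma op_fun_sel [simp]: "Ext (op_fun \<E>) C A = Ext \<E> A C" "ExtMap (op_fun \<E>) c a = ExtMap \<E> a c"
  by (simp_all add: op_fun_def)

lemma op_biprod_sel [simp]:
  "bsum (op_biprod P) = bsum P" "in1 (op_biprod P) = pr1 P" "in2 (op_biprod P) = pr2 P"
  "pr1 (op_biprod P) = in1 P" "pr2 (op_biprod P) = in2 P" "op_biprod (op_biprod P) = P"
  by (simp_all add: op_biprod_def)

lemma op_sq_op_sq [simp]: "op_sq (op_sq X) = X"
  by (simp add: op_sq_def)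

lemma inj_op_sq: "inj op_sq"
  by (metis injI op_sq_op_sq)

context preadditive_category
begin

lemma preadditive_op: "preadditive_category (op_cat \<C>)"
proof (intro preadditive_category.intro, unfold op_cat_sel)
  fix A B assume "A \<in> Obj \<C>" "B \<in> Obj \<C>"
  then show "comm_group (Mor \<C> B A)" by (intro Mor_comm_group)
next
  fix A B A' B' f
  assume "A \<in> Obj \<C>" "B \<in> Obj \<C>" "A' \<in> Obj \<C>" "B' \<in> Obj \<C>" "f \<in> arr B A" "f \<in> arr B' A'"
  then show "A = A' \<and> B = B'" using Mor_disjoint[of B A B' A' f] by simp
qed (simp_all add: Idn_in Cmp_in Cmp_Idn_left Cmp_Idn_right Cmp_assoc Cmp_add_left Cmp_add_right)

interpretation op: preadditive_category "op_cat \<C>"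
  by (rule preadditive_op)

text \<open>Each fact translates a notion of the opposite structure back to the given one, so that a
  dual statement results from unfolding an instance in the opposite category.\<close>

named_theorems opp

lemma op_mor [opp]: "op.mor = mor"
  unfolding op.mor_def mor_def by auto

lemma op_src [opp]: "op.src = tgt" and op_tgt [opp]: "op.tgt = src"
  unfolding op.src_def op.tgt_def src_def tgt_def by simp_all

lemma op_pls [opp]: "op.pls = pls"
  by (intro ext) (simp add: op.pls_def pls_def opp)

lemma op_ng [opp]: "op.ng = ng"
  by (intro ext) (simp add: op.ng_def ng_def opp)

lemma op_is_iso [opp]: "op.is_iso A B f \<longleftrightarrow> is_iso B A f"
  unfolding op.is_iso_def is_iso_def by auto

lemma op_is_zero_object [opp]: "op.is_zero_object Z \<longleftrightarrow> is_zero_object Z"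
  unfolding op.is_zero_object_def is_zero_object_def by auto

lemma op_is_biproduct [opp]: "op.is_biproduct A B P \<longleftrightarrow> is_biproduct A B (op_biprod P)"
  unfolding op.is_biproduct_def is_biproduct_def by auto

lemma op_is_seq3 [opp]: "op.is_seq3 A B C x y \<longleftrightarrow> is_seq3 C B A y x"
  unfolding op.is_seq3_def is_seq3_def by auto

text \<open>Reversing arrows turns the comparison isomorphism around; the two descriptions of the
  class are matched by passing to its inverse.\<close>

lemma op_equiv_class3 [opp]:
  assumes "is_seq3 C B A y x"
  shows "op.equiv_class3 A B C x y = op_sq ` equiv_class3 C B A y x"
proof -
  have 1: "(\<exists>b. is_iso B' B b \<and> x \<cdot> b = x' \<and> b \<cdot> y' = y) \<longleftrightarrow> (\<exists>b. is_iso B B' b \<and> b \<cdot> y = y' \<and> x' \<cdot> b = x)"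
    if "is_seq3 C B' A y' x'" for B' x' y'
  proof -
    have a: "\<guillemotleft>x : B \<rightarrow> A\<guillemotright>" "\<guillemotleft>y : C \<rightarrow> B\<guillemotright>" "\<guillemotleft>x' : B' \<rightarrow> A\<guillemotright>" "\<guillemotleft>y' : C \<rightarrow> B'\<guillemotright>" "B \<in> Obj \<C>" "B' \<in> Obj \<C>"
      using assms that by (simp_all add: is_seq3_iff)
    show ?thesis
    proof (intro iffI; elim exE conjE)
      fix b assume b: "is_iso B' B b" "x \<cdot> b = x'" "b \<cdot> y' = y"
      obtain b' where b': "\<guillemotleft>b : B' \<rightarrow> B\<guillemotright>" "\<guillemotleft>b' : B \<rightarrow> B'\<guillemotright>" "b' \<cdot> b = Idn \<C> B'" "b \<cdot> b' = Idn \<C> B"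
        using isoE[OF b(1) a(6,5)] by metis
      have "is_iso B B' b'" using isoI[OF b'(2,1,4,3)] .
      moreover have "b' \<cdot> y = y'"
        unfolding b(3)[symmetric] using a b' cmp_red[OF b'(3), of y'] by (simp add: cat)
      moreover have "x' \<cdot> b' = x" unfolding b(2)[symmetric] using a b' by (simp add: cat)
      ultimately show "\<exists>b. is_iso B B' b \<and> b \<cdot> y = y' \<and> x' \<cdot> b = x" by blast
    next
      fix b assume b: "is_iso B B' b" "b \<cdot> y = y'" "x' \<cdot> b = x"
      obtain b' where b': "\<guillemotleft>b : B \<rightarrow> B'\<guillemotright>" "\<guillemotleft>b' : B' \<rightarrow> B\<guillemotright>" "b' \<cdot> b = Idn \<C> B" "b \<cdot> b' = Idn \<C> B'"
        using isoE[OF b(1) a(5,6)] by metis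
      have "is_iso B' B b'" using isoI[OF b'(2,1,4,3)] .
      moreover have "b' \<cdot> y' = y"
        unfolding b(2)[symmetric] using a b' cmp_red[OF b'(3), of y] by (simp add: cat)
      moreover have "x \<cdot> b' = x'" unfolding b(3)[symmetric] using a b' by (simp add: cat)
      ultimately show "\<exists>b. is_iso B' B b \<and> x \<cdot> b = x' \<and> b \<cdot> y' = y" by blast
    qed
  qed
  have "op.equiv_class3 A B C x y =
      {Sq [A, B', C] [x', y'] | B' x' y'. is_seq3 C B' A y' x' \<and> (\<exists>b. is_iso B' B b \<and> x \<cdot> b = x' \<and> b \<cdot> y' = y)}"
    unfolding op.equiv_class3_def opp by simp
  also have "\<dots> = {Sq [A, B', C] [x', y'] | B' x' y'. is_seq3 C B' A y' x' \<and>
      (\<exists>b. is_iso B B' b \<and> b \<cdot> y = y' \<and> x' \<cdot> b = x)}"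
    using 1 by (metis (no_types, lifting))
  also have "\<dots> = op_sq ` equiv_class3 C B A y x"
    unfolding equiv_class3_def op_sq_def by (force simp: image_iff)
  finally show ?thesis .
qed

end

lemma (in additive_category) additive_op: "additive_category (op_cat \<C>)"
proof -
  interpret op: preadditive_category "op_cat \<C>" by (rule preadditive_op)
  show ?thesis
  proof
    show "\<exists>Z. op.is_zero_object Z" using zero_object_exists by (simp add: opp)
    show "\<exists>P. op.is_biproduct A B P" if AB: "A \<in> Obj (op_cat \<C>)" "B \<in> Obj (op_cat \<C>)" for A B
    proof -
      obtain P where "is_biproduct A B P" using biproduct_exists[of A B] AB by auto
      then show ?thesis by (intro exI[of _ "op_biprod P"]) (simp add: opp)
    qed
  qed
qed

context biadditive_functor
begin

lemma biadditive_op: "biadditive_functor (op_cat \<C>) (op_fun \<E>)"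
proof -
  interpret op: additive_category "op_cat \<C>" by (rule additive_op)
  show ?thesis
    by (intro biadditive_functor.intro biadditive_functor_axioms.intro additive_op)
      (simp_all add: Ext_comm_group ExtMap_hom ExtMap_Idn ExtMap_Cmp ExtMap_add_left ExtMap_add_right)
qed

interpretation op: biadditive_functor "op_cat \<C>" "op_fun \<E>"
  by (rule biadditive_op)

lemma op_push [opp]: "op.push = pull" and op_pull [opp]: "op.pull = push"
  by (intro ext; simp add: op.push_def op.pull_def push_def pull_def)+

lemma op_lexact [opp]: "op.lexact A B C x y \<delta> \<longleftrightarrow> rexact C B A y x \<delta>"
  unfolding op.lexact_def rexact_def opp op_cat_sel op_fun_sel by blast

lemma op_rexact [opp]: "op.rexact A B C x y \<delta> \<longleftrightarrow> lexact C B A y x \<delta>"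
  unfolding op.rexact_def lexact_def opp op_cat_sel op_fun_sel by blast

lemma op_realized_by [opp]: "op.realized_by (op_cor \<ss>) \<delta> A B C x y \<longleftrightarrow> realized_by \<ss> \<delta> C B A y x"
proof -
  have "op_cor \<ss> C A \<delta> = op.equiv_class3 A B C x y \<longleftrightarrow> \<ss> A C \<delta> = equiv_class3 C B A y x"
    if "is_seq3 C B A y x"
    using op_equiv_class3[OF that] inj_image_eq_iff[OF inj_op_sq] by (simp add: op_cor_def)
  then show ?thesis unfolding op.realized_by_def realized_by_def by (auto simp: opp)
qed

end

context preadditive_category
begin

text \<open>The dual of the split sequence with \<open>in1\<close> and \<open>pr2\<close> starts at
  the second summand. To have the form first injection, second projection again, the summands must
  change places.\<close>

lemma is_biproduct_swap:
  assumes "is_biproduct A B P" "A \<in> Obj \<C>" "B \<in> Obj \<C>"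
  shows "is_biproduct B A (Biprod (bsum P) (in2 P) (in1 P) (pr2 P) (pr1 P))"
proof -
  note P = biproductD[OF assms]
  then have "in2 P \<cdot> pr2 P \<oplus> in1 P \<cdot> pr1 P = Idn \<C> (bsum P)"
    by (simp add: pls_commute[of "in2 P \<cdot> pr2 P"] cmp_arr)
  with P show ?thesis
    by (intro is_biproductI) simp_all
qed

end

section \<open>Realizations by exact sequences\<close>

context biadditive_functor
begin

lemma rexact_comparison_split_mono:
  assumes "rexact A B C x y \<delta>" "rexact A B' C x' y' \<delta>" "\<guillemotleft>b : B \<rightarrow> B'\<guillemotright>" "b \<cdot> x = x'" "y' \<cdot> b = y"
  shows "\<exists>h. \<guillemotleft>h : B' \<rightarrow> B\<guillemotright> \<and> h \<cdot> b = Idn \<C> B"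
proof -
  interpret op: biadditive_functor "op_cat \<C>" "op_fun \<E>" by (rule biadditive_op)
  show ?thesis
    using op.lexact_comparison_split_epi[of C B' A y' x' \<delta> B y x b] assms by (auto simp: opp)
qed

text \<open>A five lemma assembled from its halves: \<open>lexact\<close> supplies the right inverse
  of \<open>b\<close>, \<open>rexact\<close> the left inverse.\<close>

lemma exact_comparison_iso:
  assumes "lexact A B C x y \<delta>" "rexact A B C x y \<delta>" "lexact A B' C x' y' \<delta>" "rexact A B' C x' y' \<delta>"
    "\<guillemotleft>b : B \<rightarrow> B'\<guillemotright>" "b \<cdot> x = x'" "y' \<cdot> b = y"
  shows "is_iso B B' b"
  using lexact_comparison_split_epi[OF assms(1,3,5,6,7)] rexact_comparison_split_mono[OF assms(2,4,5,6,7)]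
    isoI_split[OF assms(5)] by blast

lemma rexact_split:
  assumes "is_biproduct A C P" "A \<in> Obj \<C>" "C \<in> Obj \<C>"
  shows "rexact A (bsum P) C (in1 P) (pr2 P) (zext C A)"
proof -
  interpret op: biadditive_functor "op_cat \<C>" "op_fun \<E>" by (rule biadditive_op)
  show ?thesis
    using op.lexact_split[of C A "op_biprod (Biprod (bsum P) (in2 P) (in1 P) (pr2 P) (pr1 P))"]
      is_biproduct_swap[OF assms] assms by (simp add: opp)
qed

text \<open>Not the dual of \<open>lexact_push_iso\<close>: dualizing replaces \<open>push\<close>
  by \<open>pull\<close> and would change the last term instead of the first. Hence a direct
  argument.\<close>

lemma rexact_push_iso:
  assumes "rexact A B C x y \<delta>" "\<guillemotleft>a : A \<rightarrow> A'\<guillemotright>" "\<guillemotleft>a' : A' \<rightarrow> A\<guillemotright>" "a' \<cdot> a = Idn \<C> A" "a \<cdot> a' = Idn \<C> A'"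
  shows "rexact A' B C (x \<cdot> a') y (push C a \<delta>)"
proof -
  note X = rexactD[OF assms(1)]
  have "\<exists>k. \<guillemotleft>k : C \<rightarrow> T\<guillemotright> \<and> g = k \<cdot> y" if g: "\<guillemotleft>g : B \<rightarrow> T\<guillemotright>" "g \<cdot> (x \<cdot> a') = zmor A' T" for T g
  proof -
    have "g \<cdot> x = (g \<cdot> (x \<cdot> a')) \<cdot> a" using g(1) X assms(2-) by (simp add: cat)
    also have "\<dots> = zmor A T" using g assms(2-) by (simp add: cat)
    finally show ?thesis using rexact_cokernel[OF assms(1) g(1)] by blast
  qed
  moreover have "\<exists>k. \<guillemotleft>k : B \<rightarrow> T\<guillemotright> \<and> g = k \<cdot> (x \<cdot> a')"
    if g: "\<guillemotleft>g : A' \<rightarrow> T\<guillemotright>" "push C g (push C a \<delta>) = zext C T" for T g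
  proof -
    have "push C (g \<cdot> a) \<delta> = zext C T" using X assms(2-) g by (simp add: cat)
    moreover have "\<guillemotleft>g \<cdot> a : A \<rightarrow> T\<guillemotright>" using assms g by (simp add: cat)
    ultimately obtain k where k: "\<guillemotleft>k : B \<rightarrow> T\<guillemotright>" "g \<cdot> a = k \<cdot> x"
      using rexact_extend[OF assms(1)] by blast
    have "g = (g \<cdot> a) \<cdot> a'" using g assms(2-) by (simp add: cat)
    then have "g = k \<cdot> (x \<cdot> a')" unfolding k(2) using X k assms(2-) by (simp add: cat)
    then show ?thesis using k by blast
  qed
  moreover have "push C (x \<cdot> a') (push C a \<delta>) = push C x \<delta>" using X(1-3) assms(2-) by (simp add: cat)
  moreover have "y \<cdot> (x \<cdot> a') = zmor A' C" using X assms(2-) cmp_red[OF X(4), of a'] by (simp add: cat)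
  ultimately show ?thesis unfolding rexact_def using X assms(2-) by (simp add: cat)
qed

end

text \<open>Common ground of both notions, in terms of sequences instead of classes. The list is
  self-dual, and what is derived from it serves both directions of the equivalence.\<close>

locale exact_realization3 = biadditive_functor \<C> \<E>
  for \<C> :: "('o, 'm) precat" and \<E> :: "('o, 'm, 'e) bifunctor" +
  fixes \<ss> :: "('o, 'm, 'e) correspondence"
  assumes real_ex:
      "\<And>C A \<delta>. \<lbrakk>C \<in> Obj \<C>; A \<in> Obj \<C>; \<delta> \<in> ext C A\<rbrakk> \<Longrightarrow> \<exists>B x y. realized_by \<ss> \<delta> A B C x y"
    and real_lift:
      "\<And>A B C x y \<delta> A' B' C' x' y' \<delta>' a c.
         \<lbrakk>realized_by \<ss> \<delta> A B C x y; realized_by \<ss> \<delta>' A' B' C' x' y';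
          \<guillemotleft>a : A \<rightarrow> A'\<guillemotright>; \<guillemotleft>c : C \<rightarrow> C'\<guillemotright>; push C a \<delta> = pull A' c \<delta>'\<rbrakk>
         \<Longrightarrow> \<exists>b. \<guillemotleft>b : B \<rightarrow> B'\<guillemotright> \<and> b \<cdot> x = x' \<cdot> a \<and> y' \<cdot> b = c \<cdot> y"
    and real_lexact: "\<And>A B C x y \<delta>. realized_by \<ss> \<delta> A B C x y \<Longrightarrow> lexact A B C x y \<delta>"
    and real_rexact: "\<And>A B C x y \<delta>. realized_by \<ss> \<delta> A B C x y \<Longrightarrow> rexact A B C x y \<delta>"
begin

lemma exact_realization3_op: "exact_realization3 (op_cat \<C>) (op_fun \<E>) (op_cor \<ss>)"
proof -
  interpret op: biadditive_functor "op_cat \<C>" "op_fun \<E>" by (rule biadditive_op)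
  show ?thesis
  proof (intro exact_realization3.intro exact_realization3_axioms.intro biadditive_op, unfold opp op_cat_sel op_fun_sel)
    show "\<exists>B x y. realized_by \<ss> \<delta> C B A y x" if "C \<in> Obj \<C>" "A \<in> Obj \<C>" "\<delta> \<in> ext A C" for C A \<delta>
      using real_ex[OF that(2,1,3)] by blast
    show "\<exists>b. (mor b \<and> tgt b = B \<and> src b = B' \<and> B \<in> Obj \<C> \<and> B' \<in> Obj \<C>) \<and> x \<cdot> b = a \<cdot> x' \<and> b \<cdot> y' = y \<cdot> c"
      if "realized_by \<ss> \<delta> C B A y x" "realized_by \<ss> \<delta>' C' B' A' y' x'"
        "mor a \<and> tgt a = A \<and> src a = A' \<and> A \<in> Obj \<C> \<and> A' \<in> Obj \<C>"
        "mor c \<and> tgt c = C \<and> src c = C' \<and> C \<in> Obj \<C> \<and> C' \<in> Obj \<C>"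
        "pull C a \<delta> = push A' c \<delta>'" for A B C x y \<delta> A' B' C' x' y' \<delta>' a c
      using real_lift[OF that(2,1), of c a] that(3-) by metis
  qed (auto intro: real_lexact real_rexact)
qed

lemma realD:
  assumes "realized_by \<ss> \<delta> A B C x y"
  shows "\<guillemotleft>x : A \<rightarrow> B\<guillemotright>" "\<guillemotleft>y : B \<rightarrow> C\<guillemotright>" "\<delta> \<in> ext C A" "y \<cdot> x = zmor A C" "pull A y \<delta> = zext B A"
    "push C x \<delta> = zext C B" "\<And>w. \<lbrakk>mor w; tgt w = A\<rbrakk> \<Longrightarrow> y \<cdot> (x \<cdot> w) = zmor (src w) C"
  using lexactD[OF real_lexact[OF assms]] rexactD[OF real_rexact[OF assms]] by simp_all

text \<open>The recognition principle for realizations: an exact sequence only has to map to some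
  realization of the same extension, with identities at the ends. The map is then an isomorphism,
  and its inverse moves the realization back.\<close>

lemma realized_by_if_map_to:
  assumes "lexact A B C x y \<delta>" "rexact A B C x y \<delta>" "realized_by \<ss> \<delta> A W C w w'"
    "\<guillemotleft>b : B \<rightarrow> W\<guillemotright>" "b \<cdot> x = w" "w' \<cdot> b = y"
  shows "realized_by \<ss> \<delta> A B C x y"
proof -
  note X = lexactD[OF assms(1)] and W = realD[OF assms(3)]
  have "is_iso B W b"
    using exact_comparison_iso[OF assms(1,2) real_lexact[OF assms(3)] real_rexact[OF assms(3)] assms(4,5,6)] .
  then obtain b' where b': "\<guillemotleft>b' : W \<rightarrow> B\<guillemotright>" "b' \<cdot> b = Idn \<C> B" "b \<cdot> b' = Idn \<C> W"
    using isoE assms(4) by blast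
  have "b' \<cdot> w = x" unfolding assms(5)[symmetric] using b' X cmp_red[OF b'(2), of x] assms(4) by (simp add: cat)
  moreover have "y \<cdot> b' = w'" unfolding assms(6)[symmetric] using b' W assms(4) by (simp add: cat)
  moreover have "is_iso W B b'" using isoI[OF b'(1) assms(4) b'(3,2)] .
  ultimately show ?thesis using realized_by_iso[OF assms(3)] X(2) by blast
qed

lemma realized_by_split:
  assumes "is_biproduct A C P" "A \<in> Obj \<C>" "C \<in> Obj \<C>"
  shows "realized_by \<ss> (zext C A) A (bsum P) C (in1 P) (pr2 P)"
proof -
  note P = biproductD[OF assms]
  obtain W w w' where W: "realized_by \<ss> (zext C A) A W C w w'"
    using real_ex assms(2,3) Ext_monoid(1) by metis
  note w = realD[OF W]
  \<comment> \<open>The zero extension vanishes on the identity of \<open>C\<close>, which therefore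
    lifts to a section \<open>t\<close> of \<open>w'\<close>; the row with entries \<open>w\<close>
    and \<open>t\<close> maps the split sequence to the realization.\<close>
  have "\<guillemotleft>Idn \<C> C : C \<rightarrow> C\<guillemotright>" "pull A (Idn \<C> C) (zext C A) = zext C A"
    using assms by (simp_all add: cat)
  then obtain t where t: "\<guillemotleft>t : C \<rightarrow> W\<guillemotright>" "Idn \<C> C = w' \<cdot> t"
    using lexact_lift[OF real_lexact[OF W]] by metis
  have 1: "\<guillemotleft>w \<cdot> pr1 P \<oplus> t \<cdot> pr2 P : bsum P \<rightarrow> W\<guillemotright>" "(w \<cdot> pr1 P \<oplus> t \<cdot> pr2 P) \<cdot> in1 P = w"
    "w' \<cdot> (w \<cdot> pr1 P \<oplus> t \<cdot> pr2 P) = pr2 P"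
    using P(1-8) w t(1) cmp_red[OF t(2)[symmetric]] by (simp_all add: cat)
  show ?thesis
    by (rule realized_by_if_map_to[OF lexact_split[OF assms] rexact_split[OF assms] W 1])
qed

text \<open>Members of \<open>equiv_class3\<close> share both end terms, so a change of the first
  term is not a change of representative. It is a statement about another extension and goes through
  the recognition principle.\<close>

lemma realized_by_push_iso:
  assumes "realized_by \<ss> \<delta> A B C x y" "\<guillemotleft>a : A \<rightarrow> A'\<guillemotright>" "\<guillemotleft>a' : A' \<rightarrow> A\<guillemotright>" "a' \<cdot> a = Idn \<C> A" "a \<cdot> a' = Idn \<C> A'"
  shows "realized_by \<ss> (push C a \<delta>) A' B C (x \<cdot> a') y"
proof -
  note X = realD[OF assms(1)]
  have in': "push C a \<delta> \<in> ext C A'" using X(1-3) assms(2) by (simp add: cat)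
  obtain W w w' where W: "realized_by \<ss> (push C a \<delta>) A' W C w w'"
    using real_ex[OF _ _ in'] X assms(2) by blast
  note w = realD[OF W]
  have "push C a \<delta> = pull A' (Idn \<C> C) (push C a \<delta>)" "\<guillemotleft>Idn \<C> C : C \<rightarrow> C\<guillemotright>"
    using in' X assms(2) by (simp_all add: cat)
  then obtain b where b: "\<guillemotleft>b : B \<rightarrow> W\<guillemotright>" "b \<cdot> x = w \<cdot> a" "w' \<cdot> b = Idn \<C> C \<cdot> y"
    using real_lift[OF assms(1) W assms(2)] by blast
  have "b \<cdot> (x \<cdot> a') = w" "w' \<cdot> b = y"
    using b X w(1-3) assms(2-) cmp_red[OF b(2), of a'] by (simp_all add: cat)
  then show ?thesis
    using realized_by_if_map_to[OF _ _ W b(1)] lexact_push_iso[OF real_lexact[OF assms(1)] assms(2-4)]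
      rexact_push_iso[OF real_rexact[OF assms(1)] assms(2-)] by blast
qed

end

section \<open>Direct sums of extensions\<close>

context biadditive_functor
begin

text \<open>Pulling back along the decomposition of the identity expresses an extension through its
  restrictions to the two summands.\<close>

lemma pull_biproduct_eqI:
  assumes "is_biproduct C D P" "C \<in> Obj \<C>" "D \<in> Obj \<C>" "A \<in> Obj \<C>"
    and "\<delta> \<in> ext (bsum P) A" "\<rho> \<in> ext (bsum P) A"
    and "pull A (in1 P) \<delta> = pull A (in1 P) \<rho>" "pull A (in2 P) \<delta> = pull A (in2 P) \<rho>"
  shows "\<delta> = \<rho>"
proof -
  note P = biproductD[OF assms(1-3)]
  have "\<theta> = pull A (pr1 P) (pull A (in1 P) \<theta>) \<otimes>\<^bsub>Ext \<E> (bsum P) A\<^esub> pull A (pr2 P) (pull A (in2 P) \<theta>)"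
    if "\<theta> \<in> ext (bsum P) A" for \<theta>
  proof -
    have "pull A (in1 P \<cdot> pr1 P \<oplus> in2 P \<cdot> pr2 P) \<theta> =
        pull A (pr1 P) (pull A (in1 P) \<theta>) \<otimes>\<^bsub>Ext \<E> (bsum P) A\<^esub> pull A (pr2 P) (pull A (in2 P) \<theta>)"
      using that P(1-4) assms(4) by (simp add: cat)
    then show ?thesis using that P assms(4) by (simp add: cat)
  qed
  then show ?thesis using assms(5-8) by metis
qed

lemma push_biproduct_eqI:
  assumes "is_biproduct A B P" "A \<in> Obj \<C>" "B \<in> Obj \<C>" "C \<in> Obj \<C>"
    and "\<delta> \<in> ext C (bsum P)" "\<rho> \<in> ext C (bsum P)"
    and "push C (pr1 P) \<delta> = push C (pr1 P) \<rho>" "push C (pr2 P) \<delta> = push C (pr2 P) \<rho>"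
  shows "\<delta> = \<rho>"
proof -
  interpret op: biadditive_functor "op_cat \<C>" "op_fun \<E>" by (rule biadditive_op)
  show ?thesis
    using op.pull_biproduct_eqI[of A B "op_biprod P" C \<delta> \<rho>] assms by (simp add: opp)
qed

text \<open>An explicit formula for the direct sum of two extensions. It makes sense for arbitrary
  biproducts, while \<open>dsum_ext\<close> is tied to the chosen ones and given by a
  description.\<close>

abbreviation dsum_extension ::
    "('o, 'm) biprod_data \<Rightarrow> ('o, 'm) biprod_data \<Rightarrow> 'o \<Rightarrow> 'e \<Rightarrow> 'o \<Rightarrow> 'e \<Rightarrow> 'e" where
  "dsum_extension PC PA C \<delta> C' \<delta>' \<equiv>
     pull (bsum PA) (pr1 PC) (push C (in1 PA) \<delta>) \<otimes>\<^bsub>Ext \<E> (bsum PC) (bsum PA)\<^esub>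
     pull (bsum PA) (pr2 PC) (push C' (in2 PA) \<delta>')"

lemma lexact_dsum:
  assumes X: "lexact A B C x y \<delta>" and Y: "lexact A' B' C' x' y' \<delta>'"
    and P: "is_biproduct A A' PA" "is_biproduct B B' PB" "is_biproduct C C' PC"
  shows "lexact (bsum PA) (bsum PB) (bsum PC)
    (in1 PB \<cdot> (x \<cdot> pr1 PA) \<oplus> in2 PB \<cdot> (x' \<cdot> pr2 PA))
    (in1 PC \<cdot> (y \<cdot> pr1 PB) \<oplus> in2 PC \<cdot> (y' \<cdot> pr2 PB))
    (dsum_extension PC PA C \<delta> C' \<delta>')" (is "lexact _ _ _ ?x ?y ?\<theta>")
proof -
  note x = lexactD[OF X] and y = lexactD[OF Y]
  have Obj: "A \<in> Obj \<C>" "A' \<in> Obj \<C>" "B \<in> Obj \<C>" "B' \<in> Obj \<C>" "C \<in> Obj \<C>" "C' \<in> Obj \<C>"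
    using x y by simp_all
  note PA = biproductD[OF P(1) Obj(1,2)] and PB = biproductD[OF P(2) Obj(3,4)]
    and PC = biproductD[OF P(3) Obj(5,6)]
  note PA' = PA(1-8,10-) and PB' = PB(1-8,10-) and PC' = PC(1-8,10-)
  have arr: "\<guillemotleft>?x : bsum PA \<rightarrow> bsum PB\<guillemotright>" "\<guillemotleft>?y : bsum PB \<rightarrow> bsum PC\<guillemotright>"
    using x(1,2) y(1,2) PA(1-4) PB(1-4) PC(1-4) by (simp_all add: cat)
  have \<theta>: "?\<theta> \<in> ext (bsum PC) (bsum PA)"
    using x(1-3) y(1-3) PA(1-4) PC(1-4) by (simp add: cat)
  have comp: "?y \<cdot> ?x = zmor (bsum PA) (bsum PC)"
    using x(1,2,4,6) y(1,2,4,6) PA' PB' PC' by (simp add: cat)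
  \<comment> \<open>The normal form composes pullbacks and so hides
    \<open>pull A y \<delta>\<close>; the action is regrouped to bring this vanishing factor to the
    front.\<close>
  have "pull (bsum PA) (y \<cdot> pr1 PB) (push C (in1 PA) \<delta>) = push (bsum PB) (in1 PA) (pull A (pr1 PB) (pull A y \<delta>))"
    using x(1-3) PA(1) PB(3) by (simp add: cat)
  also have "\<dots> = zext (bsum PB) (bsum PA)" unfolding x(5) using PA(1) PB(3) by (simp add: cat)
  finally have 1: "pull (bsum PA) (y \<cdot> pr1 PB) (push C (in1 PA) \<delta>) = zext (bsum PB) (bsum PA)" .
  have "pull (bsum PA) (y' \<cdot> pr2 PB) (push C' (in2 PA) \<delta>') = push (bsum PB) (in2 PA) (pull A' (pr2 PB) (pull A' y' \<delta>'))"
    using y(1-3) PA(2) PB(4) by (simp add: cat)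
  also have "\<dots> = zext (bsum PB) (bsum PA)" unfolding y(5) using PA(2) PB(4) by (simp add: cat)
  finally have 2: "pull (bsum PA) (y' \<cdot> pr2 PB) (push C' (in2 PA) \<delta>') = zext (bsum PB) (bsum PA)" .
  have pr: "pr1 PC \<cdot> ?y = y \<cdot> pr1 PB" "pr2 PC \<cdot> ?y = y' \<cdot> pr2 PB"
    using x(2) y(2) PB(1-4) PC' by (simp_all add: cat)
  have z: "pull (bsum PA) ?y ?\<theta> = pull (bsum PA) (pr1 PC \<cdot> ?y) (push C (in1 PA) \<delta>) \<otimes>\<^bsub>Ext \<E> (bsum PB) (bsum PA)\<^esub>
      pull (bsum PA) (pr2 PC \<cdot> ?y) (push C' (in2 PA) \<delta>')"
    using x(1-3) y(1-3) PA(1-4) PC(1-4) arr by (simp add: pull_mult pull_pull pull_in push_in)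
  have z0: "pull (bsum PA) ?y ?\<theta> = zext (bsum PB) (bsum PA)"
    unfolding z pr 1 2 using PA(1) PB(1) by (simp add: cat)
  have k: "\<exists>k. \<guillemotleft>k : T \<rightarrow> bsum PA\<guillemotright> \<and> g = ?x \<cdot> k" if g: "\<guillemotleft>g : T \<rightarrow> bsum PB\<guillemotright>" "?y \<cdot> g = zmor T (bsum PC)" for T g
  proof -
    have "y \<cdot> (pr1 PB \<cdot> g) = pr1 PC \<cdot> (?y \<cdot> g)" "y' \<cdot> (pr2 PB \<cdot> g) = pr2 PC \<cdot> (?y \<cdot> g)"
      using x(2) y(2) PB(1-4) PC' g(1) by (simp_all add: cat)
    then have "y \<cdot> (pr1 PB \<cdot> g) = zmor T C" "y' \<cdot> (pr2 PB \<cdot> g) = zmor T C'"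
      unfolding g(2) using PC g(1) by (simp_all add: cat)
    moreover have "\<guillemotleft>pr1 PB \<cdot> g : T \<rightarrow> B\<guillemotright>" "\<guillemotleft>pr2 PB \<cdot> g : T \<rightarrow> B'\<guillemotright>" using PB g by (simp_all add: cat)
    ultimately obtain k k' where k: "\<guillemotleft>k : T \<rightarrow> A\<guillemotright>" "pr1 PB \<cdot> g = x \<cdot> k" "\<guillemotleft>k' : T \<rightarrow> A'\<guillemotright>" "pr2 PB \<cdot> g = x' \<cdot> k'"
      using lexact_kernel[OF X] lexact_kernel[OF Y] by metis
    have "g = ?x \<cdot> (in1 PA \<cdot> k \<oplus> in2 PA \<cdot> k')"
      by (rule biproduct_eqI[OF P(2) Obj(3,4) g(1)])
        (use x(1) y(1) k PA' PB' in \<open>simp_all add: cat\<close>)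
    moreover have "\<guillemotleft>in1 PA \<cdot> k \<oplus> in2 PA \<cdot> k' : T \<rightarrow> bsum PA\<guillemotright>" using PA k by (simp add: cat)
    ultimately show ?thesis by blast
  qed
  have l: "\<exists>k. \<guillemotleft>k : T \<rightarrow> bsum PB\<guillemotright> \<and> g = ?y \<cdot> k"
    if g: "\<guillemotleft>g : T \<rightarrow> bsum PC\<guillemotright>" "pull (bsum PA) g ?\<theta> = zext T (bsum PA)" for T g
  proof -
    \<comment> \<open>Pushing along a projection of \<open>bsum PA\<close> leaves one summand of the
      direct sum, so the lifting problem falls apart into one for \<delta> and one for
      \<delta>'.\<close>
    have "pull A (pr1 PC \<cdot> g) \<delta> = push T (pr1 PA) (pull (bsum PA) g ?\<theta>)"
      "pull A' (pr2 PC \<cdot> g) \<delta>' = push T (pr2 PA) (pull (bsum PA) g ?\<theta>)"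
      using x(1-3) y(1-3) PA' PC(1-4) g(1) by (simp_all add: cat)
    then have "pull A (pr1 PC \<cdot> g) \<delta> = zext T A" "pull A' (pr2 PC \<cdot> g) \<delta>' = zext T A'"
      unfolding g(2) using PA g(1) by (simp_all add: cat)
    moreover have "\<guillemotleft>pr1 PC \<cdot> g : T \<rightarrow> C\<guillemotright>" "\<guillemotleft>pr2 PC \<cdot> g : T \<rightarrow> C'\<guillemotright>" using PC g by (simp_all add: cat)
    ultimately obtain k k' where k: "\<guillemotleft>k : T \<rightarrow> B\<guillemotright>" "pr1 PC \<cdot> g = y \<cdot> k" "\<guillemotleft>k' : T \<rightarrow> B'\<guillemotright>" "pr2 PC \<cdot> g = y' \<cdot> k'"
      using lexact_lift[OF X] lexact_lift[OF Y] by metis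
    have "g = ?y \<cdot> (in1 PB \<cdot> k \<oplus> in2 PB \<cdot> k')"
      by (rule biproduct_eqI[OF P(3) Obj(5,6) g(1)])
        (use x(2) y(2) k PC' PB' in \<open>simp_all add: cat\<close>)
    moreover have "\<guillemotleft>in1 PB \<cdot> k \<oplus> in2 PB \<cdot> k' : T \<rightarrow> bsum PB\<guillemotright>" using PB k by (simp add: cat)
    ultimately show ?thesis by blast
  qed
  show ?thesis
    unfolding lexact_def using arr \<theta> comp z0 k l by (intro conjI allI impI) iprover+
qed

lemma rexact_dsum:
  assumes X: "rexact A B C x y \<delta>" and Y: "rexact A' B' C' x' y' \<delta>'"
    and P: "is_biproduct A A' PA" "is_biproduct B B' PB" "is_biproduct C C' PC"
  shows "rexact (bsum PA) (bsum PB) (bsum PC)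
    (in1 PB \<cdot> (x \<cdot> pr1 PA) \<oplus> in2 PB \<cdot> (x' \<cdot> pr2 PA))
    (in1 PC \<cdot> (y \<cdot> pr1 PB) \<oplus> in2 PC \<cdot> (y' \<cdot> pr2 PB))
    (dsum_extension PC PA C \<delta> C' \<delta>')"
proof -
  interpret op: biadditive_functor "op_cat \<C>" "op_fun \<E>" by (rule biadditive_op)
  note x = rexactD[OF X] and y = rexactD[OF Y]
  have Obj: "A \<in> Obj \<C>" "A' \<in> Obj \<C>" "B \<in> Obj \<C>" "B' \<in> Obj \<C>" "C \<in> Obj \<C>" "C' \<in> Obj \<C>"
    using x y by simp_all
  note PA = biproductD[OF P(1) Obj(1,2)] and PB = biproductD[OF P(2) Obj(3,4)]
    and PC = biproductD[OF P(3) Obj(5,6)]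
  \<comment> \<open>The formula obtained by duality pulls back before pushing; bifunctoriality
    identifies it with the given one.\<close>
  have "dsum_extension PC PA C \<delta> C' \<delta>' =
     push (bsum PC) (in1 PA) (pull A (pr1 PC) \<delta>) \<otimes>\<^bsub>Ext \<E> (bsum PC) (bsum PA)\<^esub>
     push (bsum PC) (in2 PA) (pull A' (pr2 PC) \<delta>')"
    using x(1-3) y(1-3) PA(1-4) PC(1-4) by (simp add: cat)
  moreover have "rexact (bsum PA) (bsum PB) (bsum PC)
    ((in1 PB \<cdot> x) \<cdot> pr1 PA \<oplus> (in2 PB \<cdot> x') \<cdot> pr2 PA)
    ((in1 PC \<cdot> y) \<cdot> pr1 PB \<oplus> (in2 PC \<cdot> y') \<cdot> pr2 PB)
    (push (bsum PC) (in1 PA) (pull A (pr1 PC) \<delta>) \<otimes>\<^bsub>Ext \<E> (bsum PC) (bsum PA)\<^esub>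
     push (bsum PC) (in2 PA) (pull A' (pr2 PC) \<delta>'))"
    using op.lexact_dsum[of C B A y x \<delta> C' B' A' y' x' \<delta>' "op_biprod PC" "op_biprod PB" "op_biprod PA"] assms
    by (simp add: opp)
  ultimately show ?thesis using x(1,2) y(1,2) PA(1-4) PB(1-4) PC(1-4) by (simp add: cat)
qed

text \<open>The explicit formula has the four prescribed components. They determine an extension:
  \<open>push_biproduct_eqI\<close> separates the summands of the second argument,
  \<open>pull_biproduct_eqI\<close> those of the first.\<close>

lemma dsum_ext_eq:
  assumes "A \<in> Obj \<C>" "C \<in> Obj \<C>" "A' \<in> Obj \<C>" "C' \<in> Obj \<C>" "\<delta> \<in> ext C A" "\<delta>' \<in> ext C' A'"
  shows "dsum_ext C A \<delta> C' A' \<delta>' = dsum_extension (biprod C C') (biprod A A') C \<delta> C' \<delta>'"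
    (is "_ = ?\<theta>")
proof -
  define PA PC where "PA = biprod A A'" and "PC = biprod C C'"
  have bip: "is_biproduct A A' PA" "is_biproduct C C' PC"
    unfolding PA_def PC_def biprod_def using biproduct_exists assms(1-4) by (auto intro: someI_ex)
  note PA = biproductD[OF bip(1) assms(1,3)] and PC = biproductD[OF bip(2) assms(2,4)]
  note PA' = PA(1-8,10-) and PC' = PC(1-8,10-)
  \<comment> \<open>The rewrite rules know only \<open>push\<close> and \<open>pull\<close>, so the
    simultaneous action in both arguments is split into these.\<close>
  have EM: "ExtMap \<E> c a \<rho> = push (src c) a (pull (src a) c \<rho>)"
    if "mor c" "mor a" "\<rho> \<in> ext (tgt c) (src a)" for c a \<rho>
    using that pull_push[OF that refl refl] by (simp add: push_pull)
  have \<theta>: "dsum_extension PC PA C \<delta> C' \<delta>' \<in> ext (bsum PC) (bsum PA)"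
    using assms PA(1-4) PC(1-4) by (simp add: cat)
  show ?thesis
    unfolding dsum_ext_def PA_def[symmetric] PC_def[symmetric]
  proof (rule the_equality)
    show "dsum_extension PC PA C \<delta> C' \<delta>' \<in> ext (bsum PC) (bsum PA) \<and>
      ExtMap \<E> (in1 PC) (pr1 PA) (dsum_extension PC PA C \<delta> C' \<delta>') = \<delta> \<and>
      ExtMap \<E> (in1 PC) (pr2 PA) (dsum_extension PC PA C \<delta> C' \<delta>') = zext C A' \<and>
      ExtMap \<E> (in2 PC) (pr1 PA) (dsum_extension PC PA C \<delta> C' \<delta>') = zext C' A \<and>
      ExtMap \<E> (in2 PC) (pr2 PA) (dsum_extension PC PA C \<delta> C' \<delta>') = \<delta>'"
      using \<theta> assms PA' PC' by (simp add: EM) (simp add: cat)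
  next
    fix \<rho>
    assume \<rho>: "\<rho> \<in> ext (bsum PC) (bsum PA) \<and> ExtMap \<E> (in1 PC) (pr1 PA) \<rho> = \<delta> \<and>
      ExtMap \<E> (in1 PC) (pr2 PA) \<rho> = zext C A' \<and> ExtMap \<E> (in2 PC) (pr1 PA) \<rho> = zext C' A \<and>
      ExtMap \<E> (in2 PC) (pr2 PA) \<rho> = \<delta>'"
    let ?\<theta> = "dsum_extension PC PA C \<delta> C' \<delta>'"
    have "ExtMap \<E> (in1 PC) (pr1 PA) \<rho> = ExtMap \<E> (in1 PC) (pr1 PA) ?\<theta>"
      "ExtMap \<E> (in1 PC) (pr2 PA) \<rho> = ExtMap \<E> (in1 PC) (pr2 PA) ?\<theta>"
      "ExtMap \<E> (in2 PC) (pr1 PA) \<rho> = ExtMap \<E> (in2 PC) (pr1 PA) ?\<theta>"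
      "ExtMap \<E> (in2 PC) (pr2 PA) \<rho> = ExtMap \<E> (in2 PC) (pr2 PA) ?\<theta>"
      using \<rho> \<theta> assms PA' PC' by (simp_all add: EM) (simp_all add: cat)
    then have e: "push C (pr1 PA) (pull (bsum PA) (in1 PC) \<rho>) = push C (pr1 PA) (pull (bsum PA) (in1 PC) ?\<theta>)"
      "push C (pr2 PA) (pull (bsum PA) (in1 PC) \<rho>) = push C (pr2 PA) (pull (bsum PA) (in1 PC) ?\<theta>)"
      "push C' (pr1 PA) (pull (bsum PA) (in2 PC) \<rho>) = push C' (pr1 PA) (pull (bsum PA) (in2 PC) ?\<theta>)"
      "push C' (pr2 PA) (pull (bsum PA) (in2 PC) \<rho>) = push C' (pr2 PA) (pull (bsum PA) (in2 PC) ?\<theta>)"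
      using EM[of "in1 PC" "pr1 PA"] EM[of "in1 PC" "pr2 PA"] EM[of "in2 PC" "pr1 PA"] EM[of "in2 PC" "pr2 PA"]
        \<rho> \<theta> PA(3,4) PC(1,2) by metis+
    have "pull (bsum PA) (in1 PC) \<rho> = pull (bsum PA) (in1 PC) ?\<theta>"
      by (rule push_biproduct_eqI[OF bip(1) assms(1,3,2) _ _ e(1,2)])
        (use \<rho> \<theta> PA(1-4) PC(1-4) in \<open>simp_all add: pull_in\<close>)
    moreover have "pull (bsum PA) (in2 PC) \<rho> = pull (bsum PA) (in2 PC) ?\<theta>"
      by (rule push_biproduct_eqI[OF bip(1) assms(1,3,4) _ _ e(3,4)])
        (use \<rho> \<theta> PA(1-4) PC(1-4) in \<open>simp_all add: pull_in\<close>)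
    ultimately show "\<rho> = ?\<theta>"
      using pull_biproduct_eqI[OF bip(2) assms(2,4) _ _ \<theta>] \<rho> PA(1) by blast
  qed
qed

end

context exact_realization3
begin

text \<open>The injections are morphisms of extensions from \<delta> and \<delta>' to their direct
  sum. Their lifts \<open>t\<close> and \<open>t'\<close> to a realization, joined to a row, give
  the map required by the recognition principle.\<close>

lemma realized_by_dsum:
  assumes X: "realized_by \<ss> \<delta> A B C x y" and Y: "realized_by \<ss> \<delta>' A' B' C' x' y'"
    and P: "is_biproduct A A' PA" "is_biproduct B B' PB" "is_biproduct C C' PC"
  shows "realized_by \<ss> (dsum_extension PC PA C \<delta> C' \<delta>') (bsum PA) (bsum PB) (bsum PC)
    (in1 PB \<cdot> (x \<cdot> pr1 PA) \<oplus> in2 PB \<cdot> (x' \<cdot> pr2 PA))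
    (in1 PC \<cdot> (y \<cdot> pr1 PB) \<oplus> in2 PC \<cdot> (y' \<cdot> pr2 PB))" (is "realized_by _ ?\<theta> _ _ _ ?x ?y")
proof -
  note x = realD[OF X] and y = realD[OF Y]
  have Obj: "A \<in> Obj \<C>" "A' \<in> Obj \<C>" "B \<in> Obj \<C>" "B' \<in> Obj \<C>" "C \<in> Obj \<C>" "C' \<in> Obj \<C>"
    using x y by simp_all
  note PA = biproductD[OF P(1) Obj(1,2)] and PB = biproductD[OF P(2) Obj(3,4)]
    and PC = biproductD[OF P(3) Obj(5,6)]
  have \<theta>: "?\<theta> \<in> ext (bsum PC) (bsum PA)" using x(1-3) y(1-3) PA(1-4) PC(1-4) by (simp add: cat)
  obtain W w w' where W: "realized_by \<ss> ?\<theta> (bsum PA) W (bsum PC) w w'"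
    using real_ex[OF _ _ \<theta>] PA(1) PC(1) by blast
  note w = realD[OF W]
  have "push C (in1 PA) \<delta> = pull (bsum PA) (in1 PC) ?\<theta>" "push C' (in2 PA) \<delta>' = pull (bsum PA) (in2 PC) ?\<theta>"
    using x(1-3) y(1-3) PA(1-4) PC(1-8) by (simp_all add: cat)
  then obtain t t' where t: "\<guillemotleft>t : B \<rightarrow> W\<guillemotright>" "t \<cdot> x = w \<cdot> in1 PA" "w' \<cdot> t = in1 PC \<cdot> y"
    and t': "\<guillemotleft>t' : B' \<rightarrow> W\<guillemotright>" "t' \<cdot> x' = w \<cdot> in2 PA" "w' \<cdot> t' = in2 PC \<cdot> y'"
    using real_lift[OF X W PA(1) PC(1)] real_lift[OF Y W PA(2) PC(2)] by blast
  have "(t \<cdot> pr1 PB \<oplus> t' \<cdot> pr2 PB) \<cdot> ?x = w \<cdot> (in1 PA \<cdot> pr1 PA \<oplus> in2 PA \<cdot> pr2 PA)"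
    using x(1) y(1) w(1) t t' PA(1-4) PB(1-8,10-) cmp_red[OF t(2)] cmp_red[OF t'(2)] by (simp add: cat)
  then have "(t \<cdot> pr1 PB \<oplus> t' \<cdot> pr2 PB) \<cdot> ?x = w" using PA(9) w(1) by (simp add: cat)
  moreover have "w' \<cdot> (t \<cdot> pr1 PB \<oplus> t' \<cdot> pr2 PB) = ?y"
    using x(2) y(2) w(2) t t' PB(1-4) PC(1-4) cmp_red[OF t(3)] cmp_red[OF t'(3)] by (simp add: cat)
  moreover have "\<guillemotleft>t \<cdot> pr1 PB \<oplus> t' \<cdot> pr2 PB : bsum PB \<rightarrow> W\<guillemotright>" using t(1) t'(1) PB by (simp add: cat)
  ultimately show ?thesis
    using realized_by_if_map_to[OF lexact_dsum rexact_dsum W] real_lexact[OF X] real_lexact[OF Y]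
      real_rexact[OF X] real_rexact[OF Y] P by metis
qed

end

section \<open>From 1-exangulated to extriangulated categories\<close>

text \<open>
  The axioms of a 1-exangulated category, with (EA2) for arbitrary biproducts instead of the chosen
  ones; in this form they are self-dual.
\<close>

locale exangulated3 = exact_realization3 \<C> \<E> \<ss>
  for \<C> :: "('o, 'm) precat" and \<E> :: "('o, 'm, 'e) bifunctor" and \<ss> :: "('o, 'm, 'e) correspondence" +
  assumes cmp_inflations:
      "\<And>A B C D F f f' g g' \<delta> \<delta>'.
         \<lbrakk>realized_by \<ss> \<delta> A B D f f'; realized_by \<ss> \<delta>' B C F g g'\<rbrakk>
         \<Longrightarrow> \<exists>E h' \<delta>''. realized_by \<ss> \<delta>'' A C E (g \<cdot> f) h'"
    and cmp_deflations:
      "\<And>A B C D F f f' g g' \<delta> \<delta>'.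
         \<lbrakk>realized_by \<ss> \<delta> D A B f' f; realized_by \<ss> \<delta>' F B C g' g\<rbrakk>
         \<Longrightarrow> \<exists>E h' \<delta>''. realized_by \<ss> \<delta>'' E A C h' (g \<cdot> f)"
    and cone:
      "\<And>A C D X Y \<rho> c x x' y y' P.
         \<lbrakk>\<guillemotleft>c : C \<rightarrow> D\<guillemotright>; realized_by \<ss> \<rho> A Y D y y'; realized_by \<ss> (pull A c \<rho>) A X C x x';
          is_biproduct C Y P\<rbrakk>
         \<Longrightarrow> \<exists>f. \<guillemotleft>f : X \<rightarrow> Y\<guillemotright> \<and> f \<cdot> x = y \<and> y' \<cdot> f = c \<cdot> x' \<and>
               realized_by \<ss> (push D x \<rho>) X (bsum P) D
                 (in2 P \<cdot> f \<oplus> \<ominus> (in1 P \<cdot> x')) (c \<cdot> pr1 P \<oplus> y' \<cdot> pr2 P)"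
    and cocone:
      "\<And>A B C X Y \<delta> a x x' y y' P.
         \<lbrakk>\<guillemotleft>a : A \<rightarrow> B\<guillemotright>; realized_by \<ss> \<delta> A X C x x'; realized_by \<ss> (push C a \<delta>) B Y C y y';
          is_biproduct X B P\<rbrakk>
         \<Longrightarrow> \<exists>h. \<guillemotleft>h : X \<rightarrow> Y\<guillemotright> \<and> h \<cdot> x = y \<cdot> a \<and> y' \<cdot> h = x' \<and>
               realized_by \<ss> (pull A y' \<delta>) A (bsum P) Y
                 (in2 P \<cdot> a \<oplus> in1 P \<cdot> x) (h \<cdot> pr1 P \<oplus> \<ominus> (y \<cdot> pr2 P))"
begin

lemma exangulated3_op: "exangulated3 (op_cat \<C>) (op_fun \<E>) (op_cor \<ss>)"
proof -
  interpret op: exact_realization3 "op_cat \<C>" "op_fun \<E>" "op_cor \<ss>" by (rule exact_realization3_op)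
  show ?thesis
  proof (intro exangulated3.intro exangulated3_axioms.intro exact_realization3_op, unfold opp op_cat_sel op_fun_sel)
    fix A C D X Y \<rho> c x x' y y' P
    assume c: "mor c \<and> tgt c = C \<and> src c = D \<and> C \<in> Obj \<C> \<and> D \<in> Obj \<C>"
      and r: "realized_by \<ss> \<rho> D Y A y' y" "realized_by \<ss> (push A c \<rho>) C X A x' x"
      and P: "is_biproduct C Y (op_biprod P)"
    \<comment> \<open>The cone lists the end term before the middle term, the cocone after it;
      dualizing therefore exchanges the summands.\<close>
    have "is_biproduct Y C (Biprod (bsum P) (pr2 P) (pr1 P) (in2 P) (in1 P))"
      using is_biproduct_swap[OF P] c realD(1)[OF r(1)] by simp
    from cocone[OF _ r this] c
    show "\<exists>f. (mor f \<and> tgt f = X \<and> src f = Y \<and> X \<in> Obj \<C> \<and> Y \<in> Obj \<C>) \<and>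
      x \<cdot> f = y \<and> f \<cdot> y' = x' \<cdot> c \<and>
      realized_by \<ss> (pull D x \<rho>) D (bsum P) X
       (pr1 P \<cdot> c \<oplus> pr2 P \<cdot> y') (f \<cdot> in2 P \<oplus> \<ominus> (x' \<cdot> in1 P))"
      by simp metis
  next
    fix A B C X Y \<delta> a x x' y y' P
    assume a: "mor a \<and> tgt a = A \<and> src a = B \<and> A \<in> Obj \<C> \<and> B \<in> Obj \<C>"
      and r: "realized_by \<ss> \<delta> C X A x' x" "realized_by \<ss> (pull C a \<delta>) C Y B y' y"
      and P: "is_biproduct X B (op_biprod P)"
    have "is_biproduct B X (Biprod (bsum P) (pr2 P) (pr1 P) (in2 P) (in1 P))"
      using is_biproduct_swap[OF P] a realD(1)[OF r(1)] by simp
    from cone[OF _ r this] a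
    show "\<exists>h. (mor h \<and> tgt h = X \<and> src h = Y \<and> X \<in> Obj \<C> \<and> Y \<in> Obj \<C>) \<and>
      x \<cdot> h = a \<cdot> y \<and> h \<cdot> y' = x' \<and>
      realized_by \<ss> (push A y' \<delta>) Y (bsum P) A
       (pr1 P \<cdot> h \<oplus> \<ominus> (pr2 P \<cdot> y)) (a \<cdot> in2 P \<oplus> x \<cdot> in1 P)"
      by simp metis
  qed (blast intro: cmp_inflations cmp_deflations)+
qed

text \<open>
  Exactness of \<open>\<C>(-, C) \<rightarrow> \<E>(-, A) \<rightarrow> \<E>(-, B)\<close> at the middle term. The cone construction is
  applied to \<open>(\<delta>, \<theta>) \<in> \<E>(C \<oplus> T, A)\<close> and the inclusion of \<open>C\<close>: the extension of the resulting
  sequence vanishes on \<open>T\<close>, so the inclusion of \<open>T\<close> lifts.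
\<close>

lemma ext_exact:
  assumes r: "realized_by \<ss> \<delta> A B C x y" and \<theta>: "\<theta> \<in> ext T A" "push T x \<theta> = zext T B" "T \<in> Obj \<C>"
  shows "\<exists>c. \<guillemotleft>c : T \<rightarrow> C\<guillemotright> \<and> \<theta> = pull A c \<delta>"
proof -
  note X = realD[OF r]
  have Obj: "A \<in> Obj \<C>" "B \<in> Obj \<C>" "C \<in> Obj \<C>" using X by simp_all
  obtain P where bP: "is_biproduct C T P" using biproduct_exists Obj \<theta>(3) by blast
  note P = biproductD[OF bP Obj(3) \<theta>(3)]
  define \<rho> where "\<rho> = pull A (pr1 P) \<delta> \<otimes>\<^bsub>Ext \<E> (bsum P) A\<^esub> pull A (pr2 P) \<theta>"
  have \<rho>: "\<rho> \<in> ext (bsum P) A" using P X \<theta> Obj by (simp add: cat \<rho>_def)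
  have \<rho>12: "pull A (in1 P) \<rho> = \<delta>" "pull A (in2 P) \<rho> = \<theta>" "push (bsum P) x \<rho> = zext (bsum P) B"
    using P(1-8,10-) X \<theta> Obj by (simp_all add: cat \<rho>_def)
  obtain Y u v where Y: "realized_by \<ss> \<rho> A Y (bsum P) u v" using real_ex[OF _ _ \<rho>] P Obj by blast
  note y = realD[OF Y]
  obtain Q where bQ: "is_biproduct C Y Q" using biproduct_exists[of C Y] Obj y(1) by blast
  note Q = biproductD[OF bQ Obj(3)]
  obtain f where "realized_by \<ss> (push (bsum P) x \<rho>) B (bsum Q) (bsum P)
      (in2 Q \<cdot> f \<oplus> \<ominus> (in1 Q \<cdot> y)) (in1 P \<cdot> pr1 Q \<oplus> v \<cdot> pr2 Q)"
    using cone[OF P(1) Y _ bQ] r \<rho>12(1) by metis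
  then obtain w where w: "\<guillemotleft>w : T \<rightarrow> bsum Q\<guillemotright>" "in2 P = (in1 P \<cdot> pr1 Q \<oplus> v \<cdot> pr2 Q) \<cdot> w"
    using lexact_lift[OF real_lexact P(2), of _ B] P(2) Obj by (metis \<rho>12(3) pull_zext)
  \<comment> \<open>The restriction of \<rho> to \<open>T\<close> is split along the lift
    \<open>w\<close>. The part through \<open>v\<close> vanishes because \<open>v\<close> is the
    last morphism of the sequence realizing \<rho>; the part through \<open>in1 P\<close> is a
    pullback of \<delta>.\<close>
  have "\<theta> = pull A ((in1 P \<cdot> pr1 Q \<oplus> v \<cdot> pr2 Q) \<cdot> w) \<rho>" using \<rho>12(2) w(2) by simp
  also have "\<dots> = pull A (pr1 Q \<cdot> w) (pull A (in1 P) \<rho>) \<otimes>\<^bsub>Ext \<E> T A\<^esub> pull A (pr2 Q \<cdot> w) (pull A v \<rho>)"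
    using w(1) P(1-4) Q(1-4) y(1,2) \<rho> Obj by (simp add: cat)
  also have "\<dots> = pull A (pr1 Q \<cdot> w) \<delta>"
    unfolding \<rho>12 y(5) using w(1) Q(1-4) X(1-3) Obj y(1) by (simp add: cat)
  finally show ?thesis using w(1) Q(1-4) Obj y(1) by (intro exI[of _ "pr1 Q \<cdot> w"]) (simp add: cat)
qed

text \<open>Pushing \<delta> along \<open>x' \<cdot> a = b \<cdot> x\<close> gives zero, so
  \<open>ext_exact\<close> provides some \<open>c0\<close>. A lift \<open>f\<close> of the pair
  \<open>a\<close>, \<open>c0\<close> may differ from \<open>b\<close>, but \<open>b - f\<close>
  factors as \<open>m \<cdot> y\<close>. Adding \<open>y' \<cdot> m\<close> to \<open>c0\<close>
  repairs the right square and does not affect the pullback, since \<delta>' vanishes on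
  \<open>y'\<close>.\<close>

lemma extend_map_left_square:
  assumes r: "realized_by \<ss> \<delta> A B C x y" "realized_by \<ss> \<delta>' A' B' C' x' y'"
    and a: "\<guillemotleft>a : A \<rightarrow> A'\<guillemotright>" and b: "\<guillemotleft>b : B \<rightarrow> B'\<guillemotright>" "b \<cdot> x = x' \<cdot> a"
  shows "\<exists>c. \<guillemotleft>c : C \<rightarrow> C'\<guillemotright> \<and> push C a \<delta> = pull A' c \<delta>' \<and> c \<cdot> y = y' \<cdot> b"
proof -
  note X = realD[OF r(1)] and Y = realD[OF r(2)]
  have "push C x' (push C a \<delta>) = push C b (push C x \<delta>)"
    using X(1-3) Y(1-3) a b by (simp add: cat)
  also have "\<dots> = zext C B'" unfolding X(6) using X(2) b by (simp add: cat)
  finally obtain c0 where c0: "\<guillemotleft>c0 : C \<rightarrow> C'\<guillemotright>" "push C a \<delta> = pull A' c0 \<delta>'"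
    using ext_exact[OF r(2)] X(1-3) a by (metis push_in)
  obtain f where f: "\<guillemotleft>f : B \<rightarrow> B'\<guillemotright>" "f \<cdot> x = x' \<cdot> a" "y' \<cdot> f = c0 \<cdot> y"
    using real_lift[OF r a c0] by blast
  have "(b \<oplus> \<ominus> f) \<cdot> x = zmor A B'" "\<guillemotleft>b \<oplus> \<ominus> f : B \<rightarrow> B'\<guillemotright>"
    using X(1,2) Y(1,2) a b f by (simp_all add: cat)
  then obtain m where m: "\<guillemotleft>m : C \<rightarrow> B'\<guillemotright>" "b \<oplus> \<ominus> f = m \<cdot> y"
    using rexact_cokernel[OF real_rexact[OF r(1)]] by metis
  have bm: "b = f \<oplus> m \<cdot> y"
    unfolding m(2)[symmetric] using b(1) f(1) by (simp add: cat pls_ac)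
  have "pull A' (c0 \<oplus> y' \<cdot> m) \<delta>' = pull A' c0 \<delta>' \<otimes>\<^bsub>Ext \<E> C A'\<^esub> pull A' m (pull A' y' \<delta>')"
    using Y(1-3) m(1) c0(1) a by (simp add: cat)
  also have "\<dots> = push C a \<delta>"
    unfolding Y(5) c0(2) using Y(1-3) m(1) c0(1) a by (simp add: cat)
  finally have "push C a \<delta> = pull A' (c0 \<oplus> y' \<cdot> m) \<delta>'" by simp
  moreover have "(c0 \<oplus> y' \<cdot> m) \<cdot> y = y' \<cdot> b"
    unfolding bm using X(1,2) Y(1,2) c0(1) f m(1) by (simp add: cat)
  moreover have "\<guillemotleft>c0 \<oplus> y' \<cdot> m : C \<rightarrow> C'\<guillemotright>" using Y(2) c0 m by (simp add: cat)
  ultimately show ?thesis by blast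
qed

lemma extend_map_right_square:
  assumes "realized_by \<ss> \<delta> A B C x y" "realized_by \<ss> \<delta>' A' B' C' x' y'"
    and "\<guillemotleft>c : C \<rightarrow> C'\<guillemotright>" and "\<guillemotleft>b : B \<rightarrow> B'\<guillemotright>" "c \<cdot> y = y' \<cdot> b"
  shows "\<exists>a. \<guillemotleft>a : A \<rightarrow> A'\<guillemotright> \<and> push C a \<delta> = pull A' c \<delta>' \<and> b \<cdot> x = x' \<cdot> a"
proof -
  interpret op: exangulated3 "op_cat \<C>" "op_fun \<E>" "op_cor \<ss>" by (rule exangulated3_op)
  show ?thesis
    using op.extend_map_left_square[of \<delta>' C' B' A' y' x' \<delta> C B A y x c b] assms
    unfolding opp op_cat_sel op_fun_sel by metis
qed

text \<open>
  An endomorphism of \<open>C\<close> compatible with \<open>y\<close> and \<open>\<delta>\<close> differs from the identity by a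
  morphism of square zero.
\<close>

lemma endo_of_third_term_iso:
  assumes r: "realized_by \<ss> \<delta> A B C x y" and u: "\<guillemotleft>u : C \<rightarrow> C\<guillemotright>" "u \<cdot> y = y" "pull A u \<delta> = \<delta>"
  shows "is_iso C C u"
proof -
  note X = realD[OF r]
  \<comment> \<open>The difference is compared with that of the identity to itself, which avoids
    inverses in extension groups.\<close>
  have "pull A (u \<oplus> \<ominus> (Idn \<C> C)) \<delta> = \<delta> \<otimes>\<^bsub>Ext \<E> C A\<^esub> pull A (\<ominus> (Idn \<C> C)) \<delta>"
    using u X(1-3) by (simp add: cat)
  also have "\<dots> = pull A (Idn \<C> C \<oplus> \<ominus> (Idn \<C> C)) \<delta>"
    unfolding pull_pls[of "Idn \<C> C"] using X(1-3) pull_pls[of "Idn \<C> C" "\<ominus> (Idn \<C> C)" A \<delta>]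
    by (simp add: ng_arr Idn_arr pull_Idn)
  also have "\<dots> = zext C A" using X(1-3) by (simp add: cat)
  finally have "pull A (u \<oplus> \<ominus> (Idn \<C> C)) \<delta> = zext C A" .
  moreover have "\<guillemotleft>u \<oplus> \<ominus> (Idn \<C> C) : C \<rightarrow> C\<guillemotright>" using u by (simp add: cat)
  ultimately obtain k where k: "\<guillemotleft>k : C \<rightarrow> B\<guillemotright>" "u \<oplus> \<ominus> (Idn \<C> C) = y \<cdot> k"
    using lexact_lift[OF real_lexact[OF r]] by blast
  have "(u \<oplus> \<ominus> (Idn \<C> C)) \<cdot> y = zmor B C" using u X(1,2) by (simp add: cat)
  then have "(y \<cdot> k) \<cdot> y = zmor B C" by (simp only: k(2))
  then have "y \<cdot> (k \<cdot> y) = zmor B C" using X(1,2) k(1) by (simp add: cat)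
  then have "(y \<cdot> k) \<cdot> ((y \<cdot> k) \<cdot> (y \<cdot> k)) = zmor C C"
    using X(1,2) k(1) cmp_red[of y "k \<cdot> y" _ "k \<cdot> (y \<cdot> k)"] by (simp add: cat)
  then show ?thesis using iso_if_diff_nilpotent[OF u(1) k(2)] by blast
qed

text \<open>Extending identities in both directions gives \<open>c\<close> and \<open>d\<close>.
  They need not be mutually inverse, but both composites fix the second morphism and the extension,
  so \<open>endo_of_third_term_iso\<close> applies to them.\<close>

lemma third_term_unique:
  assumes r: "realized_by \<ss> \<delta> A B C x y" "realized_by \<ss> \<delta>' A B C' x y'"
  shows "\<exists>c. is_iso C C' c \<and> \<guillemotleft>c : C \<rightarrow> C'\<guillemotright> \<and> c \<cdot> y = y' \<and> \<delta> = pull A c \<delta>'"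
proof -
  note X = realD[OF r(1)] and Y = realD[OF r(2)]
  have i: "\<guillemotleft>Idn \<C> A : A \<rightarrow> A\<guillemotright>" "\<guillemotleft>Idn \<C> B : B \<rightarrow> B\<guillemotright>" "Idn \<C> B \<cdot> x = x \<cdot> Idn \<C> A"
    using X(1) by (simp_all add: cat)
  have c: "\<exists>c. \<guillemotleft>c : C \<rightarrow> C'\<guillemotright> \<and> c \<cdot> y = y' \<and> \<delta> = pull A c \<delta>'"
    if r: "realized_by \<ss> \<delta> A B C x y" "realized_by \<ss> \<delta>' A B C' x y'" for C C' y y' \<delta> \<delta>'
    using extend_map_left_square[OF r i] realD(1-3)[OF r(1)] realD(2)[OF r(2)] by (auto simp: cat)
  obtain c where c1: "\<guillemotleft>c : C \<rightarrow> C'\<guillemotright>" "c \<cdot> y = y'" "\<delta> = pull A c \<delta>'" using c[OF r] by blast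
  obtain d where d: "\<guillemotleft>d : C' \<rightarrow> C\<guillemotright>" "d \<cdot> y' = y" "\<delta>' = pull A d \<delta>" using c[OF r(2,1)] by blast
  have "is_iso C C (d \<cdot> c)"
    using c1(1) d(1) X(1-3) Y(1-3) by (intro endo_of_third_term_iso[OF r(1)])
      (simp_all add: cat c1(2) d(2) flip: pull_pull c1(3) d(3))
  moreover have "is_iso C' C' (c \<cdot> d)"
    using c1(1) d(1) X(1-3) Y(1-3) by (intro endo_of_third_term_iso[OF r(2)])
      (simp_all add: cat c1(2) d(2) flip: pull_pull c1(3) d(3))
  ultimately have "is_iso C C' c" using iso_split_composites c1(1) d(1) by blast
  then show ?thesis using c1 by blast
qed

text \<open>
  The octahedron. (EA2) for \<open>\<delta>''\<close> pulled back along \<open>d0\<close> only provides some lift \<open>g0\<close> of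
  \<open>d0\<close>; as \<open>g - g0\<close> factors as \<open>m f'\<close>, replacing \<open>d0\<close> by \<open>d = d0 + h' m\<close> makes \<open>g\<close> itself
  the lift. The cone sequence \<open>B \<rightarrow> D \<oplus> C \<rightarrow> E\<close> so obtained and the cocone sequence for
  \<open>f'\<^sub>*\<delta>'\<close> have the same first morphism, hence isomorphic third terms.
\<close>

lemma octahedron:
  assumes r: "realized_by \<ss> \<delta> A B D f f'" "realized_by \<ss> \<delta>' B C F g g'"
  shows "\<exists>E h h' d e \<delta>''. E \<in> Obj \<C> \<and> h = g \<cdot> f \<and>
    h' \<in> arr C E \<and> d \<in> arr D E \<and> e \<in> arr E F \<and> d \<cdot> f' = h' \<cdot> g \<and> e \<cdot> h' = g' \<and>
    realized_by \<ss> \<delta>'' A C E h h' \<and> realized_by \<ss> (push F f' \<delta>') D E F d e \<and>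
    pull A d \<delta>'' = \<delta> \<and> push E f \<delta>'' = pull B e \<delta>'"
proof -
  note X = realD[OF r(1)] and Y = realD[OF r(2)]
  have Obj: "A \<in> Obj \<C>" "B \<in> Obj \<C>" "C \<in> Obj \<C>" "D \<in> Obj \<C>" "F \<in> Obj \<C>" using X Y by simp_all
  obtain E h' \<delta>'' where H: "realized_by \<ss> \<delta>'' A C E (g \<cdot> f) h'" using cmp_inflations[OF r] by blast
  note Z = realD[OF H]
  have "\<guillemotleft>Idn \<C> A : A \<rightarrow> A\<guillemotright>" "g \<cdot> f = (g \<cdot> f) \<cdot> Idn \<C> A" "push D (Idn \<C> A) \<delta> = \<delta>"
    using X(1-3) Y(1) by (simp_all add: cat)
  then obtain d0 where d0: "\<guillemotleft>d0 : D \<rightarrow> E\<guillemotright>" "pull A d0 \<delta>'' = \<delta>" "d0 \<cdot> f' = h' \<cdot> g"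
    using extend_map_left_square[OF r(1) H _ Y(1)] by metis
  obtain P where bP: "is_biproduct D C P" using biproduct_exists Obj by blast
  note P = biproductD[OF bP Obj(4,3)]
  obtain g0 where g0: "\<guillemotleft>g0 : B \<rightarrow> C\<guillemotright>" "g0 \<cdot> f = g \<cdot> f" "h' \<cdot> g0 = d0 \<cdot> f'"
    and K0: "realized_by \<ss> (push E f \<delta>'') B (bsum P) E
      (in2 P \<cdot> g0 \<oplus> \<ominus> (in1 P \<cdot> f')) (d0 \<cdot> pr1 P \<oplus> h' \<cdot> pr2 P)"
    using cone[OF d0(1) H _ bP] r(1) d0(2) by metis
  have "(g \<oplus> \<ominus> g0) \<cdot> f = zmor A C" "\<guillemotleft>g \<oplus> \<ominus> g0 : B \<rightarrow> C\<guillemotright>"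
    using X(1) Y(1) g0(1,2) by (simp_all add: cat)
  then obtain m where m: "\<guillemotleft>m : D \<rightarrow> C\<guillemotright>" "g \<oplus> \<ominus> g0 = m \<cdot> f'"
    using rexact_cokernel[OF real_rexact[OF r(1)]] by metis
  have gm: "g = g0 \<oplus> m \<cdot> f'" unfolding m(2)[symmetric] using g0(1) Y(1) by (simp add: cat pls_ac)
  define d where "d = d0 \<oplus> h' \<cdot> m"
  have d: "\<guillemotleft>d : D \<rightarrow> E\<guillemotright>" unfolding d_def using d0(1) m(1) Z(2) by (simp add: cat)
  have pd: "pull A d \<delta>'' = \<delta>"
  proof -
    have "pull A d \<delta>'' = pull A d0 \<delta>'' \<otimes>\<^bsub>Ext \<E> D A\<^esub> pull A m (pull A h' \<delta>'')"
      unfolding d_def using d0(1) m(1) Z(2,3) Obj by (simp add: cat)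
    then show ?thesis unfolding Z(5) d0(2) using m(1) X(3) Obj by (simp add: cat)
  qed
  define q where "q = d \<cdot> pr1 P \<oplus> h' \<cdot> pr2 P"
  define k where "k = in2 P \<cdot> g \<oplus> \<ominus> (in1 P \<cdot> f')"
  \<comment> \<open>The shear \<open>1 - in2 P \<cdot> m \<cdot> pr1 P\<close> of
    \<open>D \<oplus> C\<close> carries the cone formed with \<open>g0\<close> and \<open>d0\<close>
    to the one formed with \<open>g\<close> and \<open>d\<close>.\<close>
  have K: "realized_by \<ss> (push E f \<delta>'') B (bsum P) E k q"
  proof (rule realized_by_iso[OF K0])
    show "is_iso (bsum P) (bsum P) (Idn \<C> (bsum P) \<oplus> \<ominus> (in2 P \<cdot> (m \<cdot> pr1 P)))"
      using P(1-8,10-) m(1) by (intro iso_Idn_pls_nilpotent) (simp_all add: cat)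
    show "(Idn \<C> (bsum P) \<oplus> \<ominus> (in2 P \<cdot> (m \<cdot> pr1 P))) \<cdot> (in2 P \<cdot> g0 \<oplus> \<ominus> (in1 P \<cdot> f')) = k"
      unfolding k_def gm using P(1-8,10-) m(1) g0(1) X(2) by (simp add: cat pls_ac)
    show "q \<cdot> (Idn \<C> (bsum P) \<oplus> \<ominus> (in2 P \<cdot> (m \<cdot> pr1 P))) = d0 \<cdot> pr1 P \<oplus> h' \<cdot> pr2 P"
      unfolding q_def d_def using P(1-8,10-) m(1) d0(1) Z(2) by (simp add: cat pls_ac)
    show "\<guillemotleft>q : bsum P \<rightarrow> E\<guillemotright>" unfolding q_def using P d Z(2) by (simp add: cat)
  qed
  have p: "push F f' \<delta>' \<in> ext F D" using X(2) Y(3) Obj by (simp add: cat)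
  obtain W u v where W: "realized_by \<ss> (push F f' \<delta>') D W F u v" using real_ex[OF _ _ p] Obj by blast
  note w = realD[OF W]
  \<comment> \<open>The cocone has the summands in the other order and its sign at the other
    morphism. Exchanging them and negating the \<open>D\<close> part turns its first morphism into
    \<open>k\<close> exactly.\<close>
  let ?Q = "Biprod (bsum P) (in2 P) (\<ominus> (in1 P)) (pr2 P) (\<ominus> (pr1 P))"
  have bQ: "is_biproduct C D ?Q"
    using P by (intro is_biproductI) (simp_all add: cat pls_ac)
  obtain t where t: "\<guillemotleft>t : C \<rightarrow> W\<guillemotright>" "t \<cdot> g = u \<cdot> f'" "v \<cdot> t = g'"
    and L0: "realized_by \<ss> (pull B v \<delta>') B (bsum ?Q) W (in2 ?Q \<cdot> f' \<oplus> in1 ?Q \<cdot> g) (t \<cdot> pr1 ?Q \<oplus> \<ominus> (u \<cdot> pr2 ?Q))"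
    using cocone[OF X(2) r(2) W bQ] by blast
  have L: "realized_by \<ss> (pull B v \<delta>') B (bsum P) W k (u \<cdot> pr1 P \<oplus> t \<cdot> pr2 P)"
    using L0 X(2) Y(1) w(1) t(1) P(1-4) unfolding k_def by (simp add: cat pls_ac)
  obtain \<phi> where \<phi>: "is_iso E W \<phi>" "\<guillemotleft>\<phi> : E \<rightarrow> W\<guillemotright>" "\<phi> \<cdot> q = u \<cdot> pr1 P \<oplus> t \<cdot> pr2 P"
    "push E f \<delta>'' = pull B \<phi> (pull B v \<delta>')"
    using third_term_unique[OF K L] by blast
  \<comment> \<open>Restricting to the two summands shows that \<phi> carries \<open>d\<close> to
    \<open>u\<close> and \<open>h'\<close> to \<open>t\<close>. Transport of the realization
    \<open>W\<close> along the inverse of \<phi> then forces \<open>v \<cdot> \<phi>\<close> as the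
    morphism \<open>E -> F\<close>.\<close>
  have "(\<phi> \<cdot> q) \<cdot> in1 P = u" "(\<phi> \<cdot> q) \<cdot> in2 P = t"
    unfolding \<phi>(3) using P(1-8) w(1) t(1) by (simp_all add: cat)
  then have \<phi>12: "\<phi> \<cdot> d = u" "\<phi> \<cdot> h' = t"
    unfolding q_def using P(1-8) \<phi>(2) d Z(2) by (simp_all add: cat)
  obtain \<psi> where \<psi>: "\<guillemotleft>\<psi> : W \<rightarrow> E\<guillemotright>" "\<psi> \<cdot> \<phi> = Idn \<C> E" "\<phi> \<cdot> \<psi> = Idn \<C> W"
    using isoE[OF \<phi>(1)] \<phi>(2) by blast
  have e: "\<guillemotleft>v \<cdot> \<phi> : E \<rightarrow> F\<guillemotright>" using w(2) \<phi>(2) by (simp add: cat)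
  have "realized_by \<ss> (push F f' \<delta>') D E F d (v \<cdot> \<phi>)"
  proof (rule realized_by_iso[OF W])
    show "is_iso W E \<psi>" using isoI[OF \<psi>(1) \<phi>(2) \<psi>(3,2)] .
    show "\<psi> \<cdot> u = d" unfolding \<phi>12(1)[symmetric] using cmp_red[OF \<psi>(2), of d] \<psi> \<phi>(2) d by (simp add: cat)
    show "(v \<cdot> \<phi>) \<cdot> \<psi> = v" using \<psi> \<phi>(2) w(2) by (simp add: cat)
  qed (rule e)
  moreover have "(v \<cdot> \<phi>) \<cdot> h' = g'" using \<phi>(2) w(2) Z(2) \<phi>12(2) t(3) by (simp add: cat)
  moreover have "push E f \<delta>'' = pull B (v \<cdot> \<phi>) \<delta>'"
    unfolding \<phi>(4) using \<phi>(2) w(2) Y(3) Obj by (simp add: cat)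
  moreover have "d \<cdot> f' = h' \<cdot> g"
    unfolding d_def gm using d0(1,3) g0(1,3) m(1) Z(2) X(2) by (simp add: cat)
  ultimately have "E \<in> Obj \<C> \<and> g \<cdot> f = g \<cdot> f \<and> h' \<in> arr C E \<and> d \<in> arr D E \<and> v \<cdot> \<phi> \<in> arr E F \<and>
    d \<cdot> f' = h' \<cdot> g \<and> (v \<cdot> \<phi>) \<cdot> h' = g' \<and> realized_by \<ss> \<delta>'' A C E (g \<cdot> f) h' \<and>
    realized_by \<ss> (push F f' \<delta>') D E F d (v \<cdot> \<phi>) \<and> pull A d \<delta>'' = \<delta> \<and> push E f \<delta>'' = pull B (v \<cdot> \<phi>) \<delta>'"
    using H pd d e Z(2) by simp
  then show ?thesis by blast
qed

lemma octahedron_op: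
  assumes "realized_by \<ss> \<delta> D A B f' f" "realized_by \<ss> \<delta>' F B C g' g"
  shows "\<exists>E h h' d e \<delta>''. E \<in> Obj \<C> \<and> h = g \<cdot> f \<and>
    h' \<in> arr E A \<and> d \<in> arr D E \<and> e \<in> arr E F \<and> h' \<cdot> d = f' \<and> f \<cdot> h' = g' \<cdot> e \<and>
    realized_by \<ss> \<delta>'' E A C h' h \<and> realized_by \<ss> (pull D g' \<delta>) D E F d e \<and>
    push C e \<delta>'' = \<delta>' \<and> push B d \<delta> = pull E g \<delta>''"
proof -
  interpret op: exangulated3 "op_cat \<C>" "op_fun \<E>" "op_cor \<ss>" by (rule exangulated3_op)
  note op.octahedron[of \<delta>' C B F g g' \<delta> A D f f', unfolded opp op_cat_sel op_fun_sel, OF assms(2,1)]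
  then show ?thesis by (elim exE conjE) (intro exI conjI, (assumption | erule sym)+)
qed

theorem extriangulated: "extriangulated_category \<C> \<E> \<ss>"
proof (intro extriangulated_category.intro extriangulated_category_axioms.intro)
  show "biadditive_functor \<C> \<E>" by (rule biadditive_functor_axioms)
next
  fix C A \<delta> assume "C \<in> Obj \<C>" "A \<in> Obj \<C>" "\<delta> \<in> ext C A"
  then show "\<exists>B x y. is_seq3 A B C x y \<and> \<ss> C A \<delta> = equiv_class3 A B C x y"
    using real_ex[of C A \<delta>] unfolding realized_by_def by blast
next
  fix A B C x y \<delta> A' B' C' x' y' \<delta>' a c
  assume r: "realized_by \<ss> \<delta> A B C x y" "realized_by \<ss> \<delta>' A' B' C' x' y'"
    and "ext_morphism C A \<delta> C' A' \<delta>' a c"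
  then have "\<guillemotleft>a : A \<rightarrow> A'\<guillemotright>" "\<guillemotleft>c : C \<rightarrow> C'\<guillemotright>" "push C a \<delta> = pull A' c \<delta>'"
    using ext_morphism_iff[of A A' C C'] realD(1,2)[OF r(1)] realD(1,2)[OF r(2)] by simp_all
  then show "\<exists>b\<in>arr B B'. b \<cdot> x = x' \<cdot> a \<and> y' \<cdot> b = c \<cdot> y"
    using real_lift[OF r] arrI by blast
next
  fix A C assume AC: "A \<in> Obj \<C>" "C \<in> Obj \<C>"
  then have "is_biproduct A C (biprod A C)"
    unfolding biprod_def using biproduct_exists by (auto intro: someI_ex)
  from realized_by_split[OF this AC] biproductD[OF this AC]
  show "\<ss> C A (zext C A) = equiv_class3 A (A \<oplus>\<oplus> C) C
      (col A A C (Idn \<C> A) (zmor A C)) (row A C C (zmor A C) (Idn \<C> C))"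
    by (simp add: col_eq row_eq realized_by_def cat AC)
next
  fix A B C x y \<delta> A' B' C' x' y' \<delta>'
  assume r: "realized_by \<ss> \<delta> A B C x y" "realized_by \<ss> \<delta>' A' B' C' x' y'"
  note X = realD[OF r(1)] and Y = realD[OF r(2)]
  have Obj: "A \<in> Obj \<C>" "A' \<in> Obj \<C>" "B \<in> Obj \<C>" "B' \<in> Obj \<C>" "C \<in> Obj \<C>" "C' \<in> Obj \<C>"
    using X Y by simp_all
  have bip: "is_biproduct A A' (biprod A A')" "is_biproduct B B' (biprod B B')" "is_biproduct C C' (biprod C C')"
    using Obj by (simp_all add: is_biproduct_biprod)
  from realized_by_dsum[OF r this]
  show "\<ss> (C \<oplus>\<oplus> C') (A \<oplus>\<oplus> A') (dsum_ext C A \<delta> C' A' \<delta>') =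
      equiv_class3 (A \<oplus>\<oplus> A') (B \<oplus>\<oplus> B') (C \<oplus>\<oplus> C')
        (dsum_mor A A' B B' x x') (dsum_mor B B' C C' y y')"
    using X(1-3) Y(1-3) by (simp add: realized_by_def dsum_ext_eq dsum_mor_eq)
next
  fix A B C x y \<delta> A' B' C' x' y' \<delta>' a b
  assume r: "realized_by \<ss> \<delta> A B C x y" "realized_by \<ss> \<delta>' A' B' C' x' y'"
    and ab: "a \<in> arr A A'" "b \<in> arr B B'" "b \<cdot> x = x' \<cdot> a"
  note X = realD[OF r(1)] and Y = realD[OF r(2)]
  have "\<guillemotleft>a : A \<rightarrow> A'\<guillemotright>" "\<guillemotleft>b : B \<rightarrow> B'\<guillemotright>" using ab X Y is_arr_iff by blast+
  from extend_map_left_square[OF r this ab(3)]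
  show "\<exists>c. ext_morphism C A \<delta> C' A' \<delta>' a c \<and> c \<cdot> y = y' \<cdot> b"
    using ext_morphism_iff[of A A' C C'] X(1,2) Y(1,2) \<open>\<guillemotleft>a : A \<rightarrow> A'\<guillemotright>\<close> by blast
next
  fix A B C x y \<delta> A' B' C' x' y' \<delta>' b c
  assume r: "realized_by \<ss> \<delta> A B C x y" "realized_by \<ss> \<delta>' A' B' C' x' y'"
    and bc: "b \<in> arr B B'" "c \<in> arr C C'" "c \<cdot> y = y' \<cdot> b"
  note X = realD[OF r(1)] and Y = realD[OF r(2)]
  have "\<guillemotleft>c : C \<rightarrow> C'\<guillemotright>" "\<guillemotleft>b : B \<rightarrow> B'\<guillemotright>" using bc X Y is_arr_iff by blast+
  from extend_map_right_square[OF r this bc(3)]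
  show "\<exists>a. ext_morphism C A \<delta> C' A' \<delta>' a c \<and> b \<cdot> x = x' \<cdot> a"
    using ext_morphism_iff[of A A' C C'] X(1,2) Y(1,2) \<open>\<guillemotleft>c : C \<rightarrow> C'\<guillemotright>\<close> by blast
qed (fact octahedron octahedron_op)+

end

section \<open>From extriangulated to 1-exangulated categories\<close>

context preadditive_category
begin

lemma zero_object_Idn: "is_zero_object Z \<Longrightarrow> Z \<in> Obj \<C> \<and> Idn \<C> Z = zmor Z Z"
  using zero_object_mor[of Z "Idn \<C> Z" Z] by (auto simp: is_zero_object_def cat)

lemma is_biproduct_zero_left:
  assumes "is_zero_object Z" "A \<in> Obj \<C>"
  shows "is_biproduct Z A (Biprod A (zmor Z A) (Idn \<C> A) (zmor A Z) (Idn \<C> A))"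
  using zero_object_Idn[OF assms(1)] assms(2) by (intro is_biproductI) (simp_all add: cat)

lemma is_biproduct_zero_right:
  assumes "is_zero_object Z" "A \<in> Obj \<C>"
  shows "is_biproduct A Z (Biprod A (Idn \<C> A) (zmor Z A) (Idn \<C> A) (zmor A Z))"
  using zero_object_Idn[OF assms(1)] assms(2) by (intro is_biproductI) (simp_all add: cat)

end

context exact_realization3
begin

text \<open>Both are split sequences as soon as \<open>A\<close> itself is taken as the biproduct
  with the zero object, which arbitrary biproduct data permit.\<close>

lemma realized_by_zero:
  assumes "is_zero_object Z" "A \<in> Obj \<C>"
  shows "realized_by \<ss> (zext Z A) A A Z (Idn \<C> A) (zmor A Z)"
    and "realized_by \<ss> (zext A Z) Z A A (zmor Z A) (Idn \<C> A)"
  using realized_by_split[OF is_biproduct_zero_right[OF assms]] realized_by_split[OF is_biproduct_zero_left[OF assms]]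
    zero_object_Idn[OF assms(1)] assms(2) by simp_all

end

text \<open>The part of the axioms of an extriangulated category that yields exactness; it is self-dual.\<close>

locale pre_extriangulated = biadditive_functor \<C> \<E>
  for \<C> :: "('o, 'm) precat" and \<E> :: "('o, 'm, 'e) bifunctor" +
  fixes \<ss> :: "('o, 'm, 'e) correspondence"
  assumes ex:
      "\<And>C A \<delta>. \<lbrakk>C \<in> Obj \<C>; A \<in> Obj \<C>; \<delta> \<in> ext C A\<rbrakk> \<Longrightarrow> \<exists>B x y. realized_by \<ss> \<delta> A B C x y"
    and lift:
      "\<And>A B C x y \<delta> A' B' C' x' y' \<delta>' a c.
         \<lbrakk>realized_by \<ss> \<delta> A B C x y; realized_by \<ss> \<delta>' A' B' C' x' y';
          \<guillemotleft>a : A \<rightarrow> A'\<guillemotright>; \<guillemotleft>c : C \<rightarrow> C'\<guillemotright>; push C a \<delta> = pull A' c \<delta>'\<rbrakk>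
         \<Longrightarrow> \<exists>b. \<guillemotleft>b : B \<rightarrow> B'\<guillemotright> \<and> b \<cdot> x = x' \<cdot> a \<and> y' \<cdot> b = c \<cdot> y"
    and zero_right:
      "\<And>A Z. \<lbrakk>is_zero_object Z; A \<in> Obj \<C>\<rbrakk> \<Longrightarrow> realized_by \<ss> (zext Z A) A A Z (Idn \<C> A) (zmor A Z)"
    and zero_left:
      "\<And>A Z. \<lbrakk>is_zero_object Z; A \<in> Obj \<C>\<rbrakk> \<Longrightarrow> realized_by \<ss> (zext A Z) Z A A (zmor Z A) (Idn \<C> A)"
    and extend_left:
      "\<And>A B C x y \<delta> A' B' C' x' y' \<delta>' a b.
         \<lbrakk>realized_by \<ss> \<delta> A B C x y; realized_by \<ss> \<delta>' A' B' C' x' y';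
          \<guillemotleft>a : A \<rightarrow> A'\<guillemotright>; \<guillemotleft>b : B \<rightarrow> B'\<guillemotright>; b \<cdot> x = x' \<cdot> a\<rbrakk>
         \<Longrightarrow> \<exists>c. \<guillemotleft>c : C \<rightarrow> C'\<guillemotright> \<and> push C a \<delta> = pull A' c \<delta>' \<and> c \<cdot> y = y' \<cdot> b"
    and extend_right:
      "\<And>A B C x y \<delta> A' B' C' x' y' \<delta>' c b.
         \<lbrakk>realized_by \<ss> \<delta> A B C x y; realized_by \<ss> \<delta>' A' B' C' x' y';
          \<guillemotleft>c : C \<rightarrow> C'\<guillemotright>; \<guillemotleft>b : B \<rightarrow> B'\<guillemotright>; c \<cdot> y = y' \<cdot> b\<rbrakk>
         \<Longrightarrow> \<exists>a. \<guillemotleft>a : A \<rightarrow> A'\<guillemotright> \<and> push C a \<delta> = pull A' c \<delta>' \<and> b \<cdot> x = x' \<cdot> a"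
begin

lemma pre_extriangulated_op: "pre_extriangulated (op_cat \<C>) (op_fun \<E>) (op_cor \<ss>)"
proof -
  interpret op: biadditive_functor "op_cat \<C>" "op_fun \<E>" by (rule biadditive_op)
  show ?thesis
  proof (intro pre_extriangulated.intro pre_extriangulated_axioms.intro biadditive_op, unfold opp op_cat_sel op_fun_sel)
    show "\<exists>B x y. realized_by \<ss> \<delta> C B A y x" if "C \<in> Obj \<C>" "A \<in> Obj \<C>" "\<delta> \<in> ext A C" for C A \<delta>
      using ex[OF that(2,1,3)] by blast
  next
    fix A B C x y \<delta> A' B' C' x' y' \<delta>' a c
    assume r: "realized_by \<ss> \<delta> C B A y x" "realized_by \<ss> \<delta>' C' B' A' y' x'"
    show "\<exists>b. (mor b \<and> tgt b = B \<and> src b = B' \<and> B \<in> Obj \<C> \<and> B' \<in> Obj \<C>) \<and> x \<cdot> b = a \<cdot> x' \<and> b \<cdot> y' = y \<cdot> c"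
      if "mor a \<and> tgt a = A \<and> src a = A' \<and> A \<in> Obj \<C> \<and> A' \<in> Obj \<C>"
        "mor c \<and> tgt c = C \<and> src c = C' \<and> C \<in> Obj \<C> \<and> C' \<in> Obj \<C>" "pull C a \<delta> = push A' c \<delta>'"
      using lift[OF r(2,1), of c a] that by metis
    show "\<exists>c. (mor c \<and> tgt c = C \<and> src c = C' \<and> C \<in> Obj \<C> \<and> C' \<in> Obj \<C>) \<and> pull C a \<delta> = push A' c \<delta>' \<and> y \<cdot> c = b \<cdot> y'"
      if "mor a \<and> tgt a = A \<and> src a = A' \<and> A \<in> Obj \<C> \<and> A' \<in> Obj \<C>"
        "mor b \<and> tgt b = B \<and> src b = B' \<and> B \<in> Obj \<C> \<and> B' \<in> Obj \<C>" "x \<cdot> b = a \<cdot> x'" for b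
      using extend_right[OF r(2,1), of a b] that by metis
    show "\<exists>a. (mor a \<and> tgt a = A \<and> src a = A' \<and> A \<in> Obj \<C> \<and> A' \<in> Obj \<C>) \<and> pull C a \<delta> = push A' c \<delta>' \<and> x \<cdot> b = a \<cdot> x'"
      if "mor c \<and> tgt c = C \<and> src c = C' \<and> C \<in> Obj \<C> \<and> C' \<in> Obj \<C>"
        "mor b \<and> tgt b = B \<and> src b = B' \<and> B \<in> Obj \<C> \<and> B' \<in> Obj \<C>" "y \<cdot> c = b \<cdot> y'" for b
      using extend_left[OF r(2,1), of c b] that by metis
  qed (simp_all add: zero_left zero_right)
qed

text \<open>Each part tests the sequence against a realization with a zero object. Extending from
  \<open>A -> A -> 0\<close> gives \<open>y \<cdot> x = 0\<close>; extending from
  \<open>0 -> B -> B\<close> shows that \<delta> vanishes on \<open>y\<close>. If \<open>y\<close>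
  kills \<open>g\<close>, then \<open>g\<close> is the middle of a map from
  \<open>T -> T -> 0\<close>, whose left component is the factorization. If \<delta> vanishes on
  \<open>g\<close>, then \<open>g\<close> belongs to a morphism from the zero extension in
  \<open>\<E>(T, 0)\<close>, and its lift is the factorization.\<close>

lemma lexact:
  assumes r: "realized_by \<ss> \<delta> A B C x y"
  shows "lexact A B C x y \<delta>"
proof -
  obtain Z where Z: "is_zero_object Z" using zero_object_exists by blast
  note X = realized_byD[OF r]
  have Obj: "A \<in> Obj \<C>" "B \<in> Obj \<C>" "C \<in> Obj \<C>" "Z \<in> Obj \<C>" using X zero_object_Idn[OF Z] by simp_all
  note R = zero_right[OF Z] and L = zero_left[OF Z]
  have "\<guillemotleft>Idn \<C> A : A \<rightarrow> A\<guillemotright>" "x \<cdot> Idn \<C> A = x \<cdot> Idn \<C> A" using X Obj by (simp_all add: cat)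
  from extend_left[OF R[OF Obj(1)] r this(1) X(1) this(2)]
  obtain c where "\<guillemotleft>c : Z \<rightarrow> C\<guillemotright>" "c \<cdot> zmor A Z = y \<cdot> x" by blast
  then have yx: "y \<cdot> x = zmor A C" using Obj by (simp add: cat)
  have k: "\<exists>k. \<guillemotleft>k : T \<rightarrow> A\<guillemotright> \<and> g = x \<cdot> k" if g: "\<guillemotleft>g : T \<rightarrow> B\<guillemotright>" "y \<cdot> g = zmor T C" for T g
  proof -
    have "\<guillemotleft>zmor Z C : Z \<rightarrow> C\<guillemotright>" "zmor Z C \<cdot> zmor T Z = y \<cdot> g" using g Obj by (simp_all add: cat)
    from extend_right[OF R r this(1) g(1) this(2)] g show ?thesis by (auto simp: cat)
  qed
  have z: "pull A y \<delta> = zext B A"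
  proof -
    have "\<guillemotleft>zmor Z A : Z \<rightarrow> A\<guillemotright>" "\<guillemotleft>Idn \<C> B : B \<rightarrow> B\<guillemotright>" "Idn \<C> B \<cdot> zmor Z B = x \<cdot> zmor Z A"
      using X Obj by (simp_all add: cat)
    from extend_left[OF L[OF Obj(2)] r this]
    obtain c where "\<guillemotleft>c : B \<rightarrow> C\<guillemotright>" "push B (zmor Z A) (zext B Z) = pull A c \<delta>" "c \<cdot> Idn \<C> B = y \<cdot> Idn \<C> B" by blast
    then show ?thesis using X Obj by (simp add: cat)
  qed
  have l: "\<exists>k. \<guillemotleft>k : T \<rightarrow> B\<guillemotright> \<and> g = y \<cdot> k" if g: "\<guillemotleft>g : T \<rightarrow> C\<guillemotright>" "pull A g \<delta> = zext T A" for T g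
  proof -
    have "\<guillemotleft>zmor Z A : Z \<rightarrow> A\<guillemotright>" "push T (zmor Z A) (zext T Z) = pull A g \<delta>" using g Obj by (simp_all add: cat)
    from lift[OF L r this(1) g(1) this(2)] g
    obtain b where "\<guillemotleft>b : T \<rightarrow> B\<guillemotright>" "y \<cdot> b = g \<cdot> Idn \<C> T" by blast
    then show ?thesis using g by (intro exI[of _ b]) (simp add: cat)
  qed
  show ?thesis unfolding lexact_def using X yx z k l by (intro conjI allI impI) iprover+
qed

lemma exact_realization3: "exact_realization3 \<C> \<E> \<ss>"
proof -
  interpret op: pre_extriangulated "op_cat \<C>" "op_fun \<E>" "op_cor \<ss>" by (rule pre_extriangulated_op)
  have rexact: "rexact A B C x y \<delta>" if "realized_by \<ss> \<delta> A B C x y" for A B C x y \<delta>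
    using op.lexact[of \<delta> C B A y x] that by (simp add: opp)
  show ?thesis by unfold_locales (fact ex lift lexact rexact)+
qed

end

text \<open>What remains of the extriangulated axioms after lifting, (ET3) and its dual have been
  turned into an exact realization. Unlike (ET2), this list involves no chosen biproducts and
  dualizes directly.\<close>

locale octahedral3 = exact_realization3 \<C> \<E> \<ss>
  for \<C> :: "('o, 'm) precat" and \<E> :: "('o, 'm, 'e) bifunctor" and \<ss> :: "('o, 'm, 'e) correspondence" +
  assumes oct:
      "\<And>A B C D F f f' g g' \<delta> \<delta>'.
         \<lbrakk>realized_by \<ss> \<delta> A B D f f'; realized_by \<ss> \<delta>' B C F g g'\<rbrakk>
         \<Longrightarrow> \<exists>E h h' d e \<delta>''. E \<in> Obj \<C> \<and> h = g \<cdot> f \<and>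
               h' \<in> arr C E \<and> d \<in> arr D E \<and> e \<in> arr E F \<and>
               d \<cdot> f' = h' \<cdot> g \<and> e \<cdot> h' = g' \<and>
               realized_by \<ss> \<delta>'' A C E h h' \<and>
               realized_by \<ss> (push F f' \<delta>') D E F d e \<and>
               pull A d \<delta>'' = \<delta> \<and>
               push E f \<delta>'' = pull B e \<delta>'"
    and oct_op:
      "\<And>A B C D F f f' g g' \<delta> \<delta>'.
         \<lbrakk>realized_by \<ss> \<delta> D A B f' f; realized_by \<ss> \<delta>' F B C g' g\<rbrakk>
         \<Longrightarrow> \<exists>E h h' d e \<delta>''. E \<in> Obj \<C> \<and> h = g \<cdot> f \<and>
               h' \<in> arr E A \<and> d \<in> arr D E \<and> e \<in> arr E F \<and>
               h' \<cdot> d = f' \<and> f \<cdot> h' = g' \<cdot> e \<and>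
               realized_by \<ss> \<delta>'' E A C h' h \<and>
               realized_by \<ss> (pull D g' \<delta>) D E F d e \<and>
               push C e \<delta>'' = \<delta>' \<and>
               push B d \<delta> = pull E g \<delta>''"
begin

lemma octahedral3_op: "octahedral3 (op_cat \<C>) (op_fun \<E>) (op_cor \<ss>)"
proof -
  interpret op: exact_realization3 "op_cat \<C>" "op_fun \<E>" "op_cor \<ss>" by (rule exact_realization3_op)
  show ?thesis
  proof (intro octahedral3.intro octahedral3_axioms.intro exact_realization3_op, unfold opp op_cat_sel op_fun_sel, goal_cases)
    case 1
    from oct_op[OF 1(2,1)] show ?case
      by (elim exE conjE) (intro exI conjI, (assumption | erule sym)+)
  next
    case 2
    from oct[OF 2(2,1)] show ?case
      by (elim exE conjE) (intro exI conjI, (assumption | erule sym)+)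
  qed
qed

text \<open>
  \<open>C \<oplus> Y \<rightarrow> D\<close> is the composite of the deflations \<open>1 \<oplus> y' : C \<oplus> Y \<rightarrow> C \<oplus> D\<close> and
  \<open>[c 1] : C \<oplus> D \<rightarrow> D\<close>, the second of which splits with kernel \<open>[-1; c] : C \<rightarrow> C \<oplus> D\<close>; the
  octahedron on these two provides the cone.
\<close>

lemma cone_of_octahedron:
  assumes c: "\<guillemotleft>c : C \<rightarrow> D\<guillemotright>" and r: "realized_by \<ss> \<rho> A Y D y y'" "realized_by \<ss> (pull A c \<rho>) A X C x x'"
    and bP: "is_biproduct C Y P"
  shows "\<exists>f. \<guillemotleft>f : X \<rightarrow> Y\<guillemotright> \<and> f \<cdot> x = y \<and> y' \<cdot> f = c \<cdot> x' \<and>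
    realized_by \<ss> (push D x \<rho>) X (bsum P) D
      (in2 P \<cdot> f \<oplus> \<ominus> (in1 P \<cdot> x')) (c \<cdot> pr1 P \<oplus> y' \<cdot> pr2 P)"
proof -
  note y = realD[OF r(1)] and x = realD[OF r(2)]
  have Obj: "A \<in> Obj \<C>" "C \<in> Obj \<C>" "D \<in> Obj \<C>" "X \<in> Obj \<C>" "Y \<in> Obj \<C>" using x y by simp_all
  obtain Z where Z: "is_zero_object Z" using zero_object_exists by blast
  note Z0 = zero_object_Idn[OF Z]
  obtain Q where bQ: "is_biproduct C D Q" using biproduct_exists Obj by blast
  note P = biproductD[OF bP Obj(2,5)] and Q = biproductD[OF bQ Obj(2,3)]
  let ?f = "in1 Q \<cdot> pr1 P \<oplus> in2 Q \<cdot> (y' \<cdot> pr2 P)"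
  \<comment> \<open>Direct sum of \<open>0 -> C -> C\<close> with the realization of \<rho>. The
    biproduct of \<open>0\<close> and \<open>A\<close> is taken to be \<open>A\<close>, so the first
    term is unchanged.\<close>
  have 1: "realized_by \<ss> (pull A (pr2 Q) \<rho>) A (bsum P) (bsum Q) (in2 P \<cdot> y) ?f"
    using realized_by_dsum[OF realized_by_zero(2)[OF Z Obj(2)] r(1) is_biproduct_zero_left[OF Z Obj(1)] bP bQ]
      P(1-4) Q(1-4) y(1-3) Z0 Obj by (simp add: cat)
  \<comment> \<open>A sheared biproduct structure on the same object, whose split sequence is the
    second deflation with its kernel. The sign in the kernel is the one that reappears as
    \<open>-x'\<close> in the cone.\<close>
  let ?Q = "Biprod (bsum Q) (in2 Q \<cdot> c \<oplus> \<ominus> (in1 Q)) (in2 Q) (\<ominus> (pr1 Q)) (c \<cdot> pr1 Q \<oplus> pr2 Q)"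
  have "is_biproduct C D ?Q"
    using Q c by (intro is_biproductI) (simp_all add: cat pls_ac)
  from realized_by_split[OF this Obj(2,3)]
  have 2: "realized_by \<ss> (zext D C) C (bsum Q) D (in2 Q \<cdot> c \<oplus> \<ominus> (in1 Q)) (c \<cdot> pr1 Q \<oplus> pr2 Q)" by simp
  obtain E h' d e \<delta>'' where o: "E \<in> Obj \<C>" "h' \<in> arr E (bsum P)" "d \<in> arr A E" "e \<in> arr E C"
    "h' \<cdot> d = in2 P \<cdot> y" "?f \<cdot> h' = (in2 Q \<cdot> c \<oplus> \<ominus> (in1 Q)) \<cdot> e"
    "realized_by \<ss> \<delta>'' E (bsum P) D h' ((c \<cdot> pr1 Q \<oplus> pr2 Q) \<cdot> ?f)"
    "realized_by \<ss> (pull A (in2 Q \<cdot> c \<oplus> \<ominus> (in1 Q)) (pull A (pr2 Q) \<rho>)) A E C d e"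
    "push (bsum Q) d (pull A (pr2 Q) \<rho>) = pull E (c \<cdot> pr1 Q \<oplus> pr2 Q) \<delta>''"
    using oct_op[OF 1 2] by blast
  have a: "\<guillemotleft>h' : E \<rightarrow> bsum P\<guillemotright>" "\<guillemotleft>d : A \<rightarrow> E\<guillemotright>" "\<guillemotleft>e : E \<rightarrow> C\<guillemotright>"
    using is_arrI[OF _ _ o(2)] is_arrI[OF _ _ o(3)] is_arrI[OF _ _ o(4)] o(1) Obj P(1) by simp_all
  have "(c \<cdot> pr1 Q \<oplus> pr2 Q) \<cdot> ?f = c \<cdot> pr1 P \<oplus> y' \<cdot> pr2 P"
    using c y(2) P(1-4) Q(1-8,10-) by (simp add: cat)
  with o(7) have R: "realized_by \<ss> \<delta>'' E (bsum P) D h' (c \<cdot> pr1 P \<oplus> y' \<cdot> pr2 P)" by simp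
  have "pull A (in2 Q \<cdot> c \<oplus> \<ominus> (in1 Q)) (pull A (pr2 Q) \<rho>) = pull A (pr2 Q \<cdot> (in2 Q \<cdot> c \<oplus> \<ominus> (in1 Q))) \<rho>"
    using c Q(1-4) y(3) Obj by (simp only: pull_pull cmp_arr pls_arr ng_arr)
  also have "pr2 Q \<cdot> (in2 Q \<cdot> c \<oplus> \<ominus> (in1 Q)) = c" using c Q(1-8,10-) by (simp add: cat)
  finally have S: "realized_by \<ss> (pull A c \<rho>) A E C d e" using o(8) by simp
  \<comment> \<open>\<open>in2 Q\<close> is a section of the second deflation, so pulling back along
    it isolates \<delta>''.\<close>
  have "pull E (in2 Q) (push (bsum Q) d (pull A (pr2 Q) \<rho>)) = pull E ((c \<cdot> pr1 Q \<oplus> pr2 Q) \<cdot> in2 Q) \<delta>''"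
    unfolding o(9) using c Q(1-4) realD(1-3)[OF R] Obj by (simp only: pull_pull cmp_arr pls_arr)
  also have "(c \<cdot> pr1 Q \<oplus> pr2 Q) \<cdot> in2 Q = Idn \<C> D" using c Q(1-8) by (simp add: cat)
  finally have \<delta>'': "push D d \<rho> = \<delta>''"
    using a Q(1-8) y(1-3) realD(1-3)[OF R] Obj by (simp add: cat)
  have "pr1 Q \<cdot> (?f \<cdot> h') = \<ominus> e" "pr2 Q \<cdot> (?f \<cdot> h') = c \<cdot> e"
    unfolding o(6) using a c Q(1-8,10-) by (simp_all add: cat)
  then have hh: "pr1 P \<cdot> h' = \<ominus> e" "y' \<cdot> (pr2 P \<cdot> h') = c \<cdot> e"
    using a y(2) P(1-4) Q(1-8,10-) by (simp_all add: cat)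
  \<comment> \<open>The octahedron yields some middle term \<open>E\<close> for the pullback of
    \<rho> along \<open>c\<close>. Uniqueness of realizations links it to the given
    \<open>X\<close>, and the sequence is moved along this isomorphism of first terms.\<close>
  obtain b where b: "is_iso X E b" "b \<cdot> x = d" "e \<cdot> b = x'" using realized_by_unique[OF r(2) S] by blast
  obtain b' where b': "\<guillemotleft>b : X \<rightarrow> E\<guillemotright>" "\<guillemotleft>b' : E \<rightarrow> X\<guillemotright>" "b' \<cdot> b = Idn \<C> X" "b \<cdot> b' = Idn \<C> E"
    using isoE[OF b(1) Obj(4) o(1)] by blast
  let ?g = "pr2 P \<cdot> (h' \<cdot> b)"
  have "\<guillemotleft>?g : X \<rightarrow> Y\<guillemotright>" using a b' P by (simp add: cat)
  moreover have "?g \<cdot> x = pr2 P \<cdot> (h' \<cdot> d)"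
    unfolding b(2)[symmetric] using a b' x(1) P(1-4) by (simp add: cat)
  then have "?g \<cdot> x = y" unfolding o(5) using P y(1) by simp
  moreover have "y' \<cdot> ?g = c \<cdot> x'"
    unfolding b(3)[symmetric] using a b' c y(2) P(1-4) cmp_red[OF hh(2), of b] by (simp add: cat)
  moreover have "h' \<cdot> b = in2 P \<cdot> ?g \<oplus> \<ominus> (in1 P \<cdot> x')"
    by (rule biproduct_eqI[OF bP Obj(2,5), of _ X])
      (use a b' x(2) P(1-8,10-) cmp_red[OF hh(1), of b] b(3) in \<open>simp_all add: cat\<close>)
  moreover have "push D b' (push D d \<rho>) = push D x \<rho>"
    unfolding b(2)[symmetric] using b' x(1) y(3) cmp_red[OF b'(3), of x] Obj by (simp add: cat)
  moreover have "realized_by \<ss> (push D b' \<delta>'') X (bsum P) D (h' \<cdot> b) (c \<cdot> pr1 P \<oplus> y' \<cdot> pr2 P)"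
    using realized_by_push_iso[OF R b'(2,1,4,3)] .
  ultimately show ?thesis unfolding \<delta>''[symmetric] by (intro exI[of _ ?g]) simp
qed

lemma cocone_of_octahedron:
  assumes a: "\<guillemotleft>a : A \<rightarrow> B\<guillemotright>" and r: "realized_by \<ss> \<delta> A X C x x'" "realized_by \<ss> (push C a \<delta>) B Y C y y'"
    and P: "is_biproduct X B P"
  shows "\<exists>h. \<guillemotleft>h : X \<rightarrow> Y\<guillemotright> \<and> h \<cdot> x = y \<cdot> a \<and> y' \<cdot> h = x' \<and>
    realized_by \<ss> (pull A y' \<delta>) A (bsum P) Y
      (in2 P \<cdot> a \<oplus> in1 P \<cdot> x) (h \<cdot> pr1 P \<oplus> \<ominus> (y \<cdot> pr2 P))"
proof -
  interpret op: octahedral3 "op_cat \<C>" "op_fun \<E>" "op_cor \<ss>" by (rule octahedral3_op)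
  let ?P = "Biprod (bsum P) (pr2 P) (pr1 P) (in2 P) (in1 P)"
  have "is_biproduct B X (op_biprod ?P)"
    using is_biproduct_swap[OF P] a realD(1)[OF r(1)] by (simp add: op_biprod_def)
  then show ?thesis
    using op.cone_of_octahedron[of a B A \<delta> C X x' x Y y' y ?P, unfolded opp op_cat_sel op_fun_sel] a r
    by simp metis
qed

lemma exangulated3: "exangulated3 \<C> \<E> \<ss>"
proof (intro exangulated3.intro exangulated3_axioms.intro exact_realization3_axioms)
  fix A B C D F f f' g g' \<delta> \<delta>'
  show "\<exists>E h' \<delta>''. realized_by \<ss> \<delta>'' A C E (g \<cdot> f) h'"
    if "realized_by \<ss> \<delta> A B D f f'" "realized_by \<ss> \<delta>' B C F g g'" using oct[OF that] by blast
  show "\<exists>E h' \<delta>''. realized_by \<ss> \<delta>'' E A C h' (g \<cdot> f)"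
    if "realized_by \<ss> \<delta> D A B f' f" "realized_by \<ss> \<delta>' F B C g' g" using oct_op[OF that] by blast
qed (fact cone_of_octahedron cocone_of_octahedron)+

end

section \<open>The case n = 1 of the definitions\<close>

context additive_category
begin

text \<open>For \<open>n = 1\<close> the range \<open>[1..<n]\<close> of the matrices is empty and
  there is a single direct sum, so that only the column and the row remain.\<close>

lemma mapping_cone_1:
  assumes "\<guillemotleft>x' : X \<rightarrow> C\<guillemotright>" "\<guillemotleft>y' : Y \<rightarrow> D\<guillemotright>" "\<guillemotleft>f 1 : X \<rightarrow> Y\<guillemotright>" "\<guillemotleft>f 2 : C \<rightarrow> D\<guillemotright>"
  shows "mapping_cone 1 (Sq [A, X, C] [x, x']) (Sq [B, Y, D] [y, y']) f =
    Sq [X, C \<oplus>\<oplus> Y, D] [\<ominus> (in1 (biprod C Y) \<cdot> x') \<oplus> in2 (biprod C Y) \<cdot> f 1,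
      f 2 \<cdot> pr1 (biprod C Y) \<oplus> y' \<cdot> pr2 (biprod C Y)]"
proof -
  have "inv\<^bsub>Mor \<C> X C\<^esub> x' = \<ominus> x'" using assms by (simp add: ng_def)
  then show ?thesis
    using assms biproductD(1,2)[OF is_biproduct_biprod, of C Y]
    by (simp add: mapping_cone_def upt_conv_Cons[of 1 2] one_add_one col_eq row_eq cat del: One_nat_def)
qed

lemma mapping_cocone_1:
  assumes "\<guillemotleft>x : A \<rightarrow> X\<guillemotright>" "\<guillemotleft>y : B \<rightarrow> Y\<guillemotright>" "\<guillemotleft>h 0 : A \<rightarrow> B\<guillemotright>" "\<guillemotleft>h 1 : X \<rightarrow> Y\<guillemotright>"
  shows "mapping_cocone 1 (Sq [A, X, C] [x, x']) (Sq [B, Y, D] [y, y']) h =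
    Sq [A, X \<oplus>\<oplus> B, Y] [in1 (biprod X B) \<cdot> x \<oplus> in2 (biprod X B) \<cdot> h 0,
      h 1 \<cdot> pr1 (biprod X B) \<oplus> \<ominus> (y \<cdot> pr2 (biprod X B))]"
proof -
  have "inv\<^bsub>Mor \<C> B Y\<^esub> y = \<ominus> y" using assms by (simp add: ng_def)
  then show ?thesis
    using assms biproductD(3,4)[OF is_biproduct_biprod, of X B]
    by (simp add: mapping_cocone_def upt_conv_Cons[of 1 2] one_add_one col_eq row_eq cat del: One_nat_def)
qed

end

context biadditive_functor
begin

lemma inflation_1_iff:
  "inflation 1 \<ss> A B f \<longleftrightarrow> (\<exists>C f' \<delta>. f' \<cdot> f = zmor A C \<and> realized_by \<ss> \<delta> A B C f f')"
proof
  assume "inflation 1 \<ss> A B f"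
  then obtain X \<delta> where X: "distinguished 1 \<ss> X \<delta>" "ob X 0 = A" "ob X 1 = B" "df X 0 = f"
    unfolding inflation_def by blast
  obtain A' B' C x y where "X = Sq [A', B', C] [x, y]" "y \<cdot> x = zmor A' C" "realized_by \<ss> \<delta> A' B' C x y"
    using X(1) unfolding distinguished_1_iff by blast
  then show "\<exists>C f' \<delta>. f' \<cdot> f = zmor A C \<and> realized_by \<ss> \<delta> A B C f f'"
    using X(2-) by (intro exI[of _ C] exI[of _ y] exI[of _ \<delta>]) simp
next
  assume "\<exists>C f' \<delta>. f' \<cdot> f = zmor A C \<and> realized_by \<ss> \<delta> A B C f f'"
  then obtain C f' \<delta> where "f' \<cdot> f = zmor A C" "realized_by \<ss> \<delta> A B C f f'" by blast
  then show "inflation 1 \<ss> A B f"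
    unfolding inflation_def distinguished_1_iff
    by (intro exI[of _ "Sq [A, B, C] [f, f']"] exI[of _ \<delta>]) simp
qed

lemma deflation_1_iff:
  "deflation 1 \<ss> B C f \<longleftrightarrow> (\<exists>A f' \<delta>. f \<cdot> f' = zmor A C \<and> realized_by \<ss> \<delta> A B C f' f)"
proof
  assume "deflation 1 \<ss> B C f"
  then obtain X \<delta> where X: "distinguished 1 \<ss> X \<delta>" "ob X 1 = B" "ob X 2 = C" "df X 1 = f"
    unfolding deflation_def one_add_one by blast
  obtain A B' C' x y where "X = Sq [A, B', C'] [x, y]" "y \<cdot> x = zmor A C'" "realized_by \<ss> \<delta> A B' C' x y"
    using X(1) unfolding distinguished_1_iff by blast
  then show "\<exists>A f' \<delta>. f \<cdot> f' = zmor A C \<and> realized_by \<ss> \<delta> A B C f' f"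
    using X(2-) by (intro exI[of _ A] exI[of _ x] exI[of _ \<delta>]) simp
next
  assume "\<exists>A f' \<delta>. f \<cdot> f' = zmor A C \<and> realized_by \<ss> \<delta> A B C f' f"
  then obtain A f' \<delta> where "f \<cdot> f' = zmor A C" "realized_by \<ss> \<delta> A B C f' f" by blast
  then show "deflation 1 \<ss> B C f"
    unfolding deflation_def distinguished_1_iff
    by (intro exI[of _ "Sq [A, B, C] [f', f]"] exI[of _ \<delta>]) simp
qed

end

lemma exangulated3_if_1_exangulated:
  assumes "n_exangulated_category \<C> \<E> 1 \<ss>"
  shows "exangulated3 \<C> \<E> \<ss>"
proof -
  interpret n_exangulated_category \<C> \<E> 1 \<ss> by (rule assms)
  have ex: "\<exists>B x y. y \<cdot> x = zmor A C \<and> realized_by \<ss> \<delta> A B C x y"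
    if \<delta>: "C \<in> Obj \<C>" "A \<in> Obj \<C>" "\<delta> \<in> ext C A" for C A \<delta>
  proof -
    obtain X where X: "is_complex_AC 1 A C X" "\<ss> C A \<delta> = homotopy_class 1 X"
      using realization_class[OF \<delta>] by blast
    then obtain A' B C' x y where X': "X = Sq [A', B, C'] [x, y]"
      unfolding is_complex_AC_def is_complex_1_iff by blast
    have "A' = A" "C' = C"
      using X(1) unfolding is_complex_AC_def X' by (simp_all add: one_add_one del: One_nat_def)
    moreover have "distinguished 1 \<ss> X \<delta>"
      using X \<delta> unfolding distinguished_def is_complex_AC_def by simp
    ultimately show ?thesis unfolding distinguished_1_iff X' by blast
  qed
  \<comment> \<open>A class \<open>equiv_class3\<close> records no relation between \<open>x\<close>
    and \<open>y\<close>. But the class of \<delta> contains a complex, and the comparison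
    isomorphism carries the vanishing of its composite over.\<close>
  have comp: "y \<cdot> x = zmor A C" if r: "realized_by \<ss> \<delta> A B C x y" for \<delta> A B C x y
  proof -
    note X = realized_byD[OF r]
    obtain B' x' y' where r': "y' \<cdot> x' = zmor A C" "realized_by \<ss> \<delta> A B' C x' y'"
      using ex X by blast
    obtain b where b: "is_iso B B' b" "b \<cdot> x = x'" "y' \<cdot> b = y" using realized_by_unique[OF r r'(2)] by blast
    have "\<guillemotleft>b : B \<rightarrow> B'\<guillemotright>" using isoE[OF b(1)] X realized_byD[OF r'(2)] by blast
    then show ?thesis
      using r'(1) X(1) realized_byD(2)[OF r'(2)] unfolding b(2,3)[symmetric] by (simp add: cat)
  qed
  have dist: "distinguished 1 \<ss> (Sq [A, B, C] [x, y]) \<delta>" if "realized_by \<ss> \<delta> A B C x y" for \<delta> A B C x y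
    using that comp[OF that] unfolding distinguished_1_iff by blast
  have real: "realized_by \<ss> \<delta> A B C x y" if "distinguished 1 \<ss> (Sq [A, B, C] [x, y]) \<delta>" for \<delta> A B C x y
    using that unfolding distinguished_1_iff by blast
  have exact: "lexact A B C x y \<delta> \<and> rexact A B C x y \<delta>" if "realized_by \<ss> \<delta> A B C x y" for \<delta> A B C x y
    using R1[OF dist[OF that]] exangle_1_iff realized_byD[OF that] by blast
  show ?thesis
  proof (intro exangulated3.intro exact_realization3.intro exact_realization3_axioms.intro
      exangulated3_axioms.intro biadditive_functor_axioms)
    show "\<exists>B x y. realized_by \<ss> \<delta> A B C x y" if "C \<in> Obj \<C>" "A \<in> Obj \<C>" "\<delta> \<in> ext C A" for C A \<delta>
      using ex[OF that] by blast
    show "lexact A B C x y \<delta>" "rexact A B C x y \<delta>" if "realized_by \<ss> \<delta> A B C x y" for A B C x y \<delta>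
      using exact[OF that] by blast+
  next
    fix A B C x y \<delta> A' B' C' x' y' \<delta>' a c
    assume r: "realized_by \<ss> \<delta> A B C x y" "realized_by \<ss> \<delta>' A' B' C' x' y'"
      and ac: "\<guillemotleft>a : A \<rightarrow> A'\<guillemotright>" "\<guillemotleft>c : C \<rightarrow> C'\<guillemotright>" "push C a \<delta> = pull A' c \<delta>'"
    have "ext_morphism C A \<delta> C' A' \<delta>' a c" using ac ext_morphism_iff by blast
    then obtain f where "is_lift 1 (Sq [A, B, C] [x, y]) (Sq [A', B', C'] [x', y']) a c f"
      using R0[OF dist[OF r(1)] dist[OF r(2)], of a c] by (auto simp: one_add_one simp del: One_nat_def)
    then show "\<exists>b. \<guillemotleft>b : B \<rightarrow> B'\<guillemotright> \<and> b \<cdot> x = x' \<cdot> a \<and> y' \<cdot> b = c \<cdot> y"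
      unfolding is_lift_def one_add_one
        chain_map_1_iff[OF realized_byD(1,2)[OF r(1)] realized_byD(1,2)[OF r(2)]]
      by metis
  next
    fix A B C D F f f' g g' \<delta> \<delta>'
    show "\<exists>E h' \<delta>''. realized_by \<ss> \<delta>'' A C E (g \<cdot> f) h'"
      if r: "realized_by \<ss> \<delta> A B D f f'" "realized_by \<ss> \<delta>' B C F g g'"
      using EA1_inflation[of A B f C g] comp[OF r(1)] comp[OF r(2)] r unfolding inflation_1_iff by blast
    show "\<exists>E h' \<delta>''. realized_by \<ss> \<delta>'' E A C h' (g \<cdot> f)"
      if r: "realized_by \<ss> \<delta> D A B f' f" "realized_by \<ss> \<delta>' F B C g' g"
      using EA1_deflation[of A B f C g] comp[OF r(1)] comp[OF r(2)] r unfolding deflation_1_iff by blast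
  next
    fix A C D X Y \<rho> c x x' y y' P
    assume c: "\<guillemotleft>c : C \<rightarrow> D\<guillemotright>" and r: "realized_by \<ss> \<rho> A Y D y y'" "realized_by \<ss> (pull A c \<rho>) A X C x x'"
      and bP: "is_biproduct C Y P"
    note y = realized_byD[OF r(1)] and x = realized_byD[OF r(2)]
    have Obj: "A \<in> Obj \<C>" "C \<in> Obj \<C>" "D \<in> Obj \<C>" "X \<in> Obj \<C>" "Y \<in> Obj \<C>" using x y by simp_all
    let ?X = "Sq [A, X, C] [x, x']" and ?Y = "Sq [A, Y, D] [y, y']" and ?B = "biprod C Y"
    obtain f where f: "is_lift 1 ?X ?Y (Idn \<C> A) c f"
      "distinguished 1 \<ss> (mapping_cone 1 ?X ?Y f) (push D x \<rho>)"
      using EA2[OF Obj(1-3) y(3), of c ?X ?Y] dist[OF r(1)] dist[OF r(2)] c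
      by (auto simp: one_add_one simp del: One_nat_def)
    have f': "f 0 = Idn \<C> A" "f 2 = c" "\<guillemotleft>f 1 : X \<rightarrow> Y\<guillemotright>" "f 1 \<cdot> x = y \<cdot> f 0" "f 2 \<cdot> x' = y' \<cdot> f 1"
      using f(1) unfolding is_lift_def one_add_one chain_map_1_iff[OF x(1,2) y(1,2)] by blast+
    have R: "realized_by \<ss> (push D x \<rho>) X (C \<oplus>\<oplus> Y) D (\<ominus> (in1 ?B \<cdot> x') \<oplus> in2 ?B \<cdot> f 1) (c \<cdot> pr1 ?B \<oplus> y' \<cdot> pr2 ?B)"
      using real f(2) mapping_cone_1[of x' X C y' Y D f A x A y] x(2) y(2) f'(2,3) c by simp
    have bB: "is_biproduct C Y ?B" using is_biproduct_biprod Obj by blast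
    note P = biproductD[OF bP Obj(2,5)] and B = biproductD[OF bB Obj(2,5)]
    \<comment> \<open>(EA2) speaks of the chosen biproduct; the canonical isomorphism between
      biproducts moves its realization to \<open>P\<close>.\<close>
    have "realized_by \<ss> (push D x \<rho>) X (bsum P) D (in2 P \<cdot> f 1 \<oplus> \<ominus> (in1 P \<cdot> x')) (c \<cdot> pr1 P \<oplus> y' \<cdot> pr2 P)"
      by (rule realized_by_iso[OF R biproduct_unique_up_to_iso[OF bB bP Obj(2,5)]])
        (use P(1-8,10-) B(1-8,10-) x(2) y(2) f'(3) c in \<open>simp_all add: cat pls_ac\<close>)
    then show "\<exists>f. \<guillemotleft>f : X \<rightarrow> Y\<guillemotright> \<and> f \<cdot> x = y \<and> y' \<cdot> f = c \<cdot> x' \<and>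
        realized_by \<ss> (push D x \<rho>) X (bsum P) D (in2 P \<cdot> f \<oplus> \<ominus> (in1 P \<cdot> x')) (c \<cdot> pr1 P \<oplus> y' \<cdot> pr2 P)"
      using f' y(1) by (intro exI[of _ "f 1"]) (simp add: cat)
  next
    fix A B C X Y \<delta> a x x' y y' P
    assume a: "\<guillemotleft>a : A \<rightarrow> B\<guillemotright>" and r: "realized_by \<ss> \<delta> A X C x x'" "realized_by \<ss> (push C a \<delta>) B Y C y y'"
      and bP: "is_biproduct X B P"
    note x = realized_byD[OF r(1)] and y = realized_byD[OF r(2)]
    have Obj: "A \<in> Obj \<C>" "B \<in> Obj \<C>" "C \<in> Obj \<C>" "X \<in> Obj \<C>" "Y \<in> Obj \<C>" using x y by simp_all
    let ?X = "Sq [A, X, C] [x, x']" and ?Y = "Sq [B, Y, C] [y, y']" and ?B = "biprod X B"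
    obtain h where h: "is_lift 1 ?X ?Y a (Idn \<C> C) h"
      "distinguished 1 \<ss> (mapping_cocone 1 ?X ?Y h) (pull A y' \<delta>)"
      using EA2_op[OF Obj(1-3) x(3), of a ?X ?Y] dist[OF r(1)] dist[OF r(2)] a
      by (auto simp: one_add_one simp del: One_nat_def)
    have h': "h 0 = a" "h 2 = Idn \<C> C" "\<guillemotleft>h 1 : X \<rightarrow> Y\<guillemotright>" "h 1 \<cdot> x = y \<cdot> h 0" "h 2 \<cdot> x' = y' \<cdot> h 1"
      using h(1) unfolding is_lift_def one_add_one chain_map_1_iff[OF x(1,2) y(1,2)] by blast+
    have R: "realized_by \<ss> (pull A y' \<delta>) A (X \<oplus>\<oplus> B) Y (in1 ?B \<cdot> x \<oplus> in2 ?B \<cdot> a) (h 1 \<cdot> pr1 ?B \<oplus> \<ominus> (y \<cdot> pr2 ?B))"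
      using real h(2) mapping_cocone_1[of x A X y B Y h C x' C y'] x(1) y(1) h'(1,3) a by simp
    have bB: "is_biproduct X B ?B" using is_biproduct_biprod Obj by blast
    note P = biproductD[OF bP Obj(4,2)] and B = biproductD[OF bB Obj(4,2)]
    have "realized_by \<ss> (pull A y' \<delta>) A (bsum P) Y (in2 P \<cdot> a \<oplus> in1 P \<cdot> x) (h 1 \<cdot> pr1 P \<oplus> \<ominus> (y \<cdot> pr2 P))"
      by (rule realized_by_iso[OF R biproduct_unique_up_to_iso[OF bB bP Obj(4,2)]])
        (use P(1-8,10-) B(1-8,10-) x(1) y(1) h'(3) a in \<open>simp_all add: cat pls_ac\<close>)
    then show "\<exists>h. \<guillemotleft>h : X \<rightarrow> Y\<guillemotright> \<and> h \<cdot> x = y \<cdot> a \<and> y' \<cdot> h = x' \<and>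
        realized_by \<ss> (pull A y' \<delta>) A (bsum P) Y (in2 P \<cdot> a \<oplus> in1 P \<cdot> x) (h \<cdot> pr1 P \<oplus> \<ominus> (y \<cdot> pr2 P))"
      using h' x(2) by (intro exI[of _ "h 1"]) (simp add: cat)
  qed
qed

context exangulated3
begin

lemma distinguished_1_Sq: "distinguished 1 \<ss> (Sq [A, B, C] [x, y]) \<delta> \<longleftrightarrow> realized_by \<ss> \<delta> A B C x y"
  unfolding distinguished_1_iff using realD(4) by blast

lemma inflation_1: "inflation 1 \<ss> A B f \<longleftrightarrow> (\<exists>C f' \<delta>. realized_by \<ss> \<delta> A B C f f')"
  and deflation_1: "deflation 1 \<ss> B C f \<longleftrightarrow> (\<exists>A f' \<delta>. realized_by \<ss> \<delta> A B C f' f)"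
  unfolding inflation_1_iff deflation_1_iff by (metis realD(4))+

lemma distinguished_1_cases:
  assumes "distinguished 1 \<ss> X \<delta>"
  obtains A B C x y where "X = Sq [A, B, C] [x, y]" "realized_by \<ss> \<delta> A B C x y"
  using assms unfolding distinguished_1_iff by blast

lemma distinguished_1_ends:
  assumes "distinguished 1 \<ss> X \<delta>" "ob X 0 = A" "ob X (1 + 1) = C"
  obtains B x y where "X = Sq [A, B, C] [x, y]" "realized_by \<ss> \<delta> A B C x y"
proof -
  obtain A' B C' x y where X: "X = Sq [A', B, C'] [x, y]" "realized_by \<ss> \<delta> A' B C' x y"
    using distinguished_1_cases[OF assms(1)] .
  then have "A' = A" "C' = C" using assms(2,3) by simp_all
  then show ?thesis using that X by blast
qed

lemma realized_by_homotopy_class: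
  assumes "realized_by \<ss> \<delta> A B C x y"
  shows "\<ss> C A \<delta> = homotopy_class 1 (Sq [A, B, C] [x, y])"
  using assms homotopy_class_1[OF realD(1,2,4)[OF assms]] by (simp add: realized_by_def)

lemma is_lift_1:
  assumes "realized_by \<ss> \<delta> A B C x y" "realized_by \<ss> \<delta>' A' B' C' x' y'" "\<guillemotleft>a : A \<rightarrow> A'\<guillemotright>" "\<guillemotleft>c : C \<rightarrow> C'\<guillemotright>"
    and "\<guillemotleft>b : B \<rightarrow> B'\<guillemotright>" "b \<cdot> x = x' \<cdot> a" "y' \<cdot> b = c \<cdot> y"
  shows "is_lift 1 (Sq [A, B, C] [x, y]) (Sq [A', B', C'] [x', y']) a c
    (\<lambda>i. if i = 0 then a else if i = 1 then b else c)"
  unfolding is_lift_def chain_map_1_iff[OF realD(1,2)[OF assms(1)] realD(1,2)[OF assms(2)]]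
  using assms(3-) by simp

theorem n_exangulated_1: "n_exangulated_category \<C> \<E> 1 \<ss>"
proof (intro n_exangulated_category.intro exact_realization.intro exact_realization_axioms.intro
    n_exangulated_category_axioms.intro biadditive_functor_axioms)
  show "(1::nat) \<ge> 1" by simp
next
  fix C A \<delta> assume \<delta>: "C \<in> Obj \<C>" "A \<in> Obj \<C>" "\<delta> \<in> ext C A"
  then obtain B x y where r: "realized_by \<ss> \<delta> A B C x y" using real_ex by blast
  have "is_complex 1 (Sq [A, B, C] [x, y])" using realD[OF r] is_complex_1_iff by blast
  then show "\<exists>X. is_complex_AC 1 A C X \<and> \<ss> C A \<delta> = homotopy_class 1 X"
    using realized_by_homotopy_class[OF r]
    by (intro exI[of _ "Sq [A, B, C] [x, y]"]) (simp add: is_complex_AC_def one_add_one del: One_nat_def)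
next
  fix X Y \<delta> \<rho> a c
  assume d: "distinguished 1 \<ss> X \<delta>" "distinguished 1 \<ss> Y \<rho>"
    and m: "ext_morphism (ob X (1 + 1)) (ob X 0) \<delta> (ob Y (1 + 1)) (ob Y 0) \<rho> a c"
  obtain A B C x y where X: "X = Sq [A, B, C] [x, y]" "realized_by \<ss> \<delta> A B C x y"
    using distinguished_1_cases[OF d(1)] .
  obtain A' B' C' x' y' where Y: "Y = Sq [A', B', C'] [x', y']" "realized_by \<ss> \<rho> A' B' C' x' y'"
    using distinguished_1_cases[OF d(2)] .
  have "ext_morphism C A \<delta> C' A' \<rho> a c" using m X Y by (simp add: one_add_one del: One_nat_def)
  then have ac: "\<guillemotleft>a : A \<rightarrow> A'\<guillemotright>" "\<guillemotleft>c : C \<rightarrow> C'\<guillemotright>" "push C a \<delta> = pull A' c \<rho>"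
    using ext_morphism_iff[of A A' C C'] realD(1,2)[OF X(2)] realD(1,2)[OF Y(2)] by simp_all
  then show "\<exists>f. is_lift 1 X Y a c f"
    using real_lift[OF X(2) Y(2) ac] is_lift_1[OF X(2) Y(2) ac(1,2)] unfolding X(1) Y(1) by blast
next
  fix X \<delta> assume "distinguished 1 \<ss> X \<delta>"
  then obtain A B C x y where X: "X = Sq [A, B, C] [x, y]" "realized_by \<ss> \<delta> A B C x y"
    by (rule distinguished_1_cases)
  then show "exangle 1 X \<delta>"
    using exangle_1_iff[OF realD(1,2)[OF X(2)]] real_lexact real_rexact by blast
next
  fix A Z assume AZ: "A \<in> Obj \<C>" "is_zero_object Z"
  show "\<ss> Z A (zext Z A) = homotopy_class 1
      (Sq (A # A # replicate 1 Z) (Idn \<C> A # zmor A Z # replicate (1 - 1) (zmor Z Z)))"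
    using realized_by_homotopy_class[OF realized_by_zero(1)[OF AZ(2,1)]] by simp
  show "\<ss> A Z (zext A Z) = homotopy_class 1
      (Sq (replicate 1 Z @ [A, A]) (replicate (1 - 1) (zmor Z Z) @ [zmor Z A, Idn \<C> A]))"
    using realized_by_homotopy_class[OF realized_by_zero(2)[OF AZ(2,1)]] by simp
next
  fix A B C f g
  show "inflation 1 \<ss> A C (g \<cdot> f)" if "inflation 1 \<ss> A B f" "inflation 1 \<ss> B C g"
    using that cmp_inflations unfolding inflation_1 by (elim exE) blast
  show "deflation 1 \<ss> A C (g \<cdot> f)" if "deflation 1 \<ss> A B f" "deflation 1 \<ss> B C g"
    using that cmp_deflations unfolding deflation_1 by (elim exE) blast
next
  fix A C D \<rho> c X Y
  assume Obj: "A \<in> Obj \<C>" "C \<in> Obj \<C>" "D \<in> Obj \<C>" and c: "c \<in> arr C D"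
    and X: "ob X 0 = A" "ob X (1 + 1) = C" "distinguished 1 \<ss> X (pull A c \<rho>)"
    and Y: "ob Y 0 = A" "ob Y (1 + 1) = D" "distinguished 1 \<ss> Y \<rho>"
  have c': "\<guillemotleft>c : C \<rightarrow> D\<guillemotright>" using is_arrI Obj c by blast
  obtain B1 x x' where X': "X = Sq [A, B1, C] [x, x']" and rX: "realized_by \<ss> (pull A c \<rho>) A B1 C x x'"
    using distinguished_1_ends[OF X(3,1,2)] .
  obtain B2 y y' where Y': "Y = Sq [A, B2, D] [y, y']" and rY: "realized_by \<ss> \<rho> A B2 D y y'"
    using distinguished_1_ends[OF Y(3,1,2)] .
  note x = realD[OF rX] and y = realD[OF rY]
  have bP: "is_biproduct C B2 (biprod C B2)" using is_biproduct_biprod x y by blast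
  obtain f where f: "\<guillemotleft>f : B1 \<rightarrow> B2\<guillemotright>" "f \<cdot> x = y" "y' \<cdot> f = c \<cdot> x'"
    "realized_by \<ss> (push D x \<rho>) B1 (C \<oplus>\<oplus> B2) D
      (in2 (biprod C B2) \<cdot> f \<oplus> \<ominus> (in1 (biprod C B2) \<cdot> x')) (c \<cdot> pr1 (biprod C B2) \<oplus> y' \<cdot> pr2 (biprod C B2))"
    using cone[OF c' rY rX bP] by blast
  let ?f = "\<lambda>i::nat. if i = 0 then Idn \<C> A else if i = 1 then f else c"
  have "is_lift 1 X Y (Idn \<C> A) c ?f"
    unfolding X' Y' using f c' x(1) y(1) by (intro is_lift_1[OF rX rY]) (simp_all add: cat)
  moreover have "distinguished 1 \<ss> (mapping_cone 1 X Y ?f) (push D (df X 0) \<rho>)"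
    unfolding X' Y' using f(1,4) c' x(2) y(2) biproductD(1-4)[OF bP]
    by (simp add: mapping_cone_1 distinguished_1_Sq cat pls_commute del: One_nat_def)
  ultimately show "\<exists>f. is_lift 1 X Y (Idn \<C> A) c f \<and>
      distinguished 1 \<ss> (mapping_cone 1 X Y f) (push D (df X 0) \<rho>)" by blast
next
  fix A B C \<delta> a X Y
  assume Obj: "A \<in> Obj \<C>" "B \<in> Obj \<C>" "C \<in> Obj \<C>" and a: "a \<in> arr A B"
    and X: "ob X 0 = A" "ob X (1 + 1) = C" "distinguished 1 \<ss> X \<delta>"
    and Y: "ob Y 0 = B" "ob Y (1 + 1) = C" "distinguished 1 \<ss> Y (push C a \<delta>)"
  have a': "\<guillemotleft>a : A \<rightarrow> B\<guillemotright>" using is_arrI Obj a by blast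
  obtain B1 x x' where X': "X = Sq [A, B1, C] [x, x']" and rX: "realized_by \<ss> \<delta> A B1 C x x'"
    using distinguished_1_ends[OF X(3,1,2)] .
  obtain B2 y y' where Y': "Y = Sq [B, B2, C] [y, y']" and rY: "realized_by \<ss> (push C a \<delta>) B B2 C y y'"
    using distinguished_1_ends[OF Y(3,1,2)] .
  note x = realD[OF rX] and y = realD[OF rY]
  have bP: "is_biproduct B1 B (biprod B1 B)" using is_biproduct_biprod x y by blast
  obtain h where h: "\<guillemotleft>h : B1 \<rightarrow> B2\<guillemotright>" "h \<cdot> x = y \<cdot> a" "y' \<cdot> h = x'"
    "realized_by \<ss> (pull A y' \<delta>) A (B1 \<oplus>\<oplus> B) B2
      (in2 (biprod B1 B) \<cdot> a \<oplus> in1 (biprod B1 B) \<cdot> x) (h \<cdot> pr1 (biprod B1 B) \<oplus> \<ominus> (y \<cdot> pr2 (biprod B1 B)))"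
    using cocone[OF a' rX rY bP] by blast
  let ?h = "\<lambda>i::nat. if i = 0 then a else if i = 1 then h else Idn \<C> C"
  have "is_lift 1 X Y a (Idn \<C> C) ?h"
    unfolding X' Y' using h a' x(2) y(2) by (intro is_lift_1[OF rX rY]) (simp_all add: cat)
  moreover have "distinguished 1 \<ss> (mapping_cocone 1 X Y ?h) (pull A (df Y 1) \<delta>)"
    unfolding X' Y' using h(1,4) a' x(1) y(1) biproductD(1-4)[OF bP]
    by (simp add: mapping_cocone_1 distinguished_1_Sq cat pls_commute del: One_nat_def)
  ultimately show "\<exists>h. is_lift 1 X Y a (Idn \<C> C) h \<and>
      distinguished 1 \<ss> (mapping_cocone 1 X Y h) (pull A (df Y 1) \<delta>)" by blast
qed

end

lemma octahedral3_if_extriangulated: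
  assumes "extriangulated_category \<C> \<E> \<ss>"
  shows "octahedral3 \<C> \<E> \<ss>"
proof -
  interpret extriangulated_category \<C> \<E> \<ss> by (rule assms)
  have split: "realized_by \<ss> (zext C A) A (A \<oplus>\<oplus> C) C (in1 (biprod A C)) (pr2 (biprod A C))"
    if "A \<in> Obj \<C>" "C \<in> Obj \<C>" for A C
  proof -
    note B = biproductD[OF is_biproduct_biprod[OF that] that]
    have "col A A C (Idn \<C> A) (zmor A C) = in1 (biprod A C)" "row A C C (zmor A C) (Idn \<C> C) = pr2 (biprod A C)"
      using that B(1-4) by (simp_all add: col_eq row_eq cat)
    then show ?thesis
      using ET2_ii[OF that] that B(1-4) by (simp add: realized_by_def is_seq3_iff cat)
  qed
  have arrs: "\<guillemotleft>b : A \<rightarrow> B\<guillemotright>" if "b \<in> arr A B" "A \<in> Obj \<C>" "B \<in> Obj \<C>" for b A B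
    using that is_arrI by blast
  have "pre_extriangulated \<C> \<E> \<ss>"
  proof (intro pre_extriangulated.intro pre_extriangulated_axioms.intro biadditive_functor_axioms)
    show "\<exists>B x y. realized_by \<ss> \<delta> A B C x y" if "C \<in> Obj \<C>" "A \<in> Obj \<C>" "\<delta> \<in> ext C A" for C A \<delta>
      using ET2_class[OF that] that unfolding realized_by_def by blast
  next
    fix A Z assume Z: "is_zero_object Z" and A: "A \<in> Obj \<C>"
    have Z': "Z \<in> Obj \<C>" using zero_object_Idn[OF Z] by blast
    note B = biproductD[OF is_biproduct_biprod[OF A Z'] A Z'] and B' = biproductD[OF is_biproduct_biprod[OF Z' A] Z' A]
    have z: "in2 (biprod A Z) = zmor Z (A \<oplus>\<oplus> Z)" "pr2 (biprod A Z) = zmor (A \<oplus>\<oplus> Z) Z"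
      "in1 (biprod Z A) = zmor Z (Z \<oplus>\<oplus> A)" "pr1 (biprod Z A) = zmor (Z \<oplus>\<oplus> A) Z"
      using zero_object_mor[OF Z] B(1-4) B'(1-4) by metis+
    \<comment> \<open>With a zero summand the second term drops out of the decomposition of the
      identity, so \<open>in1\<close> and \<open>pr1\<close> are mutually inverse and the split
      sequence becomes \<open>A -> A -> 0\<close>.\<close>
    have "is_iso (A \<oplus>\<oplus> Z) A (pr1 (biprod A Z))"
      using B(1-9) by (intro isoI[of _ _ _ "in1 (biprod A Z)"]) (simp_all add: cat z)
    from realized_by_iso[OF split[OF A Z'] this B(5)]
    show "realized_by \<ss> (zext Z A) A A Z (Idn \<C> A) (zmor A Z)" using A Z' B(3) z(2) by (simp add: cat)
    have "is_iso (Z \<oplus>\<oplus> A) A (pr2 (biprod Z A))"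
      using B'(1-9) by (intro isoI[of _ _ _ "in2 (biprod Z A)"]) (simp_all add: cat z)
    from realized_by_iso[OF split[OF Z' A] this B'(7)]
    show "realized_by \<ss> (zext A Z) Z A A (zmor Z A) (Idn \<C> A)" using A Z' B'(4) by (simp add: cat)
  next
    fix A B C x y \<delta> A' B' C' x' y' \<delta>'
    assume r: "realized_by \<ss> \<delta> A B C x y" "realized_by \<ss> \<delta>' A' B' C' x' y'"
    have Obj: "A \<in> Obj \<C>" "B \<in> Obj \<C>" "C \<in> Obj \<C>" "A' \<in> Obj \<C>" "B' \<in> Obj \<C>" "C' \<in> Obj \<C>"
      using realized_byD[OF r(1)] realized_byD[OF r(2)] by simp_all
    show "\<exists>b. \<guillemotleft>b : B \<rightarrow> B'\<guillemotright> \<and> b \<cdot> x = x' \<cdot> a \<and> y' \<cdot> b = c \<cdot> y"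
      if "\<guillemotleft>a : A \<rightarrow> A'\<guillemotright>" "\<guillemotleft>c : C \<rightarrow> C'\<guillemotright>" "push C a \<delta> = pull A' c \<delta>'" for a c
    proof -
      have "ext_morphism C A \<delta> C' A' \<delta>' a c" using that ext_morphism_iff by blast
      then show ?thesis using ET2_i[OF r] arrs[OF _ Obj(2,5)] by blast
    qed
    show "\<exists>c. \<guillemotleft>c : C \<rightarrow> C'\<guillemotright> \<and> push C a \<delta> = pull A' c \<delta>' \<and> c \<cdot> y = y' \<cdot> b"
      if ab: "\<guillemotleft>a : A \<rightarrow> A'\<guillemotright>" "\<guillemotleft>b : B \<rightarrow> B'\<guillemotright>" "b \<cdot> x = x' \<cdot> a" for a b
    proof -
      obtain c where "ext_morphism C A \<delta> C' A' \<delta>' a c" "c \<cdot> y = y' \<cdot> b"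
        using ET3[OF r _ _ ab(3)] ab(1,2) by auto
      then show ?thesis using ext_morphism_iff[OF Obj(1,4,3,6)] by blast
    qed
    show "\<exists>a. \<guillemotleft>a : A \<rightarrow> A'\<guillemotright> \<and> push C a \<delta> = pull A' c \<delta>' \<and> b \<cdot> x = x' \<cdot> a"
      if cb: "\<guillemotleft>c : C \<rightarrow> C'\<guillemotright>" "\<guillemotleft>b : B \<rightarrow> B'\<guillemotright>" "c \<cdot> y = y' \<cdot> b" for c b
    proof -
      obtain a where "ext_morphism C A \<delta> C' A' \<delta>' a c" "b \<cdot> x = x' \<cdot> a"
        using ET3_op[OF r _ _ cb(3)] cb(1,2) by auto
      then show ?thesis using ext_morphism_iff[OF Obj(1,4,3,6)] by blast
    qed
  qed
  then show ?thesis
    by (intro octahedral3.intro octahedral3_axioms.intro pre_extriangulated.exact_realization3 ET4 ET4_op)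
qed

text \<open>\<open>exangulated3\<close> mediates: each of the two notions implies it, the
  extriangulated one by way of \<open>octahedral3\<close>, and it implies both.\<close>

theorem proposition4p3:
  fixes \<C> :: "('o, 'm) precat"
    and \<E> :: "('o, 'm, 'e) bifunctor"
    and \<ss> :: "('o, 'm, 'e) correspondence"
  assumes "additive_category \<C>"
    and "biadditive_functor \<C> \<E>"
    and "\<And>C A \<delta>. \<lbrakk>C \<in> Obj \<C>; A \<in> Obj \<C>; \<delta> \<in> carrier (Ext \<E> C A)\<rbrakk>
          \<Longrightarrow> \<ss> C A \<delta> \<subseteq> {Sq [A, B, C] [x, y] | B x y.
                B \<in> Obj \<C> \<and> x \<in> carrier (Mor \<C> A B) \<and> y \<in> carrier (Mor \<C> B C)}"
  shows "n_exangulated_category \<C> \<E> 1 \<ss> \<longleftrightarrow> extriangulated_category \<C> \<E> \<ss>"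
  using exangulated3_if_1_exangulated exangulated3.extriangulated octahedral3_if_extriangulated
    octahedral3.exangulated3 exangulated3.n_exangulated_1 by metis

end
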